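(* Let $G$ be a reductive group over $\mathbb{C}$, let $A$ be a $G$-algebra with $A_1\cong V$, and let $k\geq 2$. Then the $G$-deformations up to degree $k$ of $A$ are parametrized by a projective variety: the set $\mathbf{V}_k$ (defined in the context) is a Zariski closed subset of the product of Grassmannians $\prod_{j=2}^{k}\prod_{i} \mathrm{Grass}(f_{j,i},a_{j,i})$.
   Context: All algebras are positively graded connected $\mathbb{C}$-algebras $A=\mathbb{C}\oplus A_1\oplus A_2\oplus\cdots$ generated by $A_1$, with $\dim A_1<\infty$. Varieties are not assumed irreducible. $G$ is a reductive group acting faithfully (by a finite dimensional algebraic representation) on $V$. A $G$-algebra is such a graded algebra $A$ on which $G$ acts by gradation preserving algebra automorphisms; thus $A=T(V)/R$ with $V=A_1$ and $R$ a homogeneous, $G$-stable two-sided ideal of the tensor algebra $T(V)$, generated in degrees $\geq 2$. A $G$-deformation of $A$ up to degree $k$ is a $G$-algebra $B$ with $B_1\cong V$ and $B_i\cong A_i$ as $G$-representations for all $0\le i\le k$. For $j\geq 2$ let $\phi_j:T(V)_j=V^{\otimes j}\to A_j$ be the natural projection. Write $T(V)_j\cong\bigoplus_i S_{j,i}^{\oplus a_{j,i}}$ with $S_{j,i}$ pairwise non-isomorphic simple $G$-representations, and $\ker(\phi_j)\cong\bigoplus_i S_{j,i}^{\oplus f_{j,i}}$ (with $0\le f_{j,i}\leq a_{j,i}$). By Schur's lemma the set of $G$-subrepresentations of $V^{\otimes j}$ isomorphic to $\ker(\phi_j)$ is identified with $\prod_i\mathrm{Grass}(f_{j,i},a_{j,i})$,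 where $\mathrm{Grass}(f,a)$ is the Grassmannian of $f$-dimensional subspaces of $\mathbb{C}^a$. The set $\mathbf{V}_k$ parametrizing $G$-deformations of $A$ up to degree $k$ is the set of tuples $(P_2,\dots,P_k)$, where $P_j\subset V^{\otimes j}$ is a $G$-subrepresentation isomorphic to $\ker(\phi_j)$ for each $j$, such that $V^{\otimes l}\otimes P_i\otimes V^{\otimes (j-i-l)}\subset P_j$ for all $2\leq i\le j\leq k$ and $0\leq l\leq j-i$ (that is, $P_2,\dots,P_k$ are the degree $2,\dots,k$ components of the ideal of relations of a $G$-deformation up to degree $k$). *)

theory Defs
  imports
    "Jordan_Normal_Form.Determinant"
    "HOL-Library.Function_Algebras"
    "HOL-Library.FuncSet"
begin

section \<open>Complex function spaces\<close>

definition fscale :: "complex \<Rightarrow> ('x \<Rightarrow> complex) \<Rightarrow> 'x \<Rightarrow> complex" where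
  "fscale c f = (\<lambda>x. c * f x)"

global_interpretation fn: vector_space "fscale :: complex \<Rightarrow> ('x \<Rightarrow> complex) \<Rightarrow> 'x \<Rightarrow> complex"
  by standard (simp_all add: fscale_def fun_eq_iff algebra_simps)

text \<open>\<^term>\<open>cspace a\<close> is $\mathbb{C}^a$, realised as functions supported on the indices below $a$.\<close>

definition cspace :: "nat \<Rightarrow> (nat \<Rightarrow> complex) set" where
  "cspace a = {x. \<forall>i\<ge>a. x i = 0}"

definition unit_vector :: "nat \<Rightarrow> nat \<Rightarrow> complex" where
  "unit_vector i = (\<lambda>t. if t = i then 1 else 0)"

text \<open>Over the infinite field of complex numbers polynomials are the same as polynomial functions.
  The set \<open>I\<close> contains the variables that may occur.\<close>

inductive_set polyfun :: "'i set \<Rightarrow> (('i \<Rightarrow> complex) \<Rightarrow> complex) set" for I :: "'i set" where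
  const: "(\<lambda>_. c) \<in> polyfun I"
| var: "i \<in> I \<Longrightarrow> (\<lambda>x. x i) \<in> polyfun I"
| add: "p \<in> polyfun I \<Longrightarrow> q \<in> polyfun I \<Longrightarrow> (\<lambda>x. p x + q x) \<in> polyfun I"
| mult: "p \<in> polyfun I \<Longrightarrow> q \<in> polyfun I \<Longrightarrow> (\<lambda>x. p x * q x) \<in> polyfun I"


section \<open>Linear algebraic groups and their representations\<close>

abbreviation GL :: "nat \<Rightarrow> complex mat monoid" where
  "GL m \<equiv> units_of (ring_mat TYPE(complex) m ())"

definition matrix_entries :: "complex mat \<Rightarrow> nat \<times> nat \<Rightarrow> complex" where
  "matrix_entries g = (\<lambda>ij. g $$ ij)"

definition linear_algebraic_group :: "nat \<Rightarrow> complex mat set \<Rightarrow> bool" where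
  "linear_algebraic_group m G \<longleftrightarrow>
     subgroup G (GL m) \<and>
     (\<exists>F \<subseteq> polyfun ({..<m} \<times> {..<m}).
        G = {g \<in> carrier (GL m). \<forall>p\<in>F. p (matrix_entries g) = 0})"

definition regular_on :: "nat \<Rightarrow> complex mat set \<Rightarrow> (complex mat \<Rightarrow> complex) \<Rightarrow> bool" where
  "regular_on m G u \<longleftrightarrow>
     (\<exists>p \<in> polyfun ({..<m} \<times> {..<m}). \<exists>N::nat. \<forall>g\<in>G. u g = p (matrix_entries g) / det g ^ N)"

text \<open>An algebraic (rational) representation of \<open>G\<close> on $\mathbb{C}^d$ in matrix form.\<close>

definition rational_rep ::
  "nat \<Rightarrow> complex mat set \<Rightarrow> nat \<Rightarrow> (complex mat \<Rightarrow> complex mat) \<Rightarrow> bool" where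
  "rational_rep m G d \<sigma> \<longleftrightarrow>
     \<sigma> \<in> hom ((GL m)\<lparr>carrier := G\<rparr>) (GL d) \<and>
     (\<forall>i<d. \<forall>j<d. regular_on m G (\<lambda>g. \<sigma> g $$ (i, j)))"

text \<open>A representation space: a subspace \<open>rspace\<close> of an ambient complex vector space with
  scalar multiplication \<open>rscale\<close>, and an action of matrices.\<close>

record 'v rep =
  rspace :: "'v set"
  rscale :: "complex \<Rightarrow> 'v \<Rightarrow> 'v"
  ract :: "complex mat \<Rightarrow> 'v \<Rightarrow> 'v"

definition mat_rep :: "nat \<Rightarrow> (complex mat \<Rightarrow> complex mat) \<Rightarrow> (nat \<Rightarrow> complex) rep" where
  "mat_rep d \<sigma> =
     \<lparr>rspace = cspace d, rscale = fscale,
      ract = (\<lambda>g x i. if i < d then \<Sum>j<d. \<sigma> g $$ (i, j) * x j else 0)\<rparr>"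

definition subrep :: "complex mat set \<Rightarrow> ('v::ab_group_add) rep \<Rightarrow> 'v set \<Rightarrow> bool" where
  "subrep G R U \<longleftrightarrow>
     module.subspace (rscale R) U \<and> U \<subseteq> rspace R \<and> (\<forall>g\<in>G. \<forall>x\<in>U. ract R g x \<in> U)"

definition restrict_rep :: "'v rep \<Rightarrow> 'v set \<Rightarrow> 'v rep" where
  "restrict_rep R U = R\<lparr>rspace := U\<rparr>"

definition rep_iso ::
  "complex mat set \<Rightarrow> ('v::ab_group_add) rep \<Rightarrow> ('w::ab_group_add) rep \<Rightarrow> ('v \<Rightarrow> 'w) \<Rightarrow> bool" where
  "rep_iso G R S h \<longleftrightarrow>
     bij_betw h (rspace R) (rspace S) \<and>
     (\<forall>x\<in>rspace R. \<forall>y\<in>rspace R. h (x + y) = h x + h y) \<and>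
     (\<forall>c. \<forall>x\<in>rspace R. h (rscale R c x) = rscale S c (h x)) \<and>
     (\<forall>g\<in>G. \<forall>x\<in>rspace R. h (ract R g x) = ract S g (h x))"

definition rep_isomorphic ::
  "complex mat set \<Rightarrow> ('v::ab_group_add) rep \<Rightarrow> ('w::ab_group_add) rep \<Rightarrow> bool" where
  "rep_isomorphic G R S \<longleftrightarrow> (\<exists>h. rep_iso G R S h)"

definition simple_rep :: "complex mat set \<Rightarrow> ('v::ab_group_add) rep \<Rightarrow> bool" where
  "simple_rep G R \<longleftrightarrow>
     rspace R \<noteq> {0} \<and> (\<forall>U. subrep G R U \<longrightarrow> U = {0} \<or> U = rspace R)"

definition completely_reducible :: "complex mat set \<Rightarrow> ('v::ab_group_add) rep \<Rightarrow> bool" where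
  "completely_reducible G R \<longleftrightarrow>
     (\<forall>U. subrep G R U \<longrightarrow>
        (\<exists>U'. subrep G R U' \<and> U \<inter> U' = {0} \<and> {u + u' | u u'. u \<in> U \<and> u' \<in> U'} = rspace R))"

text \<open>Reductive groups in the sense of invariant theory over $\mathbb{C}$: linear algebraic groups
  all of whose rational representations are completely reducible. No connectedness is required,
  so finite groups are included.\<close>

definition reductive_group :: "nat \<Rightarrow> complex mat set \<Rightarrow> bool" where
  "reductive_group m G \<longleftrightarrow>
     linear_algebraic_group m G \<and>
     (\<forall>d \<sigma>. rational_rep m G d \<sigma> \<longrightarrow> completely_reducible G (mat_rep d \<sigma>))"


section \<open>The tensor algebra\<close>

text \<open>With $V = \mathbb{C}^n$, the basis tensors of $V^{\otimes j}$ are indexed by words of length \<open>j\<close>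
  over the letters \<open>0, \<dots>, n - 1\<close>; a tensor is the function of its coordinates.\<close>

definition words :: "nat \<Rightarrow> nat \<Rightarrow> nat list set" where
  "words n j = {w. set w \<subseteq> {..<n} \<and> length w = j}"

definition tensor_power :: "nat \<Rightarrow> nat \<Rightarrow> (nat list \<Rightarrow> complex) set" where
  "tensor_power n j = {t. \<forall>w. w \<notin> words n j \<longrightarrow> t w = 0}"

definition tensor_rep ::
  "nat \<Rightarrow> (complex mat \<Rightarrow> complex mat) \<Rightarrow> nat \<Rightarrow> (nat list \<Rightarrow> complex) rep" where
  "tensor_rep n \<rho> j =
     \<lparr>rspace = tensor_power n j, rscale = fscale,
      ract = (\<lambda>g t w. if w \<in> words n j
                then \<Sum>u\<in>words n j. (\<Prod>s<j. \<rho> g $$ (w ! s, u ! s)) * t u else 0)\<rparr>"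

text \<open>The product of the tensor algebra, i.e. the bilinear extension of concatenation of words.\<close>

definition tmul ::
  "(nat list \<Rightarrow> complex) \<Rightarrow> (nat list \<Rightarrow> complex) \<Rightarrow> nat list \<Rightarrow> complex" where
  "tmul t u = (\<lambda>w. \<Sum>l\<le>length w. t (take l w) * u (drop l w))"

definition tensor_sandwich ::
  "nat \<Rightarrow> nat \<Rightarrow> (nat list \<Rightarrow> complex) set \<Rightarrow> nat \<Rightarrow> (nat list \<Rightarrow> complex) set" where
  "tensor_sandwich n l P r =
     fn.span {tmul (tmul x p) y | x p y. x \<in> tensor_power n l \<and> p \<in> P \<and> y \<in> tensor_power n r}"


section \<open>Graded algebras with group action\<close>

text \<open>The algebra is the sum of the components \<open>gcomp A i\<close>, a subspace of an ambient complex vector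
  space; nothing is assumed about the operations outside that subspace.\<close>

record 'a galg =
  gcomp :: "nat \<Rightarrow> 'a set"
  gscale :: "complex \<Rightarrow> 'a \<Rightarrow> 'a"
  gmult :: "'a \<Rightarrow> 'a \<Rightarrow> 'a"
  gone :: 'a
  gact :: "complex mat \<Rightarrow> 'a \<Rightarrow> 'a"

definition alg_space :: "('a::ab_group_add) galg \<Rightarrow> 'a set" where
  "alg_space A = module.span (gscale A) (\<Union>i. gcomp A i)"

locale connected_graded_algebra = vector_space "gscale A"
  for A :: "('a::ab_group_add) galg" +
  assumes comp_subspace: "subspace (gcomp A i)"
    and comp_direct: "finite I \<Longrightarrow> (\<And>i. i \<in> I \<Longrightarrow> x i \<in> gcomp A i) \<Longrightarrow> (\<Sum>i\<in>I. x i) = 0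
                        \<Longrightarrow> i \<in> I \<Longrightarrow> x i = 0"
    and mult_graded: "a \<in> gcomp A i \<Longrightarrow> b \<in> gcomp A j \<Longrightarrow> gmult A a b \<in> gcomp A (i + j)"
    and mult_add_left: "a \<in> alg_space A \<Longrightarrow> b \<in> alg_space A \<Longrightarrow> c \<in> alg_space A
                          \<Longrightarrow> gmult A (a + b) c = gmult A a c + gmult A b c"
    and mult_add_right: "a \<in> alg_space A \<Longrightarrow> b \<in> alg_space A \<Longrightarrow> c \<in> alg_space A
                          \<Longrightarrow> gmult A a (b + c) = gmult A a b + gmult A a c"
    and mult_scale_left: "a \<in> alg_space A \<Longrightarrow> b \<in> alg_space A
                          \<Longrightarrow> gmult A (gscale A z a) b = gscale A z (gmult A a b)"
    and mult_scale_right: "a \<in> alg_space A \<Longrightarrow> b \<in> alg_space A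
                          \<Longrightarrow> gmult A a (gscale A z b) = gscale A z (gmult A a b)"
    and mult_assoc: "a \<in> alg_space A \<Longrightarrow> b \<in> alg_space A \<Longrightarrow> c \<in> alg_space A
                          \<Longrightarrow> gmult A (gmult A a b) c = gmult A a (gmult A b c)"
    and one_left: "a \<in> alg_space A \<Longrightarrow> gmult A (gone A) a = a"
    and one_right: "a \<in> alg_space A \<Longrightarrow> gmult A a (gone A) = a"
    and connected: "gone A \<noteq> 0" "gcomp A 0 = span {gone A}"
    and generated: "subspace B \<Longrightarrow> gone A \<in> B \<Longrightarrow> gcomp A 1 \<subseteq> B
                      \<Longrightarrow> (\<And>a b. a \<in> B \<Longrightarrow> b \<in> B \<Longrightarrow> a \<in> alg_space A \<Longrightarrow> b \<in> alg_space A
                            \<Longrightarrow> gmult A a b \<in> B)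
                      \<Longrightarrow> alg_space A \<subseteq> B"
    and finite_dim: "\<exists>S. finite S \<and> gcomp A 1 = span S"

locale G_algebra = connected_graded_algebra A
  for m :: nat and G :: "complex mat set" and A :: "('a::ab_group_add) galg" +
  assumes act_graded: "g \<in> G \<Longrightarrow> a \<in> gcomp A i \<Longrightarrow> gact A g a \<in> gcomp A i"
    and act_add: "g \<in> G \<Longrightarrow> a \<in> alg_space A \<Longrightarrow> b \<in> alg_space A
                    \<Longrightarrow> gact A g (a + b) = gact A g a + gact A g b"
    and act_scale: "g \<in> G \<Longrightarrow> a \<in> alg_space A \<Longrightarrow> gact A g (gscale A z a) = gscale A z (gact A g a)"
    and act_algebra_mult: "g \<in> G \<Longrightarrow> a \<in> alg_space A \<Longrightarrow> b \<in> alg_space A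
                    \<Longrightarrow> gact A g (gmult A a b) = gmult A (gact A g a) (gact A g b)"
    and act_algebra_one: "g \<in> G \<Longrightarrow> gact A g (gone A) = gone A"
    and act_identity: "a \<in> alg_space A \<Longrightarrow> gact A (1\<^sub>m m) a = a"
    and act_compose: "g \<in> G \<Longrightarrow> h \<in> G \<Longrightarrow> a \<in> alg_space A
                    \<Longrightarrow> gact A (g * h) a = gact A g (gact A h a)"

definition comp_rep :: "'a galg \<Rightarrow> nat \<Rightarrow> 'a rep" where
  "comp_rep A i = \<lparr>rspace = gcomp A i, rscale = gscale A, ract = gact A\<rparr>"

definition G_deformation ::
  "nat \<Rightarrow> complex mat set \<Rightarrow> nat \<Rightarrow> (complex mat \<Rightarrow> complex mat) \<Rightarrow>
   ('a::ab_group_add) galg \<Rightarrow> nat \<Rightarrow> ('b::ab_group_add) galg \<Rightarrow> bool" where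
  "G_deformation m G n \<rho> A k B \<longleftrightarrow>
     G_algebra m G B \<and>
     rep_isomorphic G (comp_rep B 1) (mat_rep n \<rho>) \<and>
     (\<forall>i\<le>k. rep_isomorphic G (comp_rep B i) (comp_rep A i))"

text \<open>The natural projection $V^{\otimes j} \to A_j$ induced by an identification \<open>\<psi>\<close> of
  $V = \mathbb{C}^n$ with $A_1$, and its kernel.\<close>

definition proj_map ::
  "('a::ab_group_add) galg \<Rightarrow> ((nat \<Rightarrow> complex) \<Rightarrow> 'a) \<Rightarrow> nat \<Rightarrow> nat \<Rightarrow> (nat list \<Rightarrow> complex) \<Rightarrow> 'a" where
  "proj_map A \<psi> n j t =
     (\<Sum>w\<in>words n j. gscale A (t w) (foldr (\<lambda>i b. gmult A (\<psi> (unit_vector i)) b) w (gone A)))"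

definition relations ::
  "('a::ab_group_add) galg \<Rightarrow> ((nat \<Rightarrow> complex) \<Rightarrow> 'a) \<Rightarrow> nat \<Rightarrow> nat \<Rightarrow> (nat list \<Rightarrow> complex) set" where
  "relations A \<psi> n j = {t \<in> tensor_power n j. proj_map A \<psi> n j t = 0}"


section \<open>The parameter set of deformations\<close>

definition subreps_like ::
  "complex mat set \<Rightarrow> nat \<Rightarrow> (complex mat \<Rightarrow> complex mat) \<Rightarrow> nat \<Rightarrow>
   (nat list \<Rightarrow> complex) set \<Rightarrow> (nat list \<Rightarrow> complex) set set" where
  "subreps_like G n \<rho> j K =
     {U. subrep G (tensor_rep n \<rho> j) U \<and>
         rep_isomorphic G (restrict_rep (tensor_rep n \<rho> j) U) (restrict_rep (tensor_rep n \<rho> j) K)}"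

definition param_set ::
  "complex mat set \<Rightarrow> nat \<Rightarrow> (complex mat \<Rightarrow> complex mat) \<Rightarrow> (nat \<Rightarrow> (nat list \<Rightarrow> complex) set) \<Rightarrow>
   nat \<Rightarrow> (nat \<Rightarrow> (nat list \<Rightarrow> complex) set) set" where
  "param_set G n \<rho> K k =
     {P \<in> (\<Pi>\<^sub>E j\<in>{2..k}. subreps_like G n \<rho> j (K j)).
        \<forall>i j l. 2 \<le> i \<and> i \<le> j \<and> j \<le> k \<and> l \<le> j - i \<longrightarrow>
          tensor_sandwich n l (P i) (j - i - l) \<subseteq> P j}"


section \<open>Isotypic decompositions\<close>

text \<open>Data for one degree: simple representations \<open>srep i\<close> on $\mathbb{C}^{d_i}$ with $d_i$ = \<open>sdim i\<close>
  for \<open>i < nsimple\<close>, multiplicities \<open>tot_mult i\<close> in the whole space and \<open>ker_mult i\<close> in the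
  subspace, and an isomorphism \<open>tiso\<close> from the direct sum onto the whole space. The entry of a
  vector of the direct sum at \<open>(i, c, t)\<close> is coordinate \<open>t\<close> of its component in copy \<open>c\<close> of
  \<open>srep i\<close>.\<close>

record isotypic =
  nsimple :: nat
  sdim :: "nat \<Rightarrow> nat"
  srep :: "nat \<Rightarrow> complex mat \<Rightarrow> complex mat"
  tot_mult :: "nat \<Rightarrow> nat"
  ker_mult :: "nat \<Rightarrow> nat"
  tiso :: "(nat \<times> nat \<times> nat \<Rightarrow> complex) \<Rightarrow> nat list \<Rightarrow> complex"

definition sum_of_simples :: "isotypic \<Rightarrow> (nat \<Rightarrow> nat) \<Rightarrow> (nat \<times> nat \<times> nat \<Rightarrow> complex) rep" where
  "sum_of_simples D a =
     \<lparr>rspace = {x. \<forall>i c t. \<not> (i < nsimple D \<and> c < a i \<and> t < sdim D i) \<longrightarrow> x (i, c, t) = 0},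
      rscale = fscale,
      ract = (\<lambda>g x (i, c, t). if i < nsimple D \<and> c < a i \<and> t < sdim D i
                then \<Sum>u<sdim D i. srep D i g $$ (t, u) * x (i, c, u) else 0)\<rparr>"

definition isotypic_decomposition ::
  "nat \<Rightarrow> complex mat set \<Rightarrow> (nat list \<Rightarrow> complex) rep \<Rightarrow> (nat list \<Rightarrow> complex) set \<Rightarrow>
   isotypic \<Rightarrow> bool" where
  "isotypic_decomposition m G T K D \<longleftrightarrow>
     (\<forall>i<nsimple D. rational_rep m G (sdim D i) (srep D i) \<and>
        simple_rep G (mat_rep (sdim D i) (srep D i))) \<and>
     (\<forall>i<nsimple D. \<forall>i'<nsimple D. i \<noteq> i' \<longrightarrow>
        \<not> rep_isomorphic G (mat_rep (sdim D i) (srep D i)) (mat_rep (sdim D i') (srep D i'))) \<and>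
     rep_iso G (sum_of_simples D (tot_mult D)) T (tiso D) \<and>
     rep_isomorphic G (sum_of_simples D (ker_mult D)) (restrict_rep T K)"

text \<open>The subrepresentation $\bigoplus_i S_i \otimes W_i$ of $\bigoplus_i S_i \otimes \mathbb{C}^{a_i}$,
  transported along \<open>tiso\<close>.\<close>

definition isotypic_sub :: "isotypic \<Rightarrow> (nat \<Rightarrow> (nat \<Rightarrow> complex) set) \<Rightarrow> (nat list \<Rightarrow> complex) set" where
  "isotypic_sub D W =
     tiso D ` {x \<in> rspace (sum_of_simples D (tot_mult D)).
                 \<forall>i<nsimple D. \<forall>t<sdim D i. (\<lambda>c. x (i, c, t)) \<in> W i}"


section \<open>Products of Grassmannians\<close>

definition Grass :: "nat \<Rightarrow> nat \<Rightarrow> (nat \<Rightarrow> complex) set set" where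
  "Grass f a = {W. fn.subspace W \<and> W \<subseteq> cspace a \<and> fn.dim W = f}"

definition is_frame :: "nat \<Rightarrow> (nat \<Rightarrow> complex) set \<Rightarrow> (nat \<Rightarrow> nat \<Rightarrow> complex) \<Rightarrow> bool" where
  "is_frame f W b \<longleftrightarrow>
     inj_on b {..<f} \<and> fn.independent (b ` {..<f}) \<and> fn.span (b ` {..<f}) = W"

text \<open>The Plucker coordinate of a frame at an \<open>f\<close>-element set of column indices.\<close>

definition pluecker :: "nat \<Rightarrow> (nat \<Rightarrow> nat \<Rightarrow> complex) \<Rightarrow> nat set \<Rightarrow> complex" where
  "pluecker f b I = det (mat f f (\<lambda>(r, s). b r (sorted_list_of_set I ! s)))"

text \<open>Polynomials in the Plucker coordinates of the factors of $\prod_{q \in Q} Grass(f_q, a_q)$ that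
  are homogeneous in each group of variables.\<close>

definition multihomogeneous ::
  "'q set \<Rightarrow> ('q \<Rightarrow> nat) \<Rightarrow> ('q \<Rightarrow> nat) \<Rightarrow> (('q \<times> nat set \<Rightarrow> complex) \<Rightarrow> complex) \<Rightarrow> bool" where
  "multihomogeneous Q f a p \<longleftrightarrow>
     p \<in> polyfun (SIGMA q:Q. {I. I \<subseteq> {..<a q} \<and> card I = f q}) \<and>
     (\<exists>deg :: 'q \<Rightarrow> nat. \<forall>c x. p (\<lambda>(q, I). c q * x (q, I)) = (\<Prod>q\<in>Q. c q ^ deg q) * p x)"

text \<open>The Zariski topology of the product, via the Plucker embeddings into projective spaces. By
  multihomogeneity the vanishing does not depend on the choice of the frames.\<close>

definition zariski_closed ::
  "'q set \<Rightarrow> ('q \<Rightarrow> nat) \<Rightarrow> ('q \<Rightarrow> nat) \<Rightarrow> ('q \<Rightarrow> (nat \<Rightarrow> complex) set) set \<Rightarrow> bool" where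
  "zariski_closed Q f a Z \<longleftrightarrow>
     Z \<subseteq> (\<Pi>\<^sub>E q\<in>Q. Grass (f q) (a q)) \<and>
     (\<exists>F. (\<forall>p\<in>F. multihomogeneous Q f a p) \<and>
        (\<forall>X \<in> (\<Pi>\<^sub>E q\<in>Q. Grass (f q) (a q)).
           X \<in> Z \<longleftrightarrow>
           (\<forall>p\<in>F. \<forall>b. (\<forall>q\<in>Q. is_frame (f q) (X q) (b q)) \<longrightarrow>
              p (\<lambda>(q, I). pluecker (f q) (b q) I) = 0)))"

text \<open>The index set, dimensions and multiplicities of $\prod_{j=2}^k \prod_i Grass(f_{j,i}, a_{j,i})$
  for a family of decompositions, and the map from this product to tuples of subrepresentations.\<close>

definition grass_index :: "nat \<Rightarrow> (nat \<Rightarrow> isotypic) \<Rightarrow> (nat \<times> nat) set" where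
  "grass_index k D = (SIGMA j:{2..k}. {..<nsimple (D j)})"

definition grass_f :: "(nat \<Rightarrow> isotypic) \<Rightarrow> nat \<times> nat \<Rightarrow> nat" where
  "grass_f D = (\<lambda>(j, i). ker_mult (D j) i)"

definition grass_a :: "(nat \<Rightarrow> isotypic) \<Rightarrow> nat \<times> nat \<Rightarrow> nat" where
  "grass_a D = (\<lambda>(j, i). tot_mult (D j) i)"

definition grass_product ::
  "nat \<Rightarrow> (nat \<Rightarrow> isotypic) \<Rightarrow> (nat \<times> nat \<Rightarrow> (nat \<Rightarrow> complex) set) set" where
  "grass_product k D = (\<Pi>\<^sub>E q\<in>grass_index k D. Grass (grass_f D q) (grass_a D q))"

definition schur_map ::
  "nat \<Rightarrow> (nat \<Rightarrow> isotypic) \<Rightarrow> (nat \<times> nat \<Rightarrow> (nat \<Rightarrow> complex) set) \<Rightarrow> nat \<Rightarrow> (nat list \<Rightarrow> complex) set"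
  where
  "schur_map k D X = (\<lambda>j\<in>{2..k}. isotypic_sub (D j) (\<lambda>i. X (j, i)))"

end

theory Submission
  imports Defs "Jordan_Normal_Form.Spectral_Radius"
begin

text \<open>
  Let $V = \mathbb{C}^n$ and let $K_j \subseteq V^{\otimes j}$ be the relations of the given algebra
  in degree $j$.

  A tensor power of $V$ is a rational representation of a reductive group, so it is completely
  reducible and decomposes as $\bigoplus_i S_i \otimes \mathbb{C}^{a_i}$ with pairwise
  non-isomorphic simple $S_i$. By Schur's lemma an equivariant map between two such sums is given by
  one matrix for every $i$, acting on the multiplicity spaces (\<open>hom_sum_of_simples\<close>). A
  subrepresentation is the fixed space of an equivariant projection; hence it has the form
  $\bigoplus_i S_i \otimes W_i$ (\<open>subrep_sum_of_simples\<close>), and it is isomorphic to $K_j$ exactly when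
  $\dim W_i = f_i$ for all $i$, since multiplicities are unique (\<open>multiplicity_unique\<close>). This is the
  bijection with the product of Grassmannians (\<open>schur_map_bij\<close>).

  The ideal condition on a tuple $(P_2, \dots, P_k)$ says that multiplication by words $x$ on the left
  and $y$ on the right maps $P_i$ into $P_j$. On elementary tensors $s \otimes w$ this map is linear in
  $w$, and membership in $P_j$ is a condition on multiplicity vectors. So the ideal condition is a
  conjunction of conditions $\tau W \subseteq W'$ with fixed matrices $\tau$
  (\<open>sandwich_incidence\<close>). Such an incidence condition is closed (\<open>zariski_closed_incidence\<close>): by
  Cramer's rule a subspace is spanned by vectors whose entries are maximal minors of a frame, and
  membership in a subspace is expressed by identities whose coefficients are maximal minors. The
  resulting equations are homogeneous in the Pluecker coordinates of each factor.

  For the modular meaning of the points, the degree $j$ component of an algebra $B$ generated by $V$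
  is isomorphic to a complement of its relations in $V^{\otimes j}$. Multiplicities add up in direct
  sums, so two subrepresentations of $V^{\otimes j}$ are isomorphic if and only if their complements
  are (\<open>complement_cancel\<close>). Hence the relations of a deformation are isomorphic to $K_j$ in the
  degrees up to $k$, and they satisfy the ideal condition (\<open>relations_in_param_set\<close>). Conversely, a
  tuple $(P_2, \dots, P_k)$ satisfying the ideal condition becomes a graded ideal when everything is
  added in degrees above $k$. The quotient, realised on $G$-stable complements, is a
  deformation with these relations (\<open>param_set_realized\<close>).
\<close>

section \<open>Finite-dimensional coordinate spaces\<close>

definition coord_space :: "'x set \<Rightarrow> ('x \<Rightarrow> complex) set" where
  "coord_space X = {f. \<forall>x. x \<notin> X \<longrightarrow> f x = 0}"

definition delta :: "'x \<Rightarrow> 'x \<Rightarrow> complex" where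
  "delta x = (\<lambda>t. if t = x then 1 else 0)"

text \<open>The same as \<^const>\<open>is_frame\<close>, for functions on an arbitrary index set: bases of spaces of
  tensors are needed as well.\<close>

definition frame :: "nat \<Rightarrow> ('x \<Rightarrow> complex) set \<Rightarrow> (nat \<Rightarrow> 'x \<Rightarrow> complex) \<Rightarrow> bool" where
  "frame f W b \<longleftrightarrow>
     inj_on b {..<f} \<and> fn.independent (b ` {..<f}) \<and> fn.span (b ` {..<f}) = W"

lemma is_frame_eq_frame: "is_frame = frame"
  by (intro ext) (simp add: is_frame_def frame_def)

lemma fscale_apply [simp]: "fscale c f x = c * f x"
  by (simp add: fscale_def)

lemma sum_function_apply [simp]: "(\<Sum>a\<in>A. f a) x = (\<Sum>a\<in>A. f a x)"
  by (induction A rule: infinite_finite_induct) auto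

lemma cspace_eq_coord_space: "cspace a = coord_space {..<a}"
  by (auto simp: cspace_def coord_space_def)

lemma tensor_power_eq_coord_space: "tensor_power n j = coord_space (words n j)"
  by (simp add: tensor_power_def coord_space_def)

lemma subspace_coord_space: "fn.subspace (coord_space X)"
  by (auto simp: fn.subspace_def coord_space_def)

lemma subspace_cspace: "fn.subspace (cspace a)"
  by (simp add: cspace_eq_coord_space subspace_coord_space)

lemma subspace_tensor_power: "fn.subspace (tensor_power n j)"
  by (simp add: tensor_power_eq_coord_space subspace_coord_space)

lemma delta_in_coord_space: "x \<in> X \<Longrightarrow> delta x \<in> coord_space X"
  by (auto simp: delta_def coord_space_def)

lemma coord_space_expand:
  assumes "finite X" "f \<in> coord_space X"
  shows "(\<Sum>x\<in>X. fscale (f x) (delta x)) = f"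
proof
  fix y
  have "(\<Sum>x\<in>X. f x * delta x y) = (\<Sum>x\<in>X. if x = y then f x else 0)"
    by (rule sum.cong) (auto simp: delta_def)
  also have "\<dots> = f y" using assms by (auto simp: coord_space_def)
  finally show "(\<Sum>x\<in>X. fscale (f x) (delta x)) y = f y" by simp
qed

lemma coord_space_subset_span:
  assumes "finite X"
  shows "coord_space X \<subseteq> fn.span (delta ` X)"
proof
  fix f :: "'a \<Rightarrow> complex" assume "f \<in> coord_space X"
  hence "f = (\<Sum>x\<in>X. fscale (f x) (delta x))" using assms by (simp add: coord_space_expand)
  also have "\<dots> \<in> fn.span (delta ` X)"
    by (intro fn.span_sum fn.span_scale fn.span_base) auto
  finally show "f \<in> fn.span (delta ` X)" .
qed

lemma independent_coord_space:
  assumes "finite X" "B \<subseteq> coord_space X" "fn.independent B"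
  shows "finite B" "card B \<le> card X"
proof -
  have "B \<subseteq> fn.span (delta ` X)" using assms coord_space_subset_span by blast
  hence "finite B \<and> card B \<le> card ((delta :: 'a \<Rightarrow> _) ` X)"
    by (rule fn.independent_span_bound[OF finite_imageI[OF assms(1)] assms(3)])
  moreover have "card ((delta :: 'a \<Rightarrow> _) ` X) \<le> card X" by (rule card_image_le[OF assms(1)])
  ultimately show "finite B" "card B \<le> card X" by (blast intro: le_trans)+
qed

lemma frame_exists:
  assumes "finite X" "W \<subseteq> coord_space X" "fn.subspace W"
  shows "\<exists>b. frame (fn.dim W) W b"
proof -
  obtain B where B: "B \<subseteq> W" "fn.independent B" "W \<subseteq> fn.span B" "card B = fn.dim W"
    by (rule fn.basis_exists)
  have "finite B" by (rule independent_coord_space(1)[OF assms(1) _ B(2)]) (use B(1) assms(2) in auto)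
  then obtain b where "bij_betw b {..<card B} B"
    using ex_bij_betw_nat_finite[of B] by (auto simp: atLeast0LessThan)
  moreover have "fn.span B = W" by (rule subset_antisym[OF fn.span_minimal]) (use B assms in auto)
  ultimately have "frame (card B) W b" using B(2) by (simp add: frame_def bij_betw_def)
  thus ?thesis using B(4) by auto
qed

lemma frame_in: "frame f W b \<Longrightarrow> r < f \<Longrightarrow> b r \<in> W"
  unfolding frame_def by (metis fn.span_base imageI lessThan_iff)

lemma frame_subspace: "frame f W b \<Longrightarrow> fn.subspace W"
  unfolding frame_def by (metis fn.subspace_span)

lemma frame_independent:
  assumes "frame f W b" "(\<Sum>r<f. fscale (\<mu> r) (b r)) = 0" "r < f"
  shows "\<mu> r = 0"
proof -
  have inj: "inj_on b {..<f}" and ind: "fn.independent (b ` {..<f})"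
    using assms by (auto simp: frame_def)
  define u where "u v = \<mu> (the_inv_into {..<f} b v)" for v
  have "(\<Sum>v\<in>b ` {..<f}. fscale (u v) v) = (\<Sum>r<f. fscale (\<mu> r) (b r))"
    using inj by (subst sum.reindex) (auto simp: u_def the_inv_into_f_f intro!: sum.cong)
  hence "u (b r) = 0"
    using fn.independentD[OF ind _ subset_refl, of u "b r"] assms by auto
  thus ?thesis using inj assms(3) by (simp add: u_def the_inv_into_f_f)
qed

lemma frame_spanning:
  assumes "frame f W b" "w \<in> W"
  shows "\<exists>\<mu>\<in>cspace f. w = (\<Sum>r<f. fscale (\<mu> r) (b r))"
proof -
  have inj: "inj_on b {..<f}" and "w \<in> fn.span (b ` {..<f})"
    using assms by (auto simp: frame_def)
  then obtain u where "w = (\<Sum>v\<in>b ` {..<f}. fscale (u v) v)"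
    using fn.span_finite[of "b ` {..<f}"] by auto
  also have "\<dots> = (\<Sum>r<f. fscale (u (b r)) (b r))"
    using inj by (subst sum.reindex) auto
  also have "\<dots> = (\<Sum>r<f. fscale ((\<lambda>r. if r < f then u (b r) else 0) r) (b r))"
    by (rule sum.cong) auto
  finally show ?thesis
    by (intro bexI[of _ "\<lambda>r. if r < f then u (b r) else 0"]) (auto simp: cspace_def)
qed

lemma frameI:
  assumes "\<And>\<mu> r. (\<Sum>r<f. fscale (\<mu> r) (b r)) = 0 \<Longrightarrow> r < f \<Longrightarrow> \<mu> r = 0"
  shows "frame f (fn.span (b ` {..<f})) b"
proof -
  have inj: "inj_on b {..<f}"
  proof (rule inj_onI)
    fix r s assume rs: "r \<in> {..<f}" "s \<in> {..<f}" and eq: "b r = b s"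
    show "r = s"
    proof (rule ccontr)
      assume ne: "r \<noteq> s"
      define \<mu> :: "nat \<Rightarrow> complex" where "\<mu> t = delta r t - delta s t" for t
      have "(\<Sum>t<f. fscale (\<mu> t) (b t)) = 0"
      proof
        fix x
        have "(\<Sum>t<f. \<mu> t * b t x) =
            (\<Sum>t<f. (if t = r then b t x else 0) - (if t = s then b t x else 0))"
          by (rule sum.cong) (auto simp: \<mu>_def delta_def)
        hence "(\<Sum>t<f. \<mu> t * b t x) =
            (\<Sum>t<f. if t = r then b t x else 0) - (\<Sum>t<f. if t = s then b t x else 0)"
          by (simp only: sum_subtractf)
        thus "(\<Sum>t<f. fscale (\<mu> t) (b t)) x = 0 x" using rs eq by simp
      qed
      from assms[OF this, of r] rs ne show False by (simp add: \<mu>_def delta_def)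
    qed
  qed
  have "fn.independent (b ` {..<f})"
  proof (rule fn.independent_if_scalars_zero)
    fix u v assume s: "(\<Sum>x\<in>b ` {..<f}. fscale (u x) x) = 0" and v: "v \<in> b ` {..<f}"
    then obtain r where r: "r < f" "v = b r" by auto
    have "(\<Sum>r<f. fscale (u (b r)) (b r)) = 0"
      using s inj by (subst (asm) sum.reindex) auto
    from assms[OF this r(1)] show "u v = 0" using r by simp
  qed simp
  thus ?thesis using inj by (simp add: frame_def)
qed

lemma dim_subset_coord_space:
  assumes "finite X" "U \<subseteq> U'" "U' \<subseteq> coord_space X" "fn.subspace U" "fn.subspace U'"
  shows "fn.dim U \<le> fn.dim U'" "fn.dim U = fn.dim U' \<Longrightarrow> U = U'"
proof -
  obtain B where B: "B \<subseteq> U" "fn.independent B" "U \<subseteq> fn.span B" "card B = fn.dim U"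
    by (rule fn.basis_exists)
  obtain C where C: "C \<subseteq> U'" "fn.independent C" "U' \<subseteq> fn.span C" "card C = fn.dim U'"
    by (rule fn.basis_exists)
  have finC: "finite C" by (rule independent_coord_space(1)[OF assms(1) _ C(2)]) (use C(1) assms(3) in auto)
  have bound: "finite A \<and> card A \<le> fn.dim U'" if "A \<subseteq> U'" "fn.independent A" for A
    using fn.independent_span_bound[OF finC that(2)] that C by auto
  show "fn.dim U \<le> fn.dim U'" using bound[of B] B assms(2) by auto
  assume eq: "fn.dim U = fn.dim U'"
  show "U = U'"
  proof (rule ccontr)
    assume "U \<noteq> U'"
    then obtain u where u: "u \<in> U'" "u \<notin> U" using assms(2) by blast
    have sp: "fn.span B = U" by (rule subset_antisym[OF fn.span_minimal]) (use B assms in auto)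
    have ind: "fn.independent (insert u B)"
      using u sp B by (intro fn.independent_insertI) auto
    have "insert u B \<subseteq> U'" using u B assms(2) by auto
    hence "finite (insert u B) \<and> card (insert u B) \<le> fn.dim U'" by (rule bound[OF _ ind])
    moreover have "u \<notin> B" using u B by auto
    ultimately show False using B eq by auto
  qed
qed

text \<open>The columns of an injective matrix are linearly independent.\<close>

lemma injective_matrix_le:
  fixes M :: "nat \<Rightarrow> nat \<Rightarrow> complex"
  assumes "\<And>w. w \<in> cspace a \<Longrightarrow> (\<And>c'. c' < b \<Longrightarrow> (\<Sum>c<a. M c' c * w c) = 0) \<Longrightarrow> w = 0"
  shows "a \<le> b"
proof -
  define v where "v c = (\<lambda>c'. if c' < b then M c' c else 0)" for c
  have fr: "frame a (fn.span (v ` {..<a})) v"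
  proof (rule frameI)
    fix \<mu> r assume z: "(\<Sum>r<a. fscale (\<mu> r) (v r)) = 0" and r: "r < a"
    define w where "w c = (if c < a then \<mu> c else 0)" for c
    have "w = 0"
    proof (rule assms)
      show "w \<in> cspace a" by (simp add: w_def cspace_def)
      fix c' assume c': "c' < b"
      have "(\<Sum>c<a. M c' c * w c) = (\<Sum>r<a. fscale (\<mu> r) (v r)) c'"
        using c' by (auto simp: v_def w_def intro!: sum.cong)
      thus "(\<Sum>c<a. M c' c * w c) = 0" using z by simp
    qed
    thus "\<mu> r = 0" using r by (metis w_def zero_fun_apply)
  qed
  have "v ` {..<a} \<subseteq> coord_space {..<b}" by (auto simp: v_def coord_space_def)
  from independent_coord_space(2)[OF _ this] fr have "card (v ` {..<a}) \<le> b"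
    by (auto simp: frame_def)
  thus ?thesis using fr by (simp add: frame_def card_image)
qed

section \<open>Representations, homomorphisms and complements\<close>

locale linear_rep = vector_space "rscale R"
  for G :: "complex mat set" and R :: "('v::ab_group_add) rep" +
  assumes subspace_rspace: "subspace (rspace R)"
    and act_closed: "g \<in> G \<Longrightarrow> x \<in> rspace R \<Longrightarrow> ract R g x \<in> rspace R"
    and act_add: "g \<in> G \<Longrightarrow> x \<in> rspace R \<Longrightarrow> y \<in> rspace R \<Longrightarrow>
                    ract R g (x + y) = ract R g x + ract R g y"
    and act_scale: "g \<in> G \<Longrightarrow> x \<in> rspace R \<Longrightarrow>
                    ract R g (rscale R c x) = rscale R c (ract R g x)"

definition rep_hom ::
  "complex mat set \<Rightarrow> ('v::ab_group_add) rep \<Rightarrow> ('w::ab_group_add) rep \<Rightarrow> ('v \<Rightarrow> 'w) \<Rightarrow> bool" where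
  "rep_hom G R S h \<longleftrightarrow>
     (\<forall>x\<in>rspace R. h x \<in> rspace S) \<and>
     (\<forall>x\<in>rspace R. \<forall>y\<in>rspace R. h (x + y) = h x + h y) \<and>
     (\<forall>c. \<forall>x\<in>rspace R. h (rscale R c x) = rscale S c (h x)) \<and>
     (\<forall>g\<in>G. \<forall>x\<in>rspace R. h (ract R g x) = ract S g (h x))"

definition complementary ::
  "complex mat set \<Rightarrow> ('v::ab_group_add) rep \<Rightarrow> 'v set \<Rightarrow> 'v set \<Rightarrow> bool" where
  "complementary G R U U' \<longleftrightarrow>
     subrep G R U \<and> subrep G R U' \<and> U \<inter> U' = {0} \<and>
     {u + u' | u u'. u \<in> U \<and> u' \<in> U'} = rspace R"

lemma restrict_rep_simps [simp]:
  "rspace (restrict_rep R U) = U" "rscale (restrict_rep R U) = rscale R"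
  "ract (restrict_rep R U) = ract R"
  by (simp_all add: restrict_rep_def)

lemma mat_rep_simps [simp]:
  "rspace (mat_rep d \<sigma>) = cspace d" "rscale (mat_rep d \<sigma>) = fscale"
  by (simp_all add: mat_rep_def)

lemma tensor_rep_simps [simp]:
  "rspace (tensor_rep n \<rho> j) = tensor_power n j" "rscale (tensor_rep n \<rho> j) = fscale"
  by (simp_all add: tensor_rep_def)

lemma comp_rep_simps [simp]:
  "rspace (comp_rep A i) = gcomp A i" "rscale (comp_rep A i) = gscale A"
  "ract (comp_rep A i) = gact A"
  by (simp_all add: comp_rep_def)

lemma rep_homD:
  assumes "rep_hom G R S h"
  shows "x \<in> rspace R \<Longrightarrow> h x \<in> rspace S"
    and "x \<in> rspace R \<Longrightarrow> y \<in> rspace R \<Longrightarrow> h (x + y) = h x + h y"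
    and "x \<in> rspace R \<Longrightarrow> h (rscale R c x) = rscale S c (h x)"
    and "g \<in> G \<Longrightarrow> x \<in> rspace R \<Longrightarrow> h (ract R g x) = ract S g (h x)"
  using assms unfolding rep_hom_def by auto

lemma rep_homI:
  assumes "\<And>x. x \<in> rspace R \<Longrightarrow> h x \<in> rspace S"
    and "\<And>x y. x \<in> rspace R \<Longrightarrow> y \<in> rspace R \<Longrightarrow> h (x + y) = h x + h y"
    and "\<And>c x. x \<in> rspace R \<Longrightarrow> h (rscale R c x) = rscale S c (h x)"
    and "\<And>g x. g \<in> G \<Longrightarrow> x \<in> rspace R \<Longrightarrow> h (ract R g x) = ract S g (h x)"
  shows "rep_hom G R S h"
  using assms unfolding rep_hom_def by auto

lemma rep_iso_iff_hom:
  "rep_iso G R S h \<longleftrightarrow> rep_hom G R S h \<and> bij_betw h (rspace R) (rspace S)"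
  unfolding rep_iso_def rep_hom_def by (auto simp: bij_betw_def)

lemma rep_hom_comp:
  "rep_hom G R S h \<Longrightarrow> rep_hom G S Q h' \<Longrightarrow> rep_hom G R Q (h' \<circ> h)"
  unfolding rep_hom_def by auto

lemma rep_iso_trans:
  "rep_iso G R S h \<Longrightarrow> rep_iso G S Q h' \<Longrightarrow> rep_iso G R Q (h' \<circ> h)"
  unfolding rep_iso_iff_hom using rep_hom_comp bij_betw_trans by blast

lemma rep_isomorphic_trans:
  "rep_isomorphic G R S \<Longrightarrow> rep_isomorphic G S Q \<Longrightarrow> rep_isomorphic G R Q"
  unfolding rep_isomorphic_def using rep_iso_trans by blast

lemma rep_iso_id: "rep_iso G R R (\<lambda>x. x)"
  by (auto simp: rep_iso_def bij_betw_def)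

lemma rep_isomorphic_refl: "rep_isomorphic G R R"
  unfolding rep_isomorphic_def using rep_iso_id by blast

lemma (in linear_rep) rep_iso_inv:
  assumes "rep_iso G R S h"
  shows "rep_iso G S R (inv_into (rspace R) h)"
proof -
  let ?k = "inv_into (rspace R) h"
  note hom = rep_homD[of G R S h]
  have h: "rep_hom G R S h" and bij: "bij_betw h (rspace R) (rspace S)"
    using assms by (auto simp: rep_iso_iff_hom)
  have kin: "?k y \<in> rspace R" and hk: "h (?k y) = y" if "y \<in> rspace S" for y
    using bij that by (auto simp: bij_betw_def inv_into_into f_inv_into_f)
  have kh: "?k (h x) = x" if "x \<in> rspace R" for x
    using bij that by (simp add: bij_betw_def)
  have "rep_hom G S R ?k"
  proof (rule rep_homI)
    fix x y assume xy: "x \<in> rspace S" "y \<in> rspace S"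
    have "h (?k x + ?k y) = x + y" using hom(2)[OF h] kin hk xy by simp
    thus "?k (x + y) = ?k x + ?k y"
      using kh[of "?k x + ?k y"] kin xy subspace_add[OF subspace_rspace] by simp
  next
    fix c x assume x: "x \<in> rspace S"
    have "h (rscale R c (?k x)) = rscale S c x" using hom(3)[OF h] kin hk x by simp
    thus "?k (rscale S c x) = rscale R c (?k x)"
      using kh[of "rscale R c (?k x)"] kin x subspace_scale[OF subspace_rspace] by simp
  next
    fix g x assume g: "g \<in> G" and x: "x \<in> rspace S"
    have "h (ract R g (?k x)) = ract S g x" using hom(4)[OF h] kin hk x g by simp
    thus "?k (ract S g x) = ract R g (?k x)"
      using kh[of "ract R g (?k x)"] kin x act_closed g by simp
  qed (rule kin)
  thus ?thesis using bij_betw_inv_into[OF bij] by (simp add: rep_iso_iff_hom)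
qed

lemma (in linear_rep) rep_isomorphic_sym:
  "rep_isomorphic G R S \<Longrightarrow> rep_isomorphic G S R"
  unfolding rep_isomorphic_def using rep_iso_inv by blast

lemma (in linear_rep) linear_rep_restrict:
  assumes "subrep G R U"
  shows "linear_rep G (restrict_rep R U)"
proof unfold_locales
  have U: "subspace U" "\<And>x. x \<in> U \<Longrightarrow> x \<in> rspace R" "\<And>g x. g \<in> G \<Longrightarrow> x \<in> U \<Longrightarrow> ract R g x \<in> U"
    using assms unfolding subrep_def by blast+
  show "module.subspace (rscale (restrict_rep R U)) (rspace (restrict_rep R U))"
    using U(1) by simp
qed (use assms in \<open>simp_all add: subrep_def act_add act_scale subset_iff scale_right_distrib scale_left_distrib\<close>)

lemma (in linear_rep) subrep_self: "subrep G R (rspace R)"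
  by (simp add: subrep_def subspace_rspace act_closed)

lemma subrep_restrict_iff:
  "subrep G R U \<Longrightarrow> subrep G (restrict_rep R U) V \<longleftrightarrow> subrep G R V \<and> V \<subseteq> U"
  by (auto simp: subrep_def)

lemma rep_iso_restrict:
  assumes "rep_iso G R S h" "U \<subseteq> rspace R"
  shows "rep_iso G (restrict_rep R U) (restrict_rep S (h ` U)) h"
proof -
  have "inj_on h U" using assms by (meson bij_betw_imp_inj_on inj_on_subset rep_iso_def)
  thus ?thesis using assms by (simp add: rep_iso_def bij_betw_def subset_iff)
qed

lemma rep_hom_zero:
  assumes "linear_rep G R" "linear_rep G S" "rep_hom G R S h"
  shows "h 0 = 0"
proof -
  interpret R: linear_rep G R by fact
  interpret S: linear_rep G S by fact
  have "h (rscale R 0 0) = rscale S 0 (h 0)"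
    using rep_homD(3)[OF assms(3)] R.subspace_0[OF R.subspace_rspace] by blast
  thus ?thesis by simp
qed

lemma rep_hom_diff:
  assumes "linear_rep G R" "linear_rep G S" "rep_hom G R S h" "x \<in> rspace R" "y \<in> rspace R"
  shows "h (x - y) = h x - h y"
proof -
  interpret R: linear_rep G R by fact
  have "h (x - y) + h y = h (x - y + y)"
    using rep_homD(2)[OF assms(3)] assms R.subspace_diff[OF R.subspace_rspace] by metis
  thus ?thesis by (simp add: algebra_simps)
qed

lemma rep_hom_sum:
  assumes "linear_rep G R" "linear_rep G S" "rep_hom G R S h" "\<And>a. a \<in> A \<Longrightarrow> f a \<in> rspace R"
  shows "h (\<Sum>a\<in>A. f a) = (\<Sum>a\<in>A. h (f a))"
  using assms(4)
proof (induction A rule: infinite_finite_induct)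
  case (insert a A)
  interpret R: linear_rep G R by fact
  have "(\<Sum>a\<in>A. f a) \<in> rspace R"
    using insert by (intro R.subspace_sum[OF R.subspace_rspace]) auto
  thus ?case using insert rep_homD(2)[OF assms(3)] by simp
qed (simp_all add: rep_hom_zero[OF assms(1-3)])

lemma subrep_kernel:
  assumes "linear_rep G R" "linear_rep G S" "rep_hom G R S h"
  shows "subrep G R {x \<in> rspace R. h x = 0}"
proof -
  interpret R: linear_rep G R by fact
  interpret S: linear_rep G S by fact
  note z = rep_hom_zero[OF assms]
  have "ract S g 0 = 0" if "g \<in> G" for g
    using S.act_scale[OF that S.subspace_0[OF S.subspace_rspace], of 0] by simp
  thus ?thesis
    using rep_homD[OF assms(3)] R.act_closed z
      R.subspace_add[OF R.subspace_rspace] R.subspace_0[OF R.subspace_rspace]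
      R.subspace_scale[OF R.subspace_rspace]
    by (auto simp: subrep_def R.subspace_def)
qed

lemma subrep_image:
  assumes "linear_rep G R" "linear_rep G S" "rep_hom G R S h" "subrep G R U"
  shows "subrep G S (h ` U)"
proof -
  interpret R: linear_rep G R by fact
  interpret S: linear_rep G S by fact
  have U: "R.subspace U" "\<And>x. x \<in> U \<Longrightarrow> x \<in> rspace R"
    and actU: "\<And>g x. g \<in> G \<Longrightarrow> x \<in> U \<Longrightarrow> ract R g x \<in> U"
    using assms(4) unfolding subrep_def by blast+
  note h = rep_homD[OF assms(3)]
  show ?thesis unfolding subrep_def S.subspace_def
  proof (intro conjI ballI allI)
    show "0 \<in> h ` U"
      using R.subspace_0[OF U(1)] rep_hom_zero[OF assms(1-3)] by (metis imageI)
    show "h ` U \<subseteq> rspace S" using h(1) U(2) by blast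
  next
    fix x y assume "x \<in> h ` U" "y \<in> h ` U"
    then obtain u v where uv: "u \<in> U" "v \<in> U" "x = h u" "y = h v" by auto
    hence "x + y = h (u + v)" using h(2)[of u v] U(2) by simp
    thus "x + y \<in> h ` U" using R.subspace_add[OF U(1) uv(1,2)] by simp
  next
    fix c x assume "x \<in> h ` U"
    then obtain u where u: "u \<in> U" "x = h u" by auto
    hence "rscale S c x = h (rscale R c u)" using h(3)[of u c] U(2) by simp
    thus "rscale S c x \<in> h ` U" using R.subspace_scale[OF U(1) u(1)] by simp
  next
    fix g x assume g: "g \<in> G" "x \<in> h ` U"
    then obtain u where u: "u \<in> U" "x = h u" by auto
    hence "ract S g x = h (ract R g u)" using h(4)[of g u] U(2) g by simp
    thus "ract S g x \<in> h ` U" using actU g u by simp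
  qed
qed

lemma complementary_sym: "complementary G R U U' \<Longrightarrow> complementary G R U' U"
proof -
  have "{u + u' | u u'. u \<in> U' \<and> u' \<in> U} = {u + u' | u u'. u \<in> U \<and> u' \<in> U'}"
    by (rule Collect_cong) (metis add.commute)
  thus "complementary G R U U' \<Longrightarrow> complementary G R U' U"
    unfolding complementary_def by (simp add: Int_commute)
qed

lemma complementary_decompose:
  assumes "complementary G R U U'" "x \<in> rspace R"
  obtains u u' where "u \<in> U" "u' \<in> U'" "x = u + u'"
  using assms unfolding complementary_def by blast

lemma completely_reducibleD:
  "completely_reducible G R \<Longrightarrow> subrep G R U \<Longrightarrow> \<exists>U'. complementary G R U U'"
  by (auto simp: completely_reducible_def complementary_def)

lemma completely_reducible_iff:
  "completely_reducible G R \<longleftrightarrow> (\<forall>U. subrep G R U \<longrightarrow> (\<exists>U'. complementary G R U U'))"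
  by (auto simp: completely_reducible_def complementary_def)

lemma complementary_image:
  assumes "linear_rep G R" "linear_rep G S" "rep_iso G R S h" "complementary G R U U'"
  shows "complementary G S (h ` U) (h ` U')"
proof -
  have hom: "rep_hom G R S h" and bij: "bij_betw h (rspace R) (rspace S)"
    using assms(3) by (auto simp: rep_iso_iff_hom)
  have U: "subrep G R U" "subrep G R U'" "U \<inter> U' = {0}" "{u + u' | u u'. u \<in> U \<and> u' \<in> U'} = rspace R"
    using assms(4) by (auto simp: complementary_def)
  have sub: "U \<subseteq> rspace R" "U' \<subseteq> rspace R" using U by (auto simp: subrep_def)
  have "h ` U \<inter> h ` U' = h ` (U \<inter> U')"
    using inj_on_image_Int[OF bij_betw_imp_inj_on[OF bij] sub] by simp
  hence "h ` U \<inter> h ` U' = {0}" using U(3) rep_hom_zero[OF assms(1,2) hom] by simp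
  moreover have "{u + u' | u u'. u \<in> h ` U \<and> u' \<in> h ` U'} = h ` {u + u' | u u'. u \<in> U \<and> u' \<in> U'}"
  proof -
    have "h u + h u' = h (u + u')" if "u \<in> U" "u' \<in> U'" for u u'
      using rep_homD(2)[OF hom subsetD[OF sub(1) that(1)] subsetD[OF sub(2) that(2)]] by simp
    hence "h ` {u + u' | u u'. u \<in> U \<and> u' \<in> U'} = {h u + h u' | u u'. u \<in> U \<and> u' \<in> U'}"
      by (auto simp: image_iff) metis
    thus ?thesis by blast
  qed
  hence "{u + u' | u u'. u \<in> h ` U \<and> u' \<in> h ` U'} = rspace S"
    using bij U(4) by (simp add: bij_betw_def)
  ultimately show ?thesis
    using subrep_image[OF assms(1,2) hom] U by (simp add: complementary_def)
qed

lemma completely_reducible_iso: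
  assumes "linear_rep G R" "linear_rep G S" "rep_iso G R S h" "completely_reducible G R"
  shows "completely_reducible G S"
  unfolding completely_reducible_iff
proof (intro allI impI)
  fix U assume U: "subrep G S U"
  let ?k = "inv_into (rspace R) h"
  have k: "rep_iso G S R ?k" using linear_rep.rep_iso_inv[OF assms(1,3)] .
  have bij: "bij_betw h (rspace R) (rspace S)" using assms(3) by (auto simp: rep_iso_iff_hom)
  have "subrep G R (?k ` U)"
    using subrep_image[OF assms(2,1) _ U] k by (simp add: rep_iso_iff_hom)
  then obtain V where "complementary G R (?k ` U) V" using completely_reducibleD assms(4) by blast
  from complementary_image[OF assms(1-3) this]
  have "complementary G S (h ` ?k ` U) (h ` V)" .
  moreover have "h ` ?k ` U = U"
    using U bij by (intro image_inv_into_cancel) (auto simp: bij_betw_def subrep_def)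
  ultimately show "\<exists>U'. complementary G S U U'" by auto
qed

text \<open>A complement inside the subrepresentation is the intersection with a complement in the whole
  space (modular law).\<close>

lemma completely_reducible_restrict:
  assumes "linear_rep G R" "completely_reducible G R" "subrep G R U"
  shows "completely_reducible G (restrict_rep R U)"
  unfolding completely_reducible_iff
proof (intro allI impI)
  interpret R: linear_rep G R by fact
  fix V assume V: "subrep G (restrict_rep R U) V"
  hence V': "subrep G R V" "V \<subseteq> U" using subrep_restrict_iff[OF assms(3)] by auto
  then obtain V2 where V2: "complementary G R V V2" using completely_reducibleD assms(2) by blast
  have subs: "R.subspace U" "R.subspace V" "R.subspace V2"
    using assms(3) V' V2 by (auto simp: subrep_def complementary_def)
  have "subrep G R (V2 \<inter> U)"
    using V2 assms(3) R.subspace_inter by (auto simp: complementary_def subrep_def)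
  hence "subrep G (restrict_rep R U) (V2 \<inter> U)" using subrep_restrict_iff[OF assms(3)] by auto
  moreover have "V \<inter> (V2 \<inter> U) = {0}"
    using V2 R.subspace_0[OF subs(1)] by (auto simp: complementary_def)
  moreover have "{u + u' | u u'. u \<in> V \<and> u' \<in> V2 \<inter> U} = U"
  proof (intro equalityI subsetI)
    fix x assume "x \<in> {u + u' | u u'. u \<in> V \<and> u' \<in> V2 \<inter> U}"
    thus "x \<in> U" using V'(2) R.subspace_add[OF subs(1)] by auto
  next
    fix x assume x: "x \<in> U"
    hence "x \<in> rspace R" using assms(3) by (auto simp: subrep_def)
    then obtain u u' where u: "u \<in> V" "u' \<in> V2" "x = u + u'"
      using complementary_decompose[OF V2] by metis
    have "x - u \<in> U" using R.subspace_diff[OF subs(1) x] u V'(2) by blast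
    hence "u' \<in> U" using u(3) by simp
    thus "x \<in> {u + u' | u u'. u \<in> V \<and> u' \<in> V2 \<inter> U}" using u by auto
  qed
  ultimately have "complementary G (restrict_rep R U) V (V2 \<inter> U)"
    using V by (simp add: complementary_def)
  thus "\<exists>U'. complementary G (restrict_rep R U) V U'" by blast
qed

definition proj_along :: "('v::ab_group_add) set \<Rightarrow> 'v set \<Rightarrow> 'v \<Rightarrow> 'v" where
  "proj_along U U' x = (THE u. u \<in> U \<and> x - u \<in> U')"

lemma proj_along_eq:
  assumes "linear_rep G R" "complementary G R U U'" "u \<in> U" "x - u \<in> U'"
  shows "proj_along U U' x = u"
  unfolding proj_along_def
proof (rule the_equality)
  interpret R: linear_rep G R by fact
  have subs: "R.subspace U" "R.subspace U'" "U \<inter> U' = {0}"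
    using assms(2) by (auto simp: subrep_def complementary_def)
  fix v assume v: "v \<in> U \<and> x - v \<in> U'"
  have "v - u \<in> U" using v assms R.subspace_diff[OF subs(1)] by auto
  moreover have "v - u = (x - u) - (x - v)" by simp
  hence "v - u \<in> U'" using v assms R.subspace_diff[OF subs(2)] by metis
  ultimately have "v - u = 0" using subs(3) by blast
  thus "v = u" by simp
qed (use assms in auto)

lemma proj_along:
  assumes "linear_rep G R" "complementary G R U U'" "x \<in> rspace R"
  shows "proj_along U U' x \<in> U" "x - proj_along U U' x \<in> U'"
proof -
  obtain u u' where u: "u \<in> U" "u' \<in> U'" "x = u + u'"
    using complementary_decompose[OF assms(2,3)] by metis
  have "proj_along U U' x = u" using u by (intro proj_along_eq[OF assms(1,2)]) auto
  thus "proj_along U U' x \<in> U" "x - proj_along U U' x \<in> U'" using u by auto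
qed

lemma proj_along_fixed_iff:
  assumes "linear_rep G R" "complementary G R U U'" "x \<in> rspace R"
  shows "proj_along U U' x = x \<longleftrightarrow> x \<in> U"
proof
  have "0 \<in> U'" using assms(2) by (auto simp: complementary_def)
  thus "x \<in> U \<Longrightarrow> proj_along U U' x = x" by (intro proj_along_eq[OF assms(1,2)]) auto
qed (use proj_along[OF assms] in metis)

lemma proj_along_zero_iff:
  assumes "linear_rep G R" "complementary G R U U'" "x \<in> rspace R"
  shows "proj_along U U' x = 0 \<longleftrightarrow> x \<in> U'"
proof
  have "0 \<in> U" using assms(2) by (auto simp: complementary_def)
  thus "x \<in> U' \<Longrightarrow> proj_along U U' x = 0" by (intro proj_along_eq[OF assms(1,2)]) auto
  show "proj_along U U' x = 0 \<Longrightarrow> x \<in> U'" using proj_along(2)[OF assms] by simp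
qed

lemma rep_hom_proj_along:
  assumes "linear_rep G R" "complementary G R U U'"
  shows "rep_hom G R R (proj_along U U')"
proof -
  interpret R: linear_rep G R by fact
  have subs: "R.subspace U" "R.subspace U'" "U \<subseteq> rspace R" "U' \<subseteq> rspace R"
    and act: "\<And>g x. g \<in> G \<Longrightarrow> x \<in> U \<Longrightarrow> ract R g x \<in> U" "\<And>g x. g \<in> G \<Longrightarrow> x \<in> U' \<Longrightarrow> ract R g x \<in> U'"
    using assms(2) by (auto simp: subrep_def complementary_def)
  note p = proj_along[OF assms]
  let ?p = "proj_along U U'"
  show ?thesis
  proof (rule rep_homI)
    fix x assume "x \<in> rspace R" thus "?p x \<in> rspace R" using p(1) subs(3) by blast
  next
    fix x y assume xy: "x \<in> rspace R" "y \<in> rspace R"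
    have "x + y - (?p x + ?p y) = (x - ?p x) + (y - ?p y)" by simp
    also have "\<dots> \<in> U'" using p xy by (intro R.subspace_add[OF subs(2)]) auto
    finally show "?p (x + y) = ?p x + ?p y"
      using p xy R.subspace_add[OF subs(1)] by (intro proj_along_eq[OF assms]) auto
  next
    fix c x assume x: "x \<in> rspace R"
    have "rscale R c x - rscale R c (?p x) = rscale R c (x - ?p x)" by (simp add: R.scale_right_diff_distrib)
    also have "\<dots> \<in> U'" using p x by (intro R.subspace_scale[OF subs(2)]) auto
    finally show "?p (rscale R c x) = rscale R c (?p x)"
      using p x R.subspace_scale[OF subs(1)] by (intro proj_along_eq[OF assms]) auto
  next
    fix g x assume g: "g \<in> G" and x: "x \<in> rspace R"
    have px: "?p x \<in> rspace R" "x - ?p x \<in> rspace R"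
      using subsetD[OF subs(3) p(1)[OF x]] subsetD[OF subs(4) p(2)[OF x]] .
    have "ract R g x = ract R g (?p x + (x - ?p x))" by simp
    also have "\<dots> = ract R g (?p x) + ract R g (x - ?p x)" using R.act_add[OF g px] .
    finally have "ract R g x - ract R g (?p x) = ract R g (x - ?p x)" by simp
    thus "?p (ract R g x) = ract R g (?p x)"
      using p x act g by (intro proj_along_eq[OF assms]) auto
  qed
qed

text \<open>A complement of the kernel stands in for the quotient by the kernel, so quotient
  representations do not have to be constructed.\<close>

lemma complement_iso_image:
  assumes "linear_rep G R" "linear_rep G S" "rep_hom G R S h" "h ` rspace R = rspace S"
    and "complementary G R {x \<in> rspace R. h x = 0} C"
  shows "rep_iso G (restrict_rep R C) S h"
proof -
  interpret R: linear_rep G R by fact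
  interpret S: linear_rep G S by fact
  let ?K = "{x \<in> rspace R. h x = 0}"
  have C: "R.subspace C" "C \<subseteq> rspace R" "?K \<inter> C = {0}" "{u + u' | u u'. u \<in> ?K \<and> u' \<in> C} = rspace R"
    using assms(5) by (auto simp: subrep_def complementary_def)
  have "inj_on h C"
  proof (rule inj_onI)
    fix x y assume xy: "x \<in> C" "y \<in> C" "h x = h y"
    have "x \<in> rspace R" "y \<in> rspace R" using C xy by auto
    hence "h (x - y) = 0" using rep_hom_diff[OF assms(1-3)] xy by simp
    moreover have "x - y \<in> C" using R.subspace_diff[OF C(1)] xy by simp
    ultimately have "x - y \<in> ?K \<inter> C" using C by blast
    hence "x - y = 0" using C(3) by blast
    thus "x = y" by simp
  qed
  moreover have "h ` C = rspace S"
  proof (intro equalityI subsetI)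
    fix y assume "y \<in> rspace S"
    then obtain x where x: "x \<in> rspace R" "y = h x" using assms(4) by blast
    then obtain u u' where u: "u \<in> ?K" "u' \<in> C" "x = u + u'"
      using complementary_decompose[OF assms(5)] by metis
    have "y = h u + h u'" using x(2) u rep_homD(2)[OF assms(3), of u u'] subsetD[OF C(2) u(2)] by simp
    thus "y \<in> h ` C" using u by auto
  qed (use C(2) assms(4) in auto)
  moreover have "rep_hom G (restrict_rep R C) S h"
    using assms(3) C(2) by (simp add: rep_hom_def subset_iff)
  ultimately show ?thesis by (simp add: rep_iso_iff_hom bij_betw_def)
qed

lemma linear_rep_fscaleI:
  fixes R :: "('x \<Rightarrow> complex) rep"
  assumes "rscale R = fscale" "fn.subspace (rspace R)"
    and "\<And>g x. g \<in> G \<Longrightarrow> x \<in> rspace R \<Longrightarrow> ract R g x \<in> rspace R"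
    and "\<And>g x y. g \<in> G \<Longrightarrow> ract R g (x + y) = ract R g x + ract R g y"
    and "\<And>g c x. g \<in> G \<Longrightarrow> ract R g (fscale c x) = fscale c (ract R g x)"
  shows "linear_rep G R"
proof (intro linear_rep.intro linear_rep_axioms.intro)
  show "vector_space (rscale R)" unfolding assms(1) by (rule fn.vector_space_axioms)
qed (simp_all only: assms)

lemma linear_rep_mat_rep: "linear_rep G (mat_rep d \<sigma>)"
proof (rule linear_rep_fscaleI)
  fix g x y c
  show "ract (mat_rep d \<sigma>) g (x + y) = ract (mat_rep d \<sigma>) g x + ract (mat_rep d \<sigma>) g y"
    by (rule ext) (simp add: mat_rep_def algebra_simps sum.distrib)
  show "ract (mat_rep d \<sigma>) g (fscale c x) = fscale c (ract (mat_rep d \<sigma>) g x)"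
    by (rule ext) (simp add: mat_rep_def algebra_simps sum_distrib_left)
qed (simp_all add: subspace_cspace, simp add: mat_rep_def cspace_def)

lemma linear_rep_tensor_rep: "linear_rep G (tensor_rep n \<rho> j)"
proof (rule linear_rep_fscaleI)
  fix g x y c
  show "ract (tensor_rep n \<rho> j) g (x + y) = ract (tensor_rep n \<rho> j) g x + ract (tensor_rep n \<rho> j) g y"
    by (rule ext) (simp add: tensor_rep_def algebra_simps sum.distrib)
  show "ract (tensor_rep n \<rho> j) g (fscale c x) = fscale c (ract (tensor_rep n \<rho> j) g x)"
    by (rule ext) (simp add: tensor_rep_def algebra_simps sum_distrib_left)
qed (simp_all add: subspace_tensor_power, simp add: tensor_rep_def tensor_power_def)

definition simples_index :: "isotypic \<Rightarrow> (nat \<Rightarrow> nat) \<Rightarrow> (nat \<times> nat \<times> nat) set" where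
  "simples_index D a = {(i, c, t). i < nsimple D \<and> c < a i \<and> t < sdim D i}"

lemma sum_of_simples_simps [simp]:
  "rspace (sum_of_simples D a) = coord_space (simples_index D a)"
  "rscale (sum_of_simples D a) = fscale"
  by (auto simp: sum_of_simples_def coord_space_def simples_index_def)

lemma linear_rep_sum_of_simples: "linear_rep G (sum_of_simples D a)"
proof (rule linear_rep_fscaleI)
  fix g x y c
  show "ract (sum_of_simples D a) g (x + y) = ract (sum_of_simples D a) g x + ract (sum_of_simples D a) g y"
    by (rule ext) (simp add: sum_of_simples_def algebra_simps sum.distrib split: prod.split)
  show "ract (sum_of_simples D a) g (fscale c x) = fscale c (ract (sum_of_simples D a) g x)"
    by (rule ext) (simp add: sum_of_simples_def algebra_simps sum_distrib_left split: prod.split)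
  show "ract (sum_of_simples D a) g x \<in> rspace (sum_of_simples D a)"
    by (auto simp: sum_of_simples_def)
qed (simp_all add: subspace_coord_space)

section \<open>Schur's lemma and isotypic decompositions\<close>

lemma rep_hom_kernel_iso:
  assumes "linear_rep G R" "linear_rep G S" "rep_hom G R S h"
    and "\<And>x. x \<in> rspace R \<Longrightarrow> h x = 0 \<Longrightarrow> x = 0" and "rspace S \<subseteq> h ` rspace R"
  shows "rep_iso G R S h"
proof -
  interpret R: linear_rep G R by fact
  have "inj_on h (rspace R)"
  proof (rule inj_onI)
    fix x y assume xy: "x \<in> rspace R" "y \<in> rspace R" "h x = h y"
    hence "h (x - y) = 0" using rep_hom_diff[OF assms(1-3)] by simp
    hence "x - y = 0" using assms(4) R.subspace_diff[OF R.subspace_rspace] xy by blast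
    thus "x = y" by simp
  qed
  moreover have "h ` rspace R = rspace S" using assms(5) rep_homD(1)[OF assms(3)] by blast
  ultimately show ?thesis using assms(3) by (simp add: rep_iso_iff_hom bij_betw_def)
qed

text \<open>The kernel and the image of a homomorphism are subrepresentations, and simplicity leaves only
  the two extreme possibilities for each of them.\<close>

lemma schur_zero_or_iso:
  assumes "linear_rep G R" "linear_rep G S" "rep_hom G R S h" "simple_rep G R" "simple_rep G S"
  shows "(\<forall>x\<in>rspace R. h x = 0) \<or> rep_iso G R S h"
proof (rule disjCI)
  assume niso: "\<not> rep_iso G R S h"
  interpret R: linear_rep G R by fact
  let ?K = "{x \<in> rspace R. h x = 0}"
  have K: "?K = {0} \<or> ?K = rspace R"
    using subrep_kernel[OF assms(1-3)] assms(4) unfolding simple_rep_def by blast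
  have I: "h ` rspace R = {0} \<or> h ` rspace R = rspace S"
    using subrep_image[OF assms(1-3) R.subrep_self] assms(5) unfolding simple_rep_def by blast
  show "\<forall>x\<in>rspace R. h x = 0"
  proof (rule ccontr)
    assume "\<not> ?thesis"
    hence "?K = {0}" "h ` rspace R = rspace S" using K I by blast+
    hence "rep_iso G R S h" by (intro rep_hom_kernel_iso assms(1-3)) blast+
    thus False using niso by simp
  qed
qed

lemma rep_hom_coordinates:
  fixes R :: "('x \<Rightarrow> complex) rep" and S :: "('y \<Rightarrow> complex) rep"
  assumes "linear_rep G R" "linear_rep G S" "rep_hom G R S h"
    and "rscale R = fscale" "rscale S = fscale" "rspace R = coord_space X" "finite X" "x \<in> coord_space X"
  shows "h x = (\<Sum>p\<in>X. fscale (x p) (h (delta p)))"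
proof -
  have d: "delta p \<in> rspace R" if "p \<in> X" for p
    using that by (simp add: assms(6) delta_in_coord_space)
  have "h x = h (\<Sum>p\<in>X. fscale (x p) (delta p))" using assms by (simp add: coord_space_expand)
  also have "\<dots> = (\<Sum>p\<in>X. h (fscale (x p) (delta p)))"
  proof (rule rep_hom_sum[OF assms(1-3)])
    fix p assume "p \<in> X"
    thus "fscale (x p) (delta p) \<in> rspace R"
      using fn.subspace_scale[OF subspace_coord_space delta_in_coord_space] assms(6) by simp
  qed
  also have "\<dots> = (\<Sum>p\<in>X. fscale (x p) (h (delta p)))"
    using rep_homD(3)[OF assms(3) d] by (intro sum.cong) (simp_all add: assms(4,5))
  finally show ?thesis .
qed

text \<open>Over the complex numbers an endomorphism has an eigenvalue, and its eigenspace is a nonzero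
  subrepresentation.\<close>

lemma schur_scalar:
  assumes "simple_rep G (mat_rep d \<sigma>)" "rep_hom G (mat_rep d \<sigma>) (mat_rep d \<sigma>) h"
  shows "\<exists>c. \<forall>x\<in>cspace d. h x = fscale c x"
proof -
  let ?R = "mat_rep d \<sigma>"
  interpret R: linear_rep G ?R by (rule linear_rep_mat_rep)
  define A where "A = mat d d (\<lambda>(i, j). h (delta j) i)"
  have A: "A \<in> carrier_mat d d" by (simp add: A_def)
  have "d > 0"
  proof (rule ccontr)
    assume "\<not> d > 0"
    hence "cspace d = {0}" by (auto simp: cspace_def fun_eq_iff)
    thus False using assms(1) by (simp add: simple_rep_def)
  qed
  from spectrum_non_empty[OF A this] obtain c where "eigenvalue A c"
    by (auto simp: spectrum_def)
  then obtain v where v: "v \<in> carrier_vec d" "v \<noteq> 0\<^sub>v d" "A *\<^sub>v v = c \<cdot>\<^sub>v v"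
    using A by (auto simp: eigenvalue_def eigenvector_def)
  define x where "x i = (if i < d then v $ i else 0)" for i
  have x: "x \<in> cspace d" by (simp add: x_def cspace_def)
  have hx: "h x = fscale c x"
  proof
    fix i
    have hxc: "h x \<in> cspace d" using rep_homD(1)[OF assms(2)] x by simp
    show "h x i = fscale c x i"
    proof (cases "i < d")
      case True
      have "h x = (\<Sum>p<d. fscale (x p) (h (delta p)))"
        using x by (intro rep_hom_coordinates[OF linear_rep_mat_rep linear_rep_mat_rep assms(2)])
          (simp_all add: cspace_eq_coord_space)
      hence "h x i = (\<Sum>p<d. x p * h (delta p) i)" by simp
      also have "\<dots> = (\<Sum>p<d. A $$ (i, p) * v $ p)"
        using True by (intro sum.cong) (auto simp: A_def x_def)
      also have "\<dots> = (A *\<^sub>v v) $ i"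
        using True A v(1) by (auto simp: scalar_prod_def atLeast0LessThan intro!: sum.cong)
      also have "\<dots> = c * v $ i" using v True by simp
      finally show ?thesis using True by (simp add: x_def)
    qed (use hxc x in \<open>simp add: cspace_def\<close>)
  qed
  have "\<exists>i<d. v $ i \<noteq> 0" using v(1,2) by (auto simp: vec_eq_iff)
  hence x0: "x \<noteq> 0" by (auto simp: x_def fun_eq_iff)
  define E where "E = {x \<in> cspace d. h x = fscale c x}"
  have "subrep G ?R E"
    unfolding subrep_def R.subspace_def
  proof (intro conjI ballI allI)
    show "0 \<in> E" using rep_hom_zero[OF linear_rep_mat_rep linear_rep_mat_rep assms(2)]
      by (simp add: E_def fn.subspace_0[OF subspace_cspace])
  next
    fix y z assume "y \<in> E" "z \<in> E"
    thus "y + z \<in> E" using rep_homD(2)[OF assms(2), of y z]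
      by (simp add: E_def fn.subspace_add[OF subspace_cspace] fn.scale_right_distrib)
  next
    fix a y assume "y \<in> E"
    thus "rscale ?R a y \<in> E" using rep_homD(3)[OF assms(2), of y a]
      by (simp add: E_def fn.subspace_scale[OF subspace_cspace] mult.commute)
  next
    fix g y assume g: "g \<in> G" and y: "y \<in> E"
    have yc: "y \<in> cspace d" using y by (simp add: E_def)
    have "h (ract ?R g y) = ract ?R g (fscale c y)"
      using rep_homD(4)[OF assms(2) g, of y] y by (simp add: E_def)
    also have "\<dots> = fscale c (ract ?R g y)" using R.act_scale[OF g, of y c] yc by simp
    finally show "ract ?R g y \<in> E" using R.act_closed[OF g, of y] yc by (simp add: E_def)
  qed (auto simp: E_def)
  hence "E = {0} \<or> E = cspace d" using assms(1) by (simp add: simple_rep_def)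
  moreover have "x \<in> E" using x hx by (simp add: E_def)
  ultimately have "E = cspace d" using x0 by blast
  thus ?thesis by (auto simp: E_def)
qed

definition distinct_simples :: "complex mat set \<Rightarrow> isotypic \<Rightarrow> bool" where
  "distinct_simples G D \<longleftrightarrow>
     (\<forall>i<nsimple D. simple_rep G (mat_rep (sdim D i) (srep D i))) \<and>
     (\<forall>i<nsimple D. \<forall>i'<nsimple D. i \<noteq> i' \<longrightarrow>
        \<not> rep_isomorphic G (mat_rep (sdim D i) (srep D i)) (mat_rep (sdim D i') (srep D i')))"

lemma distinct_simples_sdim_pos:
  assumes "distinct_simples G D" "i < nsimple D"
  shows "sdim D i > 0"
proof (rule ccontr)
  assume "\<not> sdim D i > 0"
  hence "cspace (sdim D i) = {0}" by (auto simp: cspace_def fun_eq_iff)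
  thus False using assms by (simp add: distinct_simples_def simple_rep_def)
qed

definition copy_incl :: "nat \<Rightarrow> nat \<Rightarrow> (nat \<Rightarrow> complex) \<Rightarrow> nat \<times> nat \<times> nat \<Rightarrow> complex" where
  "copy_incl i c s = (\<lambda>(i', c', t). if i' = i \<and> c' = c then s t else 0)"

definition copy_proj :: "nat \<Rightarrow> nat \<Rightarrow> (nat \<times> nat \<times> nat \<Rightarrow> complex) \<Rightarrow> nat \<Rightarrow> complex" where
  "copy_proj i c x = (\<lambda>t. x (i, c, t))"

lemma rep_hom_copy_incl:
  assumes "i < nsimple D" "c < a i"
  shows "rep_hom G (mat_rep (sdim D i) (srep D i)) (sum_of_simples D a) (copy_incl i c)"
proof (rule rep_homI)
  fix g x assume "x \<in> rspace (mat_rep (sdim D i) (srep D i))"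
  thus "copy_incl i c (ract (mat_rep (sdim D i) (srep D i)) g x) =
        ract (sum_of_simples D a) g (copy_incl i c x)"
    using assms by (auto simp: fun_eq_iff copy_incl_def mat_rep_def sum_of_simples_def cspace_def)
qed (use assms in \<open>auto simp: fun_eq_iff copy_incl_def cspace_def coord_space_def simples_index_def
       leI split: prod.split\<close>)

lemma rep_hom_copy_proj:
  assumes "i < nsimple D" "c < a i"
  shows "rep_hom G (sum_of_simples D a) (mat_rep (sdim D i) (srep D i)) (copy_proj i c)"
proof (rule rep_homI)
  fix g x
  show "copy_proj i c (ract (sum_of_simples D a) g x) =
        ract (mat_rep (sdim D i) (srep D i)) g (copy_proj i c x)"
    using assms by (auto simp: fun_eq_iff copy_proj_def mat_rep_def sum_of_simples_def)
qed (auto simp: fun_eq_iff copy_proj_def cspace_def coord_space_def simples_index_def)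

lemma sum_of_simples_expand:
  assumes "x \<in> coord_space (simples_index D a)"
  shows "x = (\<Sum>i<nsimple D. \<Sum>c<a i. copy_incl i c (copy_proj i c x))"
proof (rule ext)
  fix p :: "nat \<times> nat \<times> nat"
  obtain i c t where p: "p = (i, c, t)" by (cases p)
  have inner: "(\<Sum>c'<a i'. copy_incl i' c' (copy_proj i' c' x) p) = (if i' = i then (if c < a i then x p else 0) else 0)" for i'
  proof -
    have "(\<Sum>c'<a i'. copy_incl i' c' (copy_proj i' c' x) p) = (\<Sum>c'<a i'. if c' = c then (if i' = i then x p else 0) else 0)"
      by (rule sum.cong) (auto simp: copy_incl_def copy_proj_def p)
    thus ?thesis by auto
  qed
  have "(\<Sum>i'<nsimple D. \<Sum>c'<a i'. copy_incl i' c' (copy_proj i' c' x)) p =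
     (\<Sum>i'<nsimple D. if i' = i then (if c < a i then x p else 0) else 0)"
    by (simp add: inner)
  also have "\<dots> = x p"
    using assms by (auto simp: coord_space_def simples_index_def p)
  finally show "x p = (\<Sum>i'<nsimple D. \<Sum>c'<a i'. copy_incl i' c' (copy_proj i' c' x)) p" by simp
qed

text \<open>Every block between two copies is governed by Schur's lemma, so a homomorphism acts on the
  multiplicity spaces alone, by one matrix for each simple representation.\<close>

lemma hom_sum_of_simples:
  assumes D: "distinct_simples G D"
    and h: "rep_hom G (sum_of_simples D a) (sum_of_simples D b) h"
  shows "\<exists>M. \<forall>x\<in>coord_space (simples_index D a). \<forall>i c' t. i < nsimple D \<longrightarrow> c' < b i \<longrightarrow>
           h x (i, c', t) = (\<Sum>c<a i. M i c' c * x (i, c, t))"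
proof -
  let ?R = "\<lambda>i. mat_rep (sdim D i) (srep D i)"
  note lin = linear_rep_sum_of_simples linear_rep_mat_rep
  define block where "block i c i' c' = copy_proj i' c' \<circ> (h \<circ> copy_incl i c)" for i c i' c'
  have hom: "rep_hom G (?R i) (?R i') (block i c i' c')"
    if "i < nsimple D" "c < a i" "i' < nsimple D" "c' < b i'" for i c i' c'
    unfolding block_def
    by (rule rep_hom_comp[OF rep_hom_comp[OF rep_hom_copy_incl h] rep_hom_copy_proj])
      (use that in simp_all)
  have off_diag: "block i c i' c' s = 0"
    if "i < nsimple D" "c < a i" "i' < nsimple D" "c' < b i'" "i \<noteq> i'" "s \<in> cspace (sdim D i)" for i c i' c' s
  proof -
    have "simple_rep G (?R i)" "simple_rep G (?R i')" "\<not> rep_isomorphic G (?R i) (?R i')"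
      using D that by (simp_all add: distinct_simples_def)
    thus ?thesis
      using schur_zero_or_iso[OF lin(2) lin(2) hom[OF that(1-4)]] that(6)
      by (auto simp: rep_isomorphic_def)
  qed
  have "\<exists>m. \<forall>s\<in>cspace (sdim D i). block i c i c' s = fscale m s"
    if "i < nsimple D" "c < a i" "c' < b i" for i c c'
  proof (rule schur_scalar)
    show "simple_rep G (?R i)" using D that by (simp add: distinct_simples_def)
    show "rep_hom G (?R i) (?R i) (block i c i c')" using hom that by simp
  qed
  hence "\<forall>i c' c. \<exists>m. i < nsimple D \<longrightarrow> c < a i \<longrightarrow> c' < b i \<longrightarrow>
     (\<forall>s\<in>cspace (sdim D i). block i c i c' s = fscale m s)" by blast
  then obtain M where M: "\<And>i c' c s. i < nsimple D \<Longrightarrow> c < a i \<Longrightarrow> c' < b i \<Longrightarrow>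
     s \<in> cspace (sdim D i) \<Longrightarrow> block i c i c' s = fscale (M i c' c) s"
    by metis
  show ?thesis
  proof (intro exI[of _ M] ballI allI impI)
    fix x i c' t assume x: "x \<in> coord_space (simples_index D a)" and i: "i < nsimple D" and c': "c' < b i"
    have px: "copy_proj j c x \<in> cspace (sdim D j)" for j c
      using x by (auto simp: copy_proj_def cspace_def coord_space_def simples_index_def)
    have inX: "copy_incl j c (copy_proj j c x) \<in> rspace (sum_of_simples D a)"
      if "j < nsimple D" "c < a j" for j c
      using rep_homD(1)[OF rep_hom_copy_incl[where a = a, OF that], of "copy_proj j c x"] px by simp
    have sub: "fn.subspace (rspace (sum_of_simples D a))" by (simp add: subspace_coord_space)
    have inS: "(\<Sum>c<a j. copy_incl j c (copy_proj j c x)) \<in> rspace (sum_of_simples D a)"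
      if "j < nsimple D" for j
      using that inX by (intro fn.subspace_sum[OF sub]) simp
    have "h x = h (\<Sum>j<nsimple D. \<Sum>c<a j. copy_incl j c (copy_proj j c x))"
      using sum_of_simples_expand[OF x] by simp
    also have "\<dots> = (\<Sum>j<nsimple D. h (\<Sum>c<a j. copy_incl j c (copy_proj j c x)))"
      using inS by (intro rep_hom_sum[OF lin(1) lin(1) h]) simp
    also have "\<dots> = (\<Sum>j<nsimple D. \<Sum>c<a j. h (copy_incl j c (copy_proj j c x)))"
      using inX by (intro sum.cong refl rep_hom_sum[OF lin(1) lin(1) h]) simp
    finally have "h x (i, c', t) = (\<Sum>j<nsimple D. \<Sum>c<a j. block j c i c' (copy_proj j c x) t)"
      by (simp add: block_def copy_proj_def)
    also have "\<dots> = (\<Sum>j<nsimple D. if j = i then (\<Sum>c<a i. M i c' c * x (i, c, t)) else 0)"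
    proof (rule sum.cong[OF refl])
      fix j assume j: "j \<in> {..<nsimple D}"
      show "(\<Sum>c<a j. block j c i c' (copy_proj j c x) t) = (if j = i then (\<Sum>c<a i. M i c' c * x (i, c, t)) else 0)"
      proof (cases "j = i")
        case True
        thus ?thesis using M[OF i _ c' px] by (simp add: copy_proj_def)
      next
        case False
        thus ?thesis using off_diag[OF _ _ i c' False px] j by simp
      qed
    qed
    also have "\<dots> = (\<Sum>c<a i. M i c' c * x (i, c, t))" using i by simp
    finally show "h x (i, c', t) = (\<Sum>c<a i. M i c' c * x (i, c, t))" .
  qed
qed

text \<open>When the isotypic component of the simple representation $S_i$ is written as
  $S_i \otimes \mathbb{C}^{a_i}$, this is the elementary tensor of the basis vector \<open>t\<close> with \<open>w\<close>.\<close>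

definition mult_incl :: "nat \<Rightarrow> nat \<Rightarrow> (nat \<Rightarrow> complex) \<Rightarrow> nat \<times> nat \<times> nat \<Rightarrow> complex" where
  "mult_incl i t w = (\<lambda>(i', c, t'). if i' = i \<and> t' = t then w c else 0)"

lemma mult_incl_in:
  "i < nsimple D \<Longrightarrow> t < sdim D i \<Longrightarrow> w \<in> cspace (a i) \<Longrightarrow>
     mult_incl i t w \<in> coord_space (simples_index D a)"
  by (auto simp: mult_incl_def coord_space_def simples_index_def cspace_def)

text \<open>A simple representation is nonzero, so it has a basis vector with index \<open>0\<close>. On the elementary
  tensors with this vector an injective homomorphism restricts to the matrix that it induces between
  the multiplicity spaces, and this matrix is therefore injective.\<close>

lemma multiplicity_mono:
  assumes D: "distinct_simples G D"
    and h: "rep_hom G (sum_of_simples D a) (sum_of_simples D b) h"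
    and inj: "\<And>x. x \<in> coord_space (simples_index D a) \<Longrightarrow> h x = 0 \<Longrightarrow> x = 0"
    and i: "i < nsimple D"
  shows "a i \<le> b i"
proof -
  obtain M where M: "\<And>x i c' t. x \<in> coord_space (simples_index D a) \<Longrightarrow> i < nsimple D \<Longrightarrow> c' < b i \<Longrightarrow>
           h x (i, c', t) = (\<Sum>c<a i. M i c' c * x (i, c, t))"
    using hom_sum_of_simples[OF D h] by blast
  have d: "0 < sdim D i" by (rule distinct_simples_sdim_pos[OF D i])
  show ?thesis
  proof (rule injective_matrix_le)
    fix w assume w: "w \<in> cspace (a i)" and z: "\<And>c'. c' < b i \<Longrightarrow> (\<Sum>c<a i. M i c' c * w c) = 0"
    let ?x = "mult_incl i 0 w"
    have x: "?x \<in> coord_space (simples_index D a)" using mult_incl_in[of i D 0 w a] i d w by simp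
    have hx: "h ?x \<in> coord_space (simples_index D b)" using rep_homD(1)[OF h] x by simp
    have "h ?x = 0"
    proof
      fix p :: "nat \<times> nat \<times> nat"
      obtain j c' t where p: "p = (j, c', t)" by (cases p)
      show "h ?x p = 0 p"
      proof (cases "j < nsimple D \<and> c' < b j")
        case True
        hence "h ?x p = (\<Sum>c<a j. M j c' c * ?x (j, c, t))" using M[OF x] p by simp
        also have "\<dots> = 0"
          using z True by (cases "j = i \<and> t = 0") (auto simp: mult_incl_def)
        finally show ?thesis by simp
      next
        case False
        thus ?thesis using hx by (auto simp: coord_space_def simples_index_def p)
      qed
    qed
    hence "?x = 0" using inj x by simp
    hence "?x (i, c, 0) = 0" for c by simp
    thus "w = 0" by (auto simp: mult_incl_def fun_eq_iff)
  qed
qed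

lemma multiplicity_unique:
  assumes D: "distinct_simples G D"
    and "rep_isomorphic G (sum_of_simples D a) (sum_of_simples D b)"
    and i: "i < nsimple D"
  shows "a i = b i"
proof -
  obtain h where h: "rep_iso G (sum_of_simples D a) (sum_of_simples D b) h"
    using assms(2) by (auto simp: rep_isomorphic_def)
  note lin = linear_rep_sum_of_simples
  have le: "a i \<le> b i" if h: "rep_iso G (sum_of_simples D a) (sum_of_simples D b) h" for a b h
  proof (rule multiplicity_mono[OF D _ _ i])
    show hom: "rep_hom G (sum_of_simples D a) (sum_of_simples D b) h"
      using h by (simp add: rep_iso_iff_hom)
    have inj: "inj_on h (coord_space (simples_index D a))"
      using h by (simp add: rep_iso_iff_hom bij_betw_def)
    fix x assume x: "x \<in> coord_space (simples_index D a)" "h x = 0"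
    show "x = 0"
      by (rule inj_onD[OF inj _ x(1) fn.subspace_0[OF subspace_coord_space]])
        (simp add: x(2) rep_hom_zero[OF lin lin hom])
  qed
  show ?thesis using le[OF h] le[OF linear_rep.rep_iso_inv[OF lin h]] by simp
qed

text \<open>The subrepresentation $\bigoplus_i S_i \otimes W_i$ of $\bigoplus_i S_i \otimes \mathbb{C}^{a_i}$.\<close>

definition mult_sub :: "isotypic \<Rightarrow> (nat \<Rightarrow> nat) \<Rightarrow> (nat \<Rightarrow> (nat \<Rightarrow> complex) set) \<Rightarrow>
    (nat \<times> nat \<times> nat \<Rightarrow> complex) set" where
  "mult_sub D a W = {x \<in> coord_space (simples_index D a).
     \<forall>i<nsimple D. \<forall>t<sdim D i. (\<lambda>c. x (i, c, t)) \<in> W i}"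

lemma subrep_mult_sub:
  assumes "\<And>i. i < nsimple D \<Longrightarrow> fn.subspace (W i)"
  shows "subrep G (sum_of_simples D a) (mult_sub D a W)"
proof -
  interpret R: linear_rep G "sum_of_simples D a" by (rule linear_rep_sum_of_simples)
  let ?X = "coord_space (simples_index D a)"
  show ?thesis unfolding subrep_def R.subspace_def
  proof (intro conjI ballI allI)
    show "0 \<in> mult_sub D a W"
      using fn.subspace_0[OF assms] fn.subspace_0[OF subspace_coord_space]
      by (simp add: mult_sub_def zero_fun_def)
  next
    fix x y assume xy: "x \<in> mult_sub D a W" "y \<in> mult_sub D a W"
    have "(\<lambda>c. (x + y) (i, c, t)) = (\<lambda>c. x (i, c, t)) + (\<lambda>c. y (i, c, t))" for i t by auto
    thus "x + y \<in> mult_sub D a W"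
      using xy fn.subspace_add[OF subspace_coord_space, of x _ y] fn.subspace_add[OF assms]
      by (simp add: mult_sub_def)
  next
    fix e x assume x: "x \<in> mult_sub D a W"
    have "(\<lambda>c. (fscale e x) (i, c, t)) = fscale e (\<lambda>c. x (i, c, t))" for i t by auto
    thus "rscale (sum_of_simples D a) e x \<in> mult_sub D a W"
      using x fn.subspace_scale[OF subspace_coord_space, of x] fn.subspace_scale[OF assms]
      by (simp add: mult_sub_def)
  next
    fix g x assume g: "g \<in> G" and x: "x \<in> mult_sub D a W"
    hence xX: "x \<in> ?X" by (simp add: mult_sub_def)
    have "(\<lambda>c. ract (sum_of_simples D a) g x (i, c, t)) \<in> W i" if i: "i < nsimple D" and t: "t < sdim D i" for i t
    proof -
      have "(\<lambda>c. ract (sum_of_simples D a) g x (i, c, t)) =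
          (\<Sum>u<sdim D i. fscale (srep D i g $$ (t, u)) (\<lambda>c. x (i, c, u)))"
        using xX i t by (auto simp: fun_eq_iff sum_of_simples_def coord_space_def simples_index_def)
      also have "\<dots> \<in> W i"
        using x i by (intro fn.subspace_sum fn.subspace_scale assms) (auto simp: mult_sub_def)
      finally show ?thesis .
    qed
    thus "ract (sum_of_simples D a) g x \<in> mult_sub D a W"
      using R.act_closed[OF g, of x] xX by (simp add: mult_sub_def)
  qed (auto simp: mult_sub_def)
qed

text \<open>A subrepresentation is the fixed set of an equivariant projection. The projection acts on the
  multiplicity spaces by matrices, so the subrepresentation is cut out by the fixed vectors of
  these matrices.\<close>

lemma subrep_sum_of_simples:
  assumes D: "distinct_simples G D" and cr: "completely_reducible G (sum_of_simples D a)"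
    and U: "subrep G (sum_of_simples D a) U"
  shows "\<exists>W. (\<forall>i. fn.subspace (W i) \<and> W i \<subseteq> cspace (a i)) \<and> U = mult_sub D a W"
proof -
  let ?R = "sum_of_simples D a" and ?X = "coord_space (simples_index D a)"
  note lin = linear_rep_sum_of_simples
  obtain U' where U': "complementary G ?R U U'" using completely_reducibleD[OF cr U] by blast
  let ?\<pi> = "proj_along U U'"
  obtain M where M: "\<And>x i c' t. x \<in> ?X \<Longrightarrow> i < nsimple D \<Longrightarrow> c' < a i \<Longrightarrow>
           ?\<pi> x (i, c', t) = (\<Sum>c<a i. M i c' c * x (i, c, t))"
    using hom_sum_of_simples[OF D rep_hom_proj_along[OF lin U']] by blast
  define W where "W i = {w \<in> cspace (a i). \<forall>c'<a i. (\<Sum>c<a i. M i c' c * w c) = w c'}" for i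
  have "fn.subspace (W i)" for i
    unfolding fn.subspace_def
    by (auto simp: W_def cspace_def algebra_simps sum.distrib simp flip: sum_distrib_left)
  moreover have "U = mult_sub D a W"
  proof -
    have "x \<in> U \<longleftrightarrow> x \<in> mult_sub D a W" if x: "x \<in> ?X" for x
    proof -
      have "?\<pi> x \<in> ?X" using rep_homD(1)[OF rep_hom_proj_along[OF lin U']] x by simp
      hence "?\<pi> x = x \<longleftrightarrow> (\<forall>i<nsimple D. \<forall>t<sdim D i. \<forall>c'<a i. ?\<pi> x (i, c', t) = x (i, c', t))"
        using x by (auto simp: fun_eq_iff coord_space_def simples_index_def) metis
      also have "\<dots> \<longleftrightarrow> (\<forall>i<nsimple D. \<forall>t<sdim D i. (\<lambda>c. x (i, c, t)) \<in> W i)"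
        using x M[OF x] by (auto simp: W_def cspace_def coord_space_def simples_index_def)
      finally show ?thesis
        using proj_along_fixed_iff[OF lin U', of x] x by (simp add: mult_sub_def)
    qed
    moreover have "U \<subseteq> ?X" using U by (simp add: subrep_def)
    ultimately show ?thesis by (auto simp: mult_sub_def)
  qed
  moreover have "W i \<subseteq> cspace (a i)" for i by (auto simp: W_def)
  ultimately show ?thesis by blast
qed

text \<open>Bases of the spaces $W_i$ decompose $\bigoplus_i S_i \otimes W_i$ into copies of the $S_i$.\<close>

lemma mult_sub_iso:
  assumes W: "\<And>i. i < nsimple D \<Longrightarrow> fn.subspace (W i) \<and> W i \<subseteq> cspace (a i)"
  shows "rep_isomorphic G (sum_of_simples D (\<lambda>i. fn.dim (W i))) (restrict_rep (sum_of_simples D a) (mult_sub D a W))"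
proof -
  let ?f = "\<lambda>i. fn.dim (W i)"
  let ?R = "sum_of_simples D ?f" and ?S = "restrict_rep (sum_of_simples D a) (mult_sub D a W)"
  have "\<forall>i. \<exists>b. i < nsimple D \<longrightarrow> frame (?f i) (W i) b"
    using W by (intro allI) (metis cspace_eq_coord_space finite_lessThan frame_exists)
  then obtain b where b: "\<And>i. i < nsimple D \<Longrightarrow> frame (?f i) (W i) (b i)" by metis
  define h :: "(nat \<times> nat \<times> nat \<Rightarrow> complex) \<Rightarrow> nat \<times> nat \<times> nat \<Rightarrow> complex" where "h y = (\<lambda>(i, c, t). if i < nsimple D \<and> c < a i \<and> t < sdim D i then
     \<Sum>r<?f i. y (i, r, t) * b i r c else 0)" for y
  have linR: "linear_rep G ?R" by (rule linear_rep_sum_of_simples)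
  have linS: "linear_rep G ?S"
    using subrep_mult_sub[of D W] W
    by (intro linear_rep.linear_rep_restrict linear_rep_sum_of_simples) simp
  have bsupp: "b i r c = 0" if "i < nsimple D" "r < ?f i" "c \<ge> a i" for i r c
  proof -
    have "b i r \<in> cspace (a i)" using frame_in[OF b[OF that(1)] that(2)] W[OF that(1)] by blast
    thus ?thesis using that(3) by (simp add: cspace_def)
  qed
  have slice: "(\<lambda>c. h y (i, c, t)) = (\<Sum>r<?f i. fscale (y (i, r, t)) (b i r))"
    if "i < nsimple D" "t < sdim D i" for y i t
    using that bsupp by (auto simp: fun_eq_iff h_def)
  have hom: "rep_hom G ?R ?S h"
  proof (rule rep_homI)
    fix y assume y: "y \<in> rspace ?R"
    have "h y \<in> coord_space (simples_index D a)" by (auto simp: h_def coord_space_def simples_index_def)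
    moreover have "(\<lambda>c. h y (i, c, t)) \<in> W i" if "i < nsimple D" "t < sdim D i" for i t
      unfolding slice[OF that] using W[OF that(1)] frame_in[OF b[OF that(1)]]
      by (intro fn.subspace_sum fn.subspace_scale) auto
    ultimately show "h y \<in> rspace ?S" by (simp add: mult_sub_def)
  next
    fix y z show "h (y + z) = h y + h z"
      by (auto simp: fun_eq_iff h_def algebra_simps sum.distrib)
  next
    fix e y show "h (rscale ?R e y) = rscale ?S e (h y)"
      by (auto simp: fun_eq_iff h_def algebra_simps sum_distrib_left)
  next
    fix g y assume y: "y \<in> rspace ?R"
    show "h (ract ?R g y) = ract ?S g (h y)"
    proof (rule ext)
      fix p :: "nat \<times> nat \<times> nat"
      obtain i c t where p: "p = (i, c, t)" by (cases p)
      show "h (ract ?R g y) p = ract ?S g (h y) p"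
      proof (cases "i < nsimple D \<and> c < a i \<and> t < sdim D i")
        case True
        have "h (ract ?R g y) p = (\<Sum>r<?f i. \<Sum>u<sdim D i. srep D i g $$ (t, u) * y (i, r, u) * b i r c)"
          using True by (simp add: h_def p sum_of_simples_def sum_distrib_right)
        also have "\<dots> = (\<Sum>u<sdim D i. \<Sum>r<?f i. srep D i g $$ (t, u) * y (i, r, u) * b i r c)"
          by (rule sum.swap)
        also have "\<dots> = ract ?S g (h y) p"
          using True by (simp add: h_def p sum_of_simples_def sum_distrib_left mult.assoc)
        finally show ?thesis .
      next
        case False
        thus ?thesis by (auto simp: h_def p sum_of_simples_def)
      qed
    qed
  qed
  have "rep_iso G ?R ?S h"
  proof (rule rep_hom_kernel_iso[OF linR linS hom])
    fix y assume y: "y \<in> rspace ?R" and hy: "h y = 0"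
    show "y = 0"
    proof
      fix p :: "nat \<times> nat \<times> nat"
      obtain i r t where p: "p = (i, r, t)" by (cases p)
      show "y p = 0 p"
      proof (cases "i < nsimple D \<and> r < ?f i \<and> t < sdim D i")
        case True
        have "(\<Sum>r<?f i. fscale (y (i, r, t)) (b i r)) = 0"
          using slice[of i t y] True hy by (simp add: zero_fun_def)
        thus ?thesis using frame_independent[OF b, of i "\<lambda>r. y (i, r, t)" r] True p by simp
      next
        case False
        thus ?thesis using y by (auto simp: coord_space_def simples_index_def p)
      qed
    qed
  next
    show "rspace ?S \<subseteq> h ` rspace ?R"
    proof
      fix x assume "x \<in> rspace ?S"
      hence xX: "x \<in> coord_space (simples_index D a)"
        and xW: "\<And>i t. i < nsimple D \<Longrightarrow> t < sdim D i \<Longrightarrow> (\<lambda>c. x (i, c, t)) \<in> W i"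
        by (auto simp: mult_sub_def)
      define \<mu> where "\<mu> i t = (SOME m. (\<lambda>c. x (i, c, t)) = (\<Sum>r<?f i. fscale (m r) (b i r)))" for i t
      have \<mu>: "(\<lambda>c. x (i, c, t)) = (\<Sum>r<?f i. fscale (\<mu> i t r) (b i r))"
        if "i < nsimple D" "t < sdim D i" for i t
      proof -
        have "\<exists>m. (\<lambda>c. x (i, c, t)) = (\<Sum>r<?f i. fscale (m r) (b i r))"
          using frame_spanning[OF b[OF that(1)] xW[OF that]] by (rule bexE) (rule exI)
        from someI_ex[OF this] show ?thesis unfolding \<mu>_def .
      qed
      define y where "y = (\<lambda>(i, r, t). if i < nsimple D \<and> r < ?f i \<and> t < sdim D i then \<mu> i t r else 0)"
      have "h y = x"
      proof
        fix p :: "nat \<times> nat \<times> nat"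
        obtain i c t where p: "p = (i, c, t)" by (cases p)
        show "h y p = x p"
        proof (cases "i < nsimple D \<and> c < a i \<and> t < sdim D i")
          case True
          have "h y p = (\<Sum>r<?f i. \<mu> i t r * b i r c)" using True by (simp add: h_def y_def p)
          also have "\<dots> = x p" using fun_cong[OF \<mu>, of i t c] True p by simp
          finally show ?thesis .
        next
          case False
          thus ?thesis using xX by (auto simp: h_def p coord_space_def simples_index_def)
        qed
      qed
      moreover have "y \<in> rspace ?R" by (auto simp: y_def coord_space_def simples_index_def)
      ultimately show "x \<in> h ` rspace ?R" by blast
    qed
  qed
  thus ?thesis by (auto simp: rep_isomorphic_def)
qed

text \<open>The copies that make up the first summand are numbered before those of the second one; \<open>lo\<close>
  and \<open>hi\<close> separate the two ranges.\<close>

lemma sum_of_simples_add: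
  assumes linT: "linear_rep G T"
    and h1: "rep_iso G (sum_of_simples D f) (restrict_rep T K) h1"
    and h2: "rep_iso G (sum_of_simples D g) (restrict_rep T C) h2"
    and KC: "complementary G T K C"
  shows "rep_isomorphic G (sum_of_simples D (\<lambda>i. f i + g i)) T"
proof -
  let ?R = "sum_of_simples D (\<lambda>i. f i + g i)"
  let ?X = "coord_space (simples_index D (\<lambda>i. f i + g i))"
  interpret T: linear_rep G T by fact
  note lin = linear_rep_sum_of_simples
  have subK: "subrep G T K" and subC: "subrep G T C" using KC by (auto simp: complementary_def)
  have sub: "T.subspace K" "T.subspace C" "K \<subseteq> rspace T" "C \<subseteq> rspace T"
    using subK subC by (simp_all add: subrep_def)
  have linK: "linear_rep G (restrict_rep T K)" and linC: "linear_rep G (restrict_rep T C)"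
    using T.linear_rep_restrict subK subC by blast+
  define lo :: "(nat \<times> nat \<times> nat \<Rightarrow> complex) \<Rightarrow> nat \<times> nat \<times> nat \<Rightarrow> complex"
    where "lo x = (\<lambda>(i, c, t). if c < f i then x (i, c, t) else 0)" for x
  define hi :: "(nat \<times> nat \<times> nat \<Rightarrow> complex) \<Rightarrow> nat \<times> nat \<times> nat \<Rightarrow> complex"
    where "hi x = (\<lambda>(i, c, t). if c < g i then x (i, c + f i, t) else 0)" for x
  have lo: "rep_hom G ?R (sum_of_simples D f) lo"
    by (rule rep_homI)
      (auto simp: lo_def fun_eq_iff coord_space_def simples_index_def sum_of_simples_def)
  have hi: "rep_hom G ?R (sum_of_simples D g) hi"
    by (rule rep_homI)
      (auto simp: hi_def fun_eq_iff coord_space_def simples_index_def sum_of_simples_def)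
  have hom1: "rep_hom G (sum_of_simples D f) (restrict_rep T K) h1"
    and hom2: "rep_hom G (sum_of_simples D g) (restrict_rep T C) h2"
    using h1 h2 by (simp_all add: rep_iso_iff_hom)
  have k1: "rep_hom G ?R (restrict_rep T K) (h1 \<circ> lo)" and k2: "rep_hom G ?R (restrict_rep T C) (h2 \<circ> hi)"
    using rep_hom_comp[OF lo hom1] rep_hom_comp[OF hi hom2] .
  define h where "h x = (h1 \<circ> lo) x + (h2 \<circ> hi) x" for x
  have in1: "(h1 \<circ> lo) x \<in> K" and in2: "(h2 \<circ> hi) x \<in> C" if "x \<in> ?X" for x
    using rep_homD(1)[OF k1, of x] rep_homD(1)[OF k2, of x] that by simp_all
  have in1T: "(h1 \<circ> lo) x \<in> rspace T" and in2T: "(h2 \<circ> hi) x \<in> rspace T" if "x \<in> ?X" for x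
    using subsetD[OF sub(3) in1[OF that]] subsetD[OF sub(4) in2[OF that]] .
  have hom: "rep_hom G ?R T h"
  proof (rule rep_homI)
    fix x assume "x \<in> rspace ?R"
    thus "h x \<in> rspace T"
      using in1T in2T T.subspace_add[OF T.subspace_rspace] by (simp add: h_def)
  next
    fix x y assume "x \<in> rspace ?R" "y \<in> rspace ?R"
    thus "h (x + y) = h x + h y"
      unfolding h_def using rep_homD(2)[OF k1, of x y] rep_homD(2)[OF k2, of x y]
      by (simp add: algebra_simps)
  next
    fix c x assume x: "x \<in> rspace ?R"
    thus "h (rscale ?R c x) = rscale T c (h x)"
      unfolding h_def using rep_homD(3)[OF k1, of x c] rep_homD(3)[OF k2, of x c]
      by (simp only: restrict_rep_simps T.scale_right_distrib)
  next
    fix a x assume a: "a \<in> G" and x: "x \<in> rspace ?R"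
    hence xX: "x \<in> ?X" by simp
    show "h (ract ?R a x) = ract T a (h x)"
      unfolding h_def T.act_add[OF a in1T[OF xX] in2T[OF xX]]
      using rep_homD(4)[OF k1 a x] rep_homD(4)[OF k2 a x] by simp
  qed
  have "rep_iso G ?R T h"
  proof (rule rep_hom_kernel_iso[OF lin linT hom])
    fix x assume x: "x \<in> rspace ?R" and hx: "h x = 0"
    hence xX: "x \<in> ?X" by simp
    have "(h1 \<circ> lo) x = - (h2 \<circ> hi) x" using hx by (simp add: h_def eq_neg_iff_add_eq_0)
    hence "(h1 \<circ> lo) x \<in> C" using T.subspace_neg[OF sub(2) in2[OF xX]] by simp
    hence z1: "h1 (lo x) = 0" using in1[OF xX] KC by (auto simp: complementary_def)
    hence z2: "h2 (hi x) = 0" using hx by (simp add: h_def)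
    have lX: "lo x \<in> rspace (sum_of_simples D f)" and hX: "hi x \<in> rspace (sum_of_simples D g)"
      using rep_homD(1)[OF lo x] rep_homD(1)[OF hi x] .
    have lo0: "lo x = 0"
    proof (rule inj_onD[of h1 "rspace (sum_of_simples D f)"])
      show "inj_on h1 (rspace (sum_of_simples D f))" using h1 by (simp add: rep_iso_def bij_betw_def)
    qed (use z1 lX rep_hom_zero[OF lin linK hom1] fn.subspace_0[OF subspace_coord_space] in simp_all)
    have hi0: "hi x = 0"
    proof (rule inj_onD[of h2 "rspace (sum_of_simples D g)"])
      show "inj_on h2 (rspace (sum_of_simples D g))" using h2 by (simp add: rep_iso_def bij_betw_def)
    qed (use z2 hX rep_hom_zero[OF lin linC hom2] fn.subspace_0[OF subspace_coord_space] in simp_all)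
    show "x = 0"
    proof
      fix p :: "nat \<times> nat \<times> nat"
      obtain i c t where p: "p = (i, c, t)" by (cases p)
      have l: "lo x (i, c, t) = 0" and u: "hi x (i, c - f i, t) = 0" using lo0 hi0 by simp_all
      show "x p = 0 p"
      proof (cases "c < f i")
        case True thus ?thesis using l by (simp add: lo_def p)
      next
        case False
        show ?thesis
        proof (cases "c - f i < g i")
          case True thus ?thesis using u False by (simp add: hi_def p)
        next
          case F: False
          hence "\<not> c < f i + g i" using False by linarith
          thus ?thesis using xX by (auto simp: coord_space_def simples_index_def p)
        qed
      qed
    qed
  next
    show "rspace T \<subseteq> h ` rspace ?R"
    proof
      fix v assume "v \<in> rspace T"
      then obtain k c where kc: "k \<in> K" "c \<in> C" "v = k + c" using complementary_decompose[OF KC] by metis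
      have "k \<in> h1 ` rspace (sum_of_simples D f)" "c \<in> h2 ` rspace (sum_of_simples D g)"
        using h1 h2 kc by (simp_all add: rep_iso_def bij_betw_def)
      then obtain y z where y: "y \<in> rspace (sum_of_simples D f)" "k = h1 y"
        and z: "z \<in> rspace (sum_of_simples D g)" "c = h2 z" by blast
      define x where "x = (\<lambda>(i, c, t). if c < f i then y (i, c, t) else z (i, c - f i, t))"
      have "lo x = y" "hi x = z"
        using y z by (auto simp: lo_def hi_def x_def fun_eq_iff coord_space_def simples_index_def)
      hence "h x = v" using y z kc by (simp add: h_def)
      moreover have "x \<in> rspace ?R"
        using y z by (auto simp: x_def coord_space_def simples_index_def)
      ultimately show "v \<in> h ` rspace ?R" by blast
    qed
  qed
  thus ?thesis by (auto simp: rep_isomorphic_def)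
qed

lemma simple_rep_iso:
  assumes "linear_rep G R" "linear_rep G S" "rep_iso G R S h" "simple_rep G S"
  shows "simple_rep G R"
proof -
  interpret R: linear_rep G R by fact
  interpret S: linear_rep G S by fact
  have hom: "rep_hom G R S h" and inj: "inj_on h (rspace R)" and img: "h ` rspace R = rspace S"
    using assms(3) by (simp_all add: rep_iso_iff_hom bij_betw_def)
  have h0: "h 0 = 0" by (rule rep_hom_zero[OF assms(1,2) hom])
  show ?thesis unfolding simple_rep_def
  proof (intro conjI allI impI)
    show "rspace R \<noteq> {0}"
    proof
      assume "rspace R = {0}"
      hence "rspace S = {0}" using img h0 by auto
      thus False using assms(4) by (simp add: simple_rep_def)
    qed
  next
    fix U assume U: "subrep G R U"
    hence UR: "U \<subseteq> rspace R" by (simp add: subrep_def)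
    have "h ` U = {0} \<or> h ` U = rspace S"
      using subrep_image[OF assms(1,2) hom U] assms(4) unfolding simple_rep_def by blast
    thus "U = {0} \<or> U = rspace R"
    proof
      assume "h ` U = {0}"
      hence "h ` U = h ` {0}" using h0 by simp
      moreover have "{0} \<subseteq> rspace R" using R.subspace_0[OF R.subspace_rspace] by simp
      ultimately show ?thesis using inj_on_image_eq_iff[OF inj UR] by blast
    next
      assume "h ` U = rspace S"
      hence "h ` U = h ` rspace R" using img by simp
      thus ?thesis using inj_on_image_eq_iff[OF inj UR subset_refl] by blast
    qed
  qed
qed

text \<open>A nonzero subrepresentation of least dimension is simple.\<close>

lemma simple_subrep_exists:
  fixes T :: "('x \<Rightarrow> complex) rep"
  assumes T: "linear_rep G T" "rscale T = fscale" "rspace T \<subseteq> coord_space X" "finite X"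
    and U: "subrep G T U" "U \<noteq> {0}"
  shows "\<exists>S. subrep G T S \<and> S \<subseteq> U \<and> simple_rep G (restrict_rep T S)"
proof -
  define P where "P S \<longleftrightarrow> subrep G T S \<and> S \<subseteq> U \<and> S \<noteq> {0}" for S
  have "P U" using U by (simp add: P_def)
  then obtain S where S: "P S" and least: "\<And>S'. P S' \<Longrightarrow> fn.dim S \<le> fn.dim S'"
    using ex_has_least_nat[of P U fn.dim] by blast
  have "simple_rep G (restrict_rep T S)"
    unfolding simple_rep_def
  proof (intro conjI allI impI)
    show "rspace (restrict_rep T S) \<noteq> {0}" using S by (simp add: P_def)
    fix V assume V: "subrep G (restrict_rep T S) V"
    have sS: "subrep G T S" "S \<subseteq> U" using S by (auto simp: P_def)
    have V': "subrep G T V" "V \<subseteq> S" using V subrep_restrict_iff[OF sS(1)] by auto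
    show "V = {0} \<or> V = rspace (restrict_rep T S)"
    proof (cases "V = {0}")
      case False
      hence "fn.dim S \<le> fn.dim V" using V' sS by (intro least) (auto simp: P_def)
      moreover have sub: "fn.subspace V" "fn.subspace S" "S \<subseteq> coord_space X"
        using V' sS T by (auto simp: subrep_def)
      ultimately have "V = S"
        using dim_subset_coord_space[OF T(4) V'(2) sub(3,1,2)] by linarith
      thus ?thesis by simp
    qed simp
  qed
  thus ?thesis using S by (auto simp: P_def)
qed

lemma single_copy_iso:
  assumes "i < nsimple D"
  shows "rep_isomorphic G (sum_of_simples D (\<lambda>j. if j = i then 1 else 0)) (mat_rep (sdim D i) (srep D i))"
proof -
  let ?a = "\<lambda>j. if j = i then 1 else (0::nat)"
  have "rep_iso G (sum_of_simples D ?a) (mat_rep (sdim D i) (srep D i)) (copy_proj i 0)"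
  proof (rule rep_hom_kernel_iso[OF linear_rep_sum_of_simples linear_rep_mat_rep])
    show "rep_hom G (sum_of_simples D ?a) (mat_rep (sdim D i) (srep D i)) (copy_proj i 0)"
      using assms by (intro rep_hom_copy_proj) simp_all
    show "rspace (mat_rep (sdim D i) (srep D i)) \<subseteq> copy_proj i 0 ` rspace (sum_of_simples D ?a)"
    proof
      fix s assume s: "s \<in> rspace (mat_rep (sdim D i) (srep D i))"
      have "copy_incl i 0 s \<in> rspace (sum_of_simples D ?a)"
        using rep_homD(1)[OF rep_hom_copy_incl[OF assms, of 0 ?a] s] by simp
      moreover have "copy_proj i 0 (copy_incl i 0 s) = s" by (simp add: copy_proj_def copy_incl_def)
      ultimately show "s \<in> copy_proj i 0 ` rspace (sum_of_simples D ?a)" by (metis imageI)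
    qed
    fix x assume x: "x \<in> rspace (sum_of_simples D ?a)" and z: "copy_proj i 0 x = 0"
    show "x = 0"
    proof
      fix p :: "nat \<times> nat \<times> nat"
      obtain j c t where p: "p = (j, c, t)" by (cases p)
      show "x p = 0 p"
        using x fun_cong[OF z, of t]
        by (cases "j = i \<and> c = 0") (auto simp: p copy_proj_def coord_space_def simples_index_def)
    qed
  qed
  thus ?thesis by (auto simp: rep_isomorphic_def)
qed

definition rational_simples :: "nat \<Rightarrow> complex mat set \<Rightarrow> isotypic \<Rightarrow> bool" where
  "rational_simples m G D \<longleftrightarrow>
     distinct_simples G D \<and> (\<forall>i<nsimple D. rational_rep m G (sdim D i) (srep D i))"

definition extends :: "isotypic \<Rightarrow> isotypic \<Rightarrow> bool" where
  "extends D D' \<longleftrightarrow> nsimple D \<le> nsimple D' \<and>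
     (\<forall>i<nsimple D. sdim D' i = sdim D i \<and> srep D' i = srep D i)"

lemma extends_refl: "extends D D"
  by (simp add: extends_def)

lemma extends_trans: "extends D D' \<Longrightarrow> extends D' D'' \<Longrightarrow> extends D D''"
  by (auto simp: extends_def)

lemma sum_of_simples_extend:
  assumes "extends D D'"
  shows "sum_of_simples D' (\<lambda>i. if i < nsimple D then f i else 0) = sum_of_simples D f"
proof -
  have "i < nsimple D' \<and> c < (if i < nsimple D then f i else 0) \<and> t < sdim D' i \<longleftrightarrow>
        i < nsimple D \<and> c < f i \<and> t < sdim D i" for i c t
    using assms by (auto simp: extends_def)
  moreover have "srep D' i = srep D i" "sdim D' i = sdim D i" if "i < nsimple D" for i
    using assms that by (auto simp: extends_def)
  ultimately show ?thesis
    unfolding sum_of_simples_def by (auto simp: fun_eq_iff)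
qed

text \<open>By induction on the dimension one simple subrepresentation is split off at a time. Its
  isomorphism type is either already in the list of simple representations or is appended to it.
  The list given at the start is kept, so that the two summands of a decomposition can be expressed
  with one common list.\<close>

lemma decomposition_exists:
  fixes T :: "(nat list \<Rightarrow> complex) rep"
  assumes T: "linear_rep G T" "rscale T = fscale" "rspace T \<subseteq> coord_space X" "finite X"
    and cr: "completely_reducible G T"
    and rat: "\<And>S. subrep G T S \<Longrightarrow> \<exists>d \<sigma>. rational_rep m G d \<sigma> \<and> rep_isomorphic G (mat_rep d \<sigma>) (restrict_rep T S)"
    and D0: "rational_simples m G D0"
    and U: "subrep G T U"
  shows "\<exists>D f. rational_simples m G D \<and> extends D0 D \<and>
           rep_isomorphic G (sum_of_simples D f) (restrict_rep T U)"
  using U D0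
proof (induction "fn.dim U" arbitrary: U D0 rule: less_induct)
  case less
  interpret T: linear_rep G T by fact
  show ?case
  proof (cases "U = {0}")
    case True
    have X0: "coord_space (simples_index D0 (\<lambda>_. 0)) = {0}"
      by (auto simp: coord_space_def simples_index_def fun_eq_iff)
    have "rep_iso G (sum_of_simples D0 (\<lambda>_. 0)) (restrict_rep T U) (\<lambda>_. 0)"
    proof (rule rep_hom_kernel_iso[OF linear_rep_sum_of_simples T.linear_rep_restrict[OF less.prems(1)]])
      have "ract T g 0 = 0" if "g \<in> G" for g
        using T.act_scale[OF that T.subspace_0[OF T.subspace_rspace], of 0] T(2) by simp
      thus "rep_hom G (sum_of_simples D0 (\<lambda>_. 0)) (restrict_rep T U) (\<lambda>_. 0)"
        using T.subspace_0[OF T.subspace_rspace] True by (intro rep_homI) (simp_all add: T(2))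
    qed (use True X0 in simp_all)
    thus ?thesis using less.prems(2) extends_refl unfolding rep_isomorphic_def by blast
  next
    case False
    obtain S where S: "subrep G T S" "S \<subseteq> U" "simple_rep G (restrict_rep T S)"
      using simple_subrep_exists[OF T less.prems(1) False] by blast
    have "completely_reducible G (restrict_rep T U)"
      by (rule completely_reducible_restrict[OF T(1) cr less.prems(1)])
    moreover have "subrep G (restrict_rep T U) S" using S subrep_restrict_iff[OF less.prems(1)] by blast
    ultimately obtain U' where U': "complementary G (restrict_rep T U) S U'"
      using completely_reducibleD by blast
    hence sU': "subrep G T U'" "U' \<subseteq> U" "S \<inter> U' = {0}"
      using subrep_restrict_iff[OF less.prems(1)] by (auto simp: complementary_def)
    have S0: "S \<noteq> {0}" using S(3) by (simp add: simple_rep_def)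
    have "U' \<noteq> U" using sU'(3) S(2) S0 by blast
    moreover have sp: "fn.subspace U" "fn.subspace U'" "U \<subseteq> coord_space X"
      using less.prems(1) sU' T(2,3) by (auto simp: subrep_def)
    ultimately have "fn.dim U' < fn.dim U"
      using dim_subset_coord_space[OF T(4) sU'(2) sp(3,2,1)] by linarith
    from less.hyps[OF this sU'(1) less.prems(2)] obtain D f where D: "rational_simples m G D" "extends D0 D"
      "rep_isomorphic G (sum_of_simples D f) (restrict_rep T U')" by blast
    obtain d \<sigma> where \<sigma>: "rational_rep m G d \<sigma>" "rep_isomorphic G (mat_rep d \<sigma>) (restrict_rep T S)"
      using rat[OF S(1)] by blast
    have simp\<sigma>: "simple_rep G (mat_rep d \<sigma>)"
      using \<sigma>(2) simple_rep_iso[OF linear_rep_mat_rep T.linear_rep_restrict[OF S(1)] _ S(3)]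
      by (auto simp: rep_isomorphic_def)
    have "\<exists>D' i. rational_simples m G D' \<and> extends D D' \<and> i < nsimple D' \<and>
        rep_isomorphic G (mat_rep (sdim D' i) (srep D' i)) (mat_rep d \<sigma>)"
    proof (cases "\<exists>i<nsimple D. rep_isomorphic G (mat_rep (sdim D i) (srep D i)) (mat_rep d \<sigma>)")
      case True
      thus ?thesis using D(1) extends_refl by blast
    next
      case no: False
      define D' where "D' = D\<lparr>nsimple := Suc (nsimple D), sdim := (sdim D)(nsimple D := d),
         srep := (srep D)(nsimple D := \<sigma>)\<rparr>"
      have "\<not> rep_isomorphic G (mat_rep d \<sigma>) (mat_rep (sdim D i) (srep D i))" if "i < nsimple D" for i
        using no that linear_rep.rep_isomorphic_sym[OF linear_rep_mat_rep] by blast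
      hence "rational_simples m G D'"
        using D(1) \<sigma>(1) simp\<sigma> no
        by (auto simp: rational_simples_def distinct_simples_def D'_def less_Suc_eq)
      moreover have "extends D D'" by (auto simp: extends_def D'_def)
      moreover have "nsimple D < nsimple D'" "sdim D' (nsimple D) = d" "srep D' (nsimple D) = \<sigma>"
        by (simp_all add: D'_def)
      ultimately show ?thesis using rep_isomorphic_refl by metis
    qed
    then obtain D' i where D': "rational_simples m G D'" "extends D D'" "i < nsimple D'"
      "rep_isomorphic G (mat_rep (sdim D' i) (srep D' i)) (mat_rep d \<sigma>)" by blast
    let ?f = "\<lambda>i. if i < nsimple D then f i else 0" and ?g = "\<lambda>j. if j = i then 1 else (0::nat)"
    have "rep_isomorphic G (sum_of_simples D' ?g) (restrict_rep T S)"
      using rep_isomorphic_trans[OF rep_isomorphic_trans[OF single_copy_iso[OF D'(3)] D'(4)] \<sigma>(2)] .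
    moreover have "rep_isomorphic G (sum_of_simples D' ?f) (restrict_rep T U')"
      using D(3) sum_of_simples_extend[OF D'(2)] by simp
    moreover have "restrict_rep (restrict_rep T U) V = restrict_rep T V" for V
      by (simp add: restrict_rep_def)
    ultimately obtain h1 h2 where
      "rep_iso G (sum_of_simples D' ?g) (restrict_rep (restrict_rep T U) S) h1"
      "rep_iso G (sum_of_simples D' ?f) (restrict_rep (restrict_rep T U) U') h2"
      by (auto simp: rep_isomorphic_def)
    from sum_of_simples_add[OF T.linear_rep_restrict[OF less.prems(1)] this U']
    have "rep_isomorphic G (sum_of_simples D' (\<lambda>j. ?g j + ?f j)) (restrict_rep T U)" by simp
    thus ?thesis using D'(1) extends_trans[OF D(2) D'(2)] by blast
  qed
qed

lemma sum_of_simples_cong: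
  assumes "\<And>i. i < nsimple D \<Longrightarrow> f i = f' i"
  shows "sum_of_simples D f = sum_of_simples D f'"
proof -
  have "i < nsimple D \<and> c < f i \<and> t < sdim D i \<longleftrightarrow> i < nsimple D \<and> c < f' i \<and> t < sdim D i" for i c t
    using assms by auto
  thus ?thesis unfolding sum_of_simples_def by simp
qed

lemma isotypic_decomposition_iff:
  "isotypic_decomposition m G T K D \<longleftrightarrow> rational_simples m G D \<and>
     rep_iso G (sum_of_simples D (tot_mult D)) T (tiso D) \<and>
     rep_isomorphic G (sum_of_simples D (ker_mult D)) (restrict_rep T K)"
  by (auto simp: isotypic_decomposition_def rational_simples_def distinct_simples_def)

lemma isotypic_sub_eq_image: "isotypic_sub D W = tiso D ` mult_sub D (tot_mult D) W"
  by (simp add: isotypic_sub_def mult_sub_def)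

lemma linear_rep_of_subrep: "linear_rep G T \<Longrightarrow> subrep G T U \<Longrightarrow> linear_rep G (restrict_rep T U)"
  by (rule linear_rep.linear_rep_restrict)

text \<open>What the arguments use about a tensor power of $V$. An isotypic decomposition asks for simple
  representations by matrices of regular functions, so subrepresentations have to be available in
  this form.\<close>

locale semisimple_rep = linear_rep G T for G and T :: "(nat list \<Rightarrow> complex) rep" +
  fixes m :: nat and X :: "nat list set"
  assumes scale_fscale: "rscale T = fscale"
    and finite_support: "finite X" "rspace T \<subseteq> coord_space X"
    and reducible: "completely_reducible G T"
    and rational: "subrep G T S \<Longrightarrow>
          \<exists>d \<sigma>. rational_rep m G d \<sigma> \<and> rep_isomorphic G (mat_rep d \<sigma>) (restrict_rep T S)"
begin

lemma linear_rep_T: "linear_rep G T" ..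

text \<open>The simple representations found in the first summand start the list for the second one.\<close>

lemma common_decomposition:
  assumes "complementary G T K C"
  shows "\<exists>D f g h. rational_simples m G D \<and> rep_isomorphic G (sum_of_simples D f) (restrict_rep T K) \<and>
     rep_isomorphic G (sum_of_simples D g) (restrict_rep T C) \<and>
     rep_iso G (sum_of_simples D (\<lambda>i. f i + g i)) T h"
proof -
  have K: "subrep G T K" and C: "subrep G T C" using assms by (auto simp: complementary_def)
  note dec = decomposition_exists[OF linear_rep_T scale_fscale finite_support(2,1) reducible rational]
  define D0 :: isotypic where "D0 = \<lparr>nsimple = 0, sdim = (\<lambda>_. 0), srep = (\<lambda>_ _. 1\<^sub>m 0),
    tot_mult = (\<lambda>_. 0), ker_mult = (\<lambda>_. 0), tiso = (\<lambda>_. 0)\<rparr>"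
  have "rational_simples m G D0" by (simp add: D0_def rational_simples_def distinct_simples_def)
  from dec[OF _ this K] obtain D1 f where D1: "rational_simples m G D1"
    "rep_isomorphic G (sum_of_simples D1 f) (restrict_rep T K)" by blast
  from dec[OF _ D1(1) C] obtain D g where D: "rational_simples m G D" "extends D1 D"
    "rep_isomorphic G (sum_of_simples D g) (restrict_rep T C)" by blast
  define f' where "f' i = (if i < nsimple D1 then f i else 0)" for i
  have f': "rep_isomorphic G (sum_of_simples D f') (restrict_rep T K)"
    using D1(2) sum_of_simples_extend[OF D(2), of f] by (simp add: f'_def[abs_def])
  obtain h1 h2 where "rep_iso G (sum_of_simples D f') (restrict_rep T K) h1"
      "rep_iso G (sum_of_simples D g) (restrict_rep T C) h2"
    using f' D(3) by (auto simp: rep_isomorphic_def)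
  from sum_of_simples_add[OF linear_rep_T this assms]
  obtain h where "rep_iso G (sum_of_simples D (\<lambda>i. f' i + g i)) T h" by (auto simp: rep_isomorphic_def)
  thus ?thesis using D f' by blast
qed

lemma isotypic_decomposition_exists:
  assumes "subrep G T K"
  shows "\<exists>D. isotypic_decomposition m G T K D"
proof -
  obtain C where "complementary G T K C" using completely_reducibleD[OF reducible assms] by blast
  from common_decomposition[OF this] obtain D f g h where D: "rational_simples m G D"
    "rep_isomorphic G (sum_of_simples D f) (restrict_rep T K)"
    "rep_iso G (sum_of_simples D (\<lambda>i. f i + g i)) T h" by blast
  define D' where "D' = D\<lparr>tot_mult := (\<lambda>i. f i + g i), ker_mult := f, tiso := h\<rparr>"
  have "sum_of_simples D' = sum_of_simples D"
    by (intro ext) (simp add: sum_of_simples_def D'_def cong: if_cong)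
  moreover have "rational_simples m G D'"
    using D(1) by (simp add: rational_simples_def distinct_simples_def D'_def)
  moreover have "tot_mult D' = (\<lambda>i. f i + g i)" "ker_mult D' = f" "tiso D' = h"
    by (simp_all add: D'_def)
  ultimately have "isotypic_decomposition m G T K D'"
    using D by (simp add: isotypic_decomposition_iff)
  thus ?thesis by blast
qed

text \<open>The classification of subrepresentations of a direct sum of simple representations, moved along
  the given isomorphism.\<close>

lemma subrep_isotypic:
  assumes D: "distinct_simples G D" and h: "rep_iso G (sum_of_simples D a) T h" and U: "subrep G T U"
  shows "\<exists>W. (\<forall>i. fn.subspace (W i) \<and> W i \<subseteq> cspace (a i)) \<and> U = h ` mult_sub D a W \<and>
     rep_isomorphic G (sum_of_simples D (\<lambda>i. fn.dim (W i))) (restrict_rep T U)"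
proof -
  let ?R = "sum_of_simples D a"
  let ?k = "inv_into (rspace ?R) h"
  note lin = linear_rep_sum_of_simples
  have k: "rep_iso G T ?R ?k" using linear_rep.rep_iso_inv[OF lin h] .
  have cr: "completely_reducible G ?R" by (rule completely_reducible_iso[OF linear_rep_T lin k reducible])
  have "subrep G ?R (?k ` U)"
    using k subrep_image[OF linear_rep_T lin _ U] by (simp add: rep_iso_iff_hom)
  from subrep_sum_of_simples[OF D cr this] obtain W where
    W: "\<And>i. fn.subspace (W i) \<and> W i \<subseteq> cspace (a i)" "?k ` U = mult_sub D a W" by blast
  have "U \<subseteq> rspace T" using U by (simp add: subrep_def)
  hence "h ` (?k ` U) = U"
    using h by (intro image_inv_into_cancel) (simp_all add: rep_iso_def bij_betw_def)
  hence hU: "U = h ` mult_sub D a W" using W(2) by simp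
  have "mult_sub D a W \<subseteq> rspace ?R" by (auto simp: mult_sub_def)
  from rep_iso_restrict[OF h this] have "rep_isomorphic G (restrict_rep ?R (mult_sub D a W)) (restrict_rep T U)"
    using hU by (auto simp: rep_isomorphic_def)
  from rep_isomorphic_trans[OF mult_sub_iso[OF W(1)] this]
  have "rep_isomorphic G (sum_of_simples D (\<lambda>i. fn.dim (W i))) (restrict_rep T U)" .
  thus ?thesis using W(1) hU by blast
qed

lemma isotypic_sub_subrep:
  assumes D: "isotypic_decomposition m G T K D"
    and W: "\<And>i. i < nsimple D \<Longrightarrow> W i \<in> Grass (ker_mult D i) (tot_mult D i)"
  shows "subrep G T (isotypic_sub D W)"
    and "rep_isomorphic G (restrict_rep T (isotypic_sub D W)) (restrict_rep T K)"
proof -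
  let ?R = "sum_of_simples D (tot_mult D)" and ?M = "mult_sub D (tot_mult D) W"
  have h: "rep_iso G ?R T (tiso D)" using D by (simp add: isotypic_decomposition_iff)
  have Ws: "fn.subspace (W i) \<and> W i \<subseteq> cspace (tot_mult D i)" "fn.dim (W i) = ker_mult D i" if "i < nsimple D" for i
    using W[OF that] by (simp_all add: Grass_def)
  have M: "subrep G ?R ?M" using Ws by (intro subrep_mult_sub) simp
  show "subrep G T (isotypic_sub D W)"
    using subrep_image[OF linear_rep_sum_of_simples linear_rep_T _ M] h
    by (simp add: isotypic_sub_eq_image rep_iso_iff_hom)
  have MR: "?M \<subseteq> rspace ?R" by (auto simp: mult_sub_def)
  have "rep_isomorphic G (restrict_rep ?R ?M) (restrict_rep T (isotypic_sub D W))"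
    using rep_iso_restrict[OF h MR] by (auto simp: rep_isomorphic_def isotypic_sub_eq_image)
  hence 1: "rep_isomorphic G (restrict_rep T (isotypic_sub D W)) (restrict_rep ?R ?M)"
    by (rule linear_rep.rep_isomorphic_sym[OF linear_rep_of_subrep[OF linear_rep_sum_of_simples M]])
  have 2: "rep_isomorphic G (restrict_rep ?R ?M) (sum_of_simples D (\<lambda>i. fn.dim (W i)))"
    by (rule linear_rep.rep_isomorphic_sym[OF linear_rep_sum_of_simples mult_sub_iso]) (rule Ws)
  have "sum_of_simples D (\<lambda>i. fn.dim (W i)) = sum_of_simples D (ker_mult D)"
    by (rule sum_of_simples_cong) (rule Ws(2))
  hence "rep_isomorphic G (sum_of_simples D (\<lambda>i. fn.dim (W i))) (restrict_rep T K)"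
    using D by (simp add: isotypic_decomposition_iff)
  from rep_isomorphic_trans[OF rep_isomorphic_trans[OF 1 2] this]
  show "rep_isomorphic G (restrict_rep T (isotypic_sub D W)) (restrict_rep T K)" .
qed

lemma isotypic_sub_surj:
  assumes D: "isotypic_decomposition m G T K D" and K: "subrep G T K"
    and U: "subrep G T U" "rep_isomorphic G (restrict_rep T U) (restrict_rep T K)"
  shows "\<exists>W. (\<forall>i<nsimple D. W i \<in> Grass (ker_mult D i) (tot_mult D i)) \<and> U = isotypic_sub D W"
proof -
  have h: "rep_iso G (sum_of_simples D (tot_mult D)) T (tiso D)" and ds: "distinct_simples G D"
    and ker: "rep_isomorphic G (sum_of_simples D (ker_mult D)) (restrict_rep T K)"
    using D by (simp_all add: isotypic_decomposition_iff rational_simples_def)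
  obtain W where W: "\<And>i. fn.subspace (W i) \<and> W i \<subseteq> cspace (tot_mult D i)"
    "U = tiso D ` mult_sub D (tot_mult D) W"
    "rep_isomorphic G (sum_of_simples D (\<lambda>i. fn.dim (W i))) (restrict_rep T U)"
    using subrep_isotypic[OF ds h U(1)] by blast
  have "rep_isomorphic G (restrict_rep T K) (sum_of_simples D (ker_mult D))"
    by (rule linear_rep.rep_isomorphic_sym[OF linear_rep_sum_of_simples ker])
  from rep_isomorphic_trans[OF rep_isomorphic_trans[OF W(3) U(2)] this]
  have "rep_isomorphic G (sum_of_simples D (\<lambda>i. fn.dim (W i))) (sum_of_simples D (ker_mult D))" .
  from multiplicity_unique[OF ds this] have "fn.dim (W i) = ker_mult D i" if "i < nsimple D" for i
    using that by simp
  thus ?thesis using W(1,2) by (intro exI[of _ W]) (simp add: Grass_def isotypic_sub_eq_image)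
qed

text \<open>The multiplicity space is recovered as the set of those vectors whose elementary tensor with the
  basis vector \<open>0\<close> of the simple representation lies in the subrepresentation.\<close>

lemma isotypic_sub_inj:
  assumes D: "isotypic_decomposition m G T K D"
    and W: "\<And>i. i < nsimple D \<Longrightarrow> W i \<in> Grass (ker_mult D i) (tot_mult D i)"
    and W': "\<And>i. i < nsimple D \<Longrightarrow> W' i \<in> Grass (ker_mult D i) (tot_mult D i)"
    and eq: "isotypic_sub D W = isotypic_sub D W'" and i: "i < nsimple D"
  shows "W i = W' i"
proof -
  have inj: "inj_on (tiso D) (coord_space (simples_index D (tot_mult D)))"
    using D by (simp add: isotypic_decomposition_iff rep_iso_def bij_betw_def)
  have sub: "mult_sub D (tot_mult D) V \<subseteq> coord_space (simples_index D (tot_mult D))" for V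
    by (auto simp: mult_sub_def)
  have eq': "mult_sub D (tot_mult D) W = mult_sub D (tot_mult D) W'"
    using eq inj_on_image_eq_iff[OF inj sub sub] by (simp add: isotypic_sub_eq_image)
  have pos: "0 < sdim D i"
    using D distinct_simples_sdim_pos[OF _ i] by (auto simp: isotypic_decomposition_iff rational_simples_def)
  have mem: "w \<in> V i \<longleftrightarrow> w \<in> cspace (tot_mult D i) \<and> mult_incl i 0 w \<in> mult_sub D (tot_mult D) V"
    if V: "\<And>i. i < nsimple D \<Longrightarrow> V i \<in> Grass (ker_mult D i) (tot_mult D i)" for V w
  proof -
    have zero: "(\<lambda>c. 0) \<in> V j" if "j < nsimple D" for j
      using V[OF that] fn.subspace_0[of "V j"] by (simp add: Grass_def zero_fun_def)
    have Vi: "V i \<subseteq> cspace (tot_mult D i)" using V[OF i] by (simp add: Grass_def)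
    have slice: "(\<lambda>c. mult_incl i 0 w (j, c, t)) = (if j = i \<and> t = 0 then w else (\<lambda>c. 0))" for j t
      by (auto simp: mult_incl_def)
    show ?thesis
    proof
      assume w: "w \<in> V i"
      hence "w \<in> cspace (tot_mult D i)" using Vi by blast
      thus "w \<in> cspace (tot_mult D i) \<and> mult_incl i 0 w \<in> mult_sub D (tot_mult D) V"
        using w zero mult_incl_in[of i D 0 w "tot_mult D"] i pos by (simp add: mult_sub_def slice)
    next
      assume "w \<in> cspace (tot_mult D i) \<and> mult_incl i 0 w \<in> mult_sub D (tot_mult D) V"
      hence "(\<lambda>c. mult_incl i 0 w (i, c, 0)) \<in> V i" using i pos by (simp add: mult_sub_def)
      thus "w \<in> V i" by (simp add: slice)
    qed
  qed
  show ?thesis using mem[of W] mem[of W'] W W' eq' by blast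
qed

text \<open>Multiplicities are additive and determine the isomorphism type. Hence, in a fixed semisimple
  representation, two subrepresentations are isomorphic as soon as they have isomorphic
  complements.\<close>

lemma complement_cancel:
  assumes 1: "complementary G T K1 C1" and 2: "complementary G T K2 C2"
    and iso: "rep_isomorphic G (restrict_rep T C1) (restrict_rep T C2)"
  shows "rep_isomorphic G (restrict_rep T K1) (restrict_rep T K2)"
proof -
  have K1: "subrep G T K1" and C1: "subrep G T C1" and K2: "subrep G T K2" and C2: "subrep G T C2"
    using 1 2 by (auto simp: complementary_def)
  obtain D f g h where D: "rational_simples m G D"
    and f: "rep_isomorphic G (sum_of_simples D f) (restrict_rep T K1)"
    and g: "rep_isomorphic G (sum_of_simples D g) (restrict_rep T C1)"
    and h: "rep_iso G (sum_of_simples D (\<lambda>i. f i + g i)) T h" using common_decomposition[OF 1] by blast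
  have ds: "distinct_simples G D" using D by (simp add: rational_simples_def)
  obtain f2 where f2: "rep_isomorphic G (sum_of_simples D f2) (restrict_rep T K2)"
    using subrep_isotypic[OF ds h K2] by blast
  obtain g2 where g2: "rep_isomorphic G (sum_of_simples D g2) (restrict_rep T C2)"
    using subrep_isotypic[OF ds h C2] by blast
  note sym' = linear_rep.rep_isomorphic_sym[OF linear_rep_sum_of_simples]
  have gg: "g i = g2 i" if "i < nsimple D" for i
    by (rule multiplicity_unique[OF ds _ that])
      (rule rep_isomorphic_trans[OF rep_isomorphic_trans[OF g iso] sym'[OF g2]])
  obtain h1 h2 where "rep_iso G (sum_of_simples D f2) (restrict_rep T K2) h1"
      "rep_iso G (sum_of_simples D g2) (restrict_rep T C2) h2"
    using f2 g2 by (auto simp: rep_isomorphic_def)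
  from sum_of_simples_add[OF linear_rep_T this 2]
  have "rep_isomorphic G (sum_of_simples D (\<lambda>i. f2 i + g2 i)) T" .
  moreover have "rep_isomorphic G T (sum_of_simples D (\<lambda>i. f i + g i))"
    using rep_isomorphic_sym linear_rep.rep_iso_inv[OF linear_rep_sum_of_simples h]
    by (auto simp: rep_isomorphic_def)
  ultimately have "rep_isomorphic G (sum_of_simples D (\<lambda>i. f2 i + g2 i)) (sum_of_simples D (\<lambda>i. f i + g i))"
    by (rule rep_isomorphic_trans)
  from multiplicity_unique[OF ds this] gg have "f i = f2 i" if "i < nsimple D" for i
    using that by fastforce
  hence "sum_of_simples D f = sum_of_simples D f2" by (rule sum_of_simples_cong)
  thus ?thesis using rep_isomorphic_trans[OF sym'[OF f]] f2 by simp
qed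

end

section \<open>Tensor powers of a rational representation of a reductive group\<close>

lemma GL_simps:
  "carrier (GL d) = Units (ring_mat TYPE(complex) d ())" "mult (GL d) = (*)" "one (GL d) = 1\<^sub>m d"
  by (simp_all add: units_of_carrier units_of_mult units_of_one ring_mat_simps)

lemma group_GL: "group (GL d)"
proof -
  interpret R: ring "ring_mat TYPE(complex) d ()" by (rule ring_mat)
  show ?thesis by (rule R.units_group)
qed

lemma GL_carrier_mat: "g \<in> carrier (GL d) \<Longrightarrow> g \<in> carrier_mat d d"
  by (auto simp: GL_simps Units_def ring_mat_simps)

lemma polyfun_sum: "(\<And>a. a \<in> A \<Longrightarrow> f a \<in> polyfun I) \<Longrightarrow> (\<lambda>x. \<Sum>a\<in>A. f a x) \<in> polyfun I"
  by (induction A rule: infinite_finite_induct) (auto intro: polyfun.intros)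

lemma polyfun_prod: "(\<And>a. a \<in> A \<Longrightarrow> f a \<in> polyfun I) \<Longrightarrow> (\<lambda>x. \<Prod>a\<in>A. f a x) \<in> polyfun I"
  by (induction A rule: infinite_finite_induct) (auto intro: polyfun.intros)

lemma polyfun_power: "p \<in> polyfun I \<Longrightarrow> (\<lambda>x. p x ^ N) \<in> polyfun I"
  by (induction N) (auto intro: polyfun.intros)

lemma polyfun_cmult: "p \<in> polyfun I \<Longrightarrow> (\<lambda>x. c * p x) \<in> polyfun I"
  by (intro polyfun.mult polyfun.const)

locale algebraic_group =
  fixes m :: nat and G :: "complex mat set"
  assumes lin_alg: "linear_algebraic_group m G"
begin

lemma subgroup_G: "subgroup G (GL m)"
  using lin_alg by (simp add: linear_algebraic_group_def)

lemma group_G: "group ((GL m)\<lparr>carrier := G\<rparr>)"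
  by (rule subgroup.subgroup_is_group[OF subgroup_G group_GL])

lemma G_carrier: "g \<in> G \<Longrightarrow> g \<in> carrier_mat m m"
  using subgroup.subset[OF subgroup_G] GL_carrier_mat by blast

lemma G_inverse: "g \<in> G \<Longrightarrow> \<exists>h\<in>G. h * g = 1\<^sub>m m \<and> g * h = 1\<^sub>m m"
proof -
  assume g: "g \<in> G"
  interpret GG: group "(GL m)\<lparr>carrier := G\<rparr>" by (rule group_G)
  show ?thesis using GG.inv_closed[of g] GG.l_inv[of g] GG.r_inv[of g] g
    by (intro bexI[of _ "inv\<^bsub>(GL m)\<lparr>carrier := G\<rparr>\<^esub> g"]) (simp_all add: GL_simps)
qed

lemma det_nonzero: "g \<in> G \<Longrightarrow> det g \<noteq> 0"
  using subsetD[OF subgroup.subset[OF subgroup_G], of g] unit_imp_det_non_zero[of g m "()"]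
  by (simp add: GL_simps)

lemma det_polyfun:
  "\<exists>p\<in>polyfun ({..<m} \<times> {..<m}). \<forall>g\<in>G. det g = p (matrix_entries g)"
proof (intro bexI ballI)
  let ?p = "\<lambda>x. \<Sum>\<pi> \<in> {\<pi>. \<pi> permutes {0..<m}}. signof \<pi> * (\<Prod>i\<in>{0..<m}. x (i, \<pi> i))"
  show "?p \<in> polyfun ({..<m} \<times> {..<m})"
  proof (rule polyfun_sum)
    fix \<pi> assume "\<pi> \<in> {\<pi>. \<pi> permutes {0..<m}}"
    hence "\<pi> i < m" if "i < m" for i using that permutes_in_image[of \<pi> "{0..<m}" i] by auto
    thus "(\<lambda>x. signof \<pi> * (\<Prod>i\<in>{0..<m}. x (i, \<pi> i))) \<in> polyfun ({..<m} \<times> {..<m})"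
      by (intro polyfun_cmult polyfun_prod polyfun.var) auto
  qed
  show "det g = ?p (matrix_entries g)" if "g \<in> G" for g
    using det_def'[OF G_carrier[OF that]] by (simp add: matrix_entries_def)
qed

lemma regular_const: "regular_on m G (\<lambda>_. c)"
  unfolding regular_on_def by (rule bexI[of _ "\<lambda>_. c"], rule exI[of _ 0]) (auto intro: polyfun.intros)

text \<open>Bringing two fractions to a common denominator takes powers of the determinant into the
  numerator; they are polynomials in the matrix entries.\<close>

lemma regular_add:
  assumes "regular_on m G u" "regular_on m G v"
  shows "regular_on m G (\<lambda>g. u g + v g)"
proof -
  obtain p M where p: "p \<in> polyfun ({..<m} \<times> {..<m})" "\<And>g. g \<in> G \<Longrightarrow> u g = p (matrix_entries g) / det g ^ M"
    using assms(1) unfolding regular_on_def by blast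
  obtain q N where q: "q \<in> polyfun ({..<m} \<times> {..<m})" "\<And>g. g \<in> G \<Longrightarrow> v g = q (matrix_entries g) / det g ^ N"
    using assms(2) unfolding regular_on_def by blast
  obtain d where d: "d \<in> polyfun ({..<m} \<times> {..<m})" "\<And>g. g \<in> G \<Longrightarrow> det g = d (matrix_entries g)"
    using det_polyfun by blast
  let ?r = "\<lambda>x. p x * d x ^ N + q x * d x ^ M"
  have "?r \<in> polyfun ({..<m} \<times> {..<m})" using p q d by (intro polyfun.add polyfun.mult polyfun_power)
  moreover have "u g + v g = ?r (matrix_entries g) / det g ^ (M + N)" if g: "g \<in> G" for g
    using p(2)[OF g] q(2)[OF g] d(2)[OF g, symmetric] det_nonzero[OF g]
    by (simp add: field_simps power_add)
  ultimately show ?thesis unfolding regular_on_def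
    by (intro bexI[of _ ?r] exI[of _ "M + N"] ballI)
qed

lemma regular_mult:
  assumes "regular_on m G u" "regular_on m G v"
  shows "regular_on m G (\<lambda>g. u g * v g)"
proof -
  obtain p M where p: "p \<in> polyfun ({..<m} \<times> {..<m})" "\<And>g. g \<in> G \<Longrightarrow> u g = p (matrix_entries g) / det g ^ M"
    using assms(1) unfolding regular_on_def by blast
  obtain q N where q: "q \<in> polyfun ({..<m} \<times> {..<m})" "\<And>g. g \<in> G \<Longrightarrow> v g = q (matrix_entries g) / det g ^ N"
    using assms(2) unfolding regular_on_def by blast
  have "(\<lambda>x. p x * q x) \<in> polyfun ({..<m} \<times> {..<m})" using p q by (intro polyfun.mult)
  moreover have "u g * v g = p (matrix_entries g) * q (matrix_entries g) / det g ^ (M + N)" if g: "g \<in> G" for g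
    using p(2)[OF g] q(2)[OF g] by (simp add: power_add)
  ultimately show ?thesis unfolding regular_on_def
    by (intro bexI[of _ "\<lambda>x. p x * q x"] exI[of _ "M + N"] ballI)
qed

lemma regular_sum: "(\<And>a. a \<in> A \<Longrightarrow> regular_on m G (u a)) \<Longrightarrow> regular_on m G (\<lambda>g. \<Sum>a\<in>A. u a g)"
  by (induction A rule: infinite_finite_induct) (auto intro: regular_const regular_add)

lemma regular_prod: "(\<And>a. a \<in> A \<Longrightarrow> regular_on m G (u a)) \<Longrightarrow> regular_on m G (\<lambda>g. \<Prod>a\<in>A. u a g)"
  by (induction A rule: infinite_finite_induct) (auto intro: regular_const regular_mult)

lemma rational_repI:
  assumes car: "\<And>g. g \<in> G \<Longrightarrow> \<sigma> g \<in> carrier_mat d d" and one: "\<sigma> (1\<^sub>m m) = 1\<^sub>m d"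
    and mult: "\<And>g h. g \<in> G \<Longrightarrow> h \<in> G \<Longrightarrow> \<sigma> (g * h) = \<sigma> g * \<sigma> h"
    and reg: "\<And>i j. i < d \<Longrightarrow> j < d \<Longrightarrow> regular_on m G (\<lambda>g. \<sigma> g $$ (i, j))"
  shows "rational_rep m G d \<sigma>"
proof -
  have "\<sigma> g \<in> carrier (GL d)" if g: "g \<in> G" for g
  proof -
    obtain h where h: "h \<in> G" "h * g = 1\<^sub>m m" "g * h = 1\<^sub>m m" using G_inverse[OF g] by blast
    have "\<sigma> h * \<sigma> g = 1\<^sub>m d" "\<sigma> g * \<sigma> h = 1\<^sub>m d" using mult g h one by metis+
    thus ?thesis using car[OF g] car[OF h(1)] by (auto simp: GL_simps Units_def ring_mat_simps)
  qed
  thus ?thesis using mult reg by (auto simp: rational_rep_def hom_def GL_simps)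
qed

lemma rational_repD:
  assumes "rational_rep m G d \<sigma>"
  shows "g \<in> G \<Longrightarrow> \<sigma> g \<in> carrier_mat d d" and "\<sigma> (1\<^sub>m m) = 1\<^sub>m d"
    and "g \<in> G \<Longrightarrow> h \<in> G \<Longrightarrow> \<sigma> (g * h) = \<sigma> g * \<sigma> h"
    and "i < d \<Longrightarrow> j < d \<Longrightarrow> regular_on m G (\<lambda>g. \<sigma> g $$ (i, j))"
proof -
  have hom: "\<sigma> \<in> hom ((GL m)\<lparr>carrier := G\<rparr>) (GL d)" using assms by (simp add: rational_rep_def)
  show "g \<in> G \<Longrightarrow> \<sigma> g \<in> carrier_mat d d"
    using hom GL_carrier_mat by (auto simp: hom_def)
  show "g \<in> G \<Longrightarrow> h \<in> G \<Longrightarrow> \<sigma> (g * h) = \<sigma> g * \<sigma> h"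
    using hom by (auto simp: hom_def GL_simps)
  show "i < d \<Longrightarrow> j < d \<Longrightarrow> regular_on m G (\<lambda>g. \<sigma> g $$ (i, j))"
    using assms by (simp add: rational_rep_def)
  interpret group_hom "(GL m)\<lparr>carrier := G\<rparr>" "GL d" \<sigma>
    by (intro group_hom.intro group_hom_axioms.intro group_G group_GL hom)
  show "\<sigma> (1\<^sub>m m) = 1\<^sub>m d" using hom_one by (simp add: GL_simps)
qed

end

subsection \<open>Words and tensor powers\<close>

lemma words_0: "words n 0 = {[]}"
  by (auto simp: words_def)

lemma words_Suc: "words n (Suc j) = (\<lambda>(i, u). i # u) ` ({..<n} \<times> words n j)"
proof (intro equalityI subsetI)
  fix w assume "w \<in> words n (Suc j)"
  then obtain i u where "w = i # u" "i < n" "u \<in> words n j"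
    by (cases w) (auto simp: words_def)
  thus "w \<in> (\<lambda>(i, u). i # u) ` ({..<n} \<times> words n j)" by force
qed (auto simp: words_def)

lemma finite_words: "finite (words n j)"
  by (induction j) (simp_all add: words_0 words_Suc)

lemma words_length: "w \<in> words n j \<Longrightarrow> length w = j"
  by (simp add: words_def)

lemma words_nth: "w \<in> words n j \<Longrightarrow> s < j \<Longrightarrow> w ! s < n"
  using nth_mem[of s w] unfolding words_def by blast

lemma sum_words_Suc: "(\<Sum>u\<in>words n (Suc j). f u) = (\<Sum>i<n. \<Sum>u\<in>words n j. f (i # u))"
proof -
  have "inj_on (\<lambda>(i, u). i # u) ({..<n} \<times> words n j)" by (auto simp: inj_on_def)
  thus ?thesis unfolding words_Suc
    by (subst sum.reindex) (auto simp: sum.cartesian_product intro!: sum.cong)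
qed

text \<open>A product of sums is expanded into a sum over words; this makes Kronecker powers multiplicative.\<close>

lemma sum_words_prod:
  "(\<Sum>u\<in>words n j. \<Prod>s<j. F s (u ! s)) = (\<Prod>s<j. \<Sum>i<n. (F s i :: complex))"
proof (induction j arbitrary: F)
  case (Suc j)
  have "(\<Sum>u\<in>words n (Suc j). \<Prod>s<Suc j. F s (u ! s)) =
      (\<Sum>i<n. \<Sum>u\<in>words n j. F 0 i * (\<Prod>s<j. F (Suc s) (u ! s)))"
    by (simp add: sum_words_Suc prod.lessThan_Suc_shift del: prod.lessThan_Suc)
  also have "\<dots> = (\<Sum>i<n. F 0 i) * (\<Sum>u\<in>words n j. \<Prod>s<j. F (Suc s) (u ! s))"
    by (simp add: sum_product)
  also have "\<dots> = (\<Prod>s<Suc j. \<Sum>i<n. F s i)"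
    by (simp add: Suc.IH[of "\<lambda>s. F (Suc s)"] prod.lessThan_Suc_shift del: prod.lessThan_Suc)
  finally show ?case .
qed (simp add: words_0)

text \<open>An entry of the Kronecker power of \<open>\<rho> g\<close>, with rows and columns indexed by words.\<close>

definition tensor_entry :: "(complex mat \<Rightarrow> complex mat) \<Rightarrow> complex mat \<Rightarrow> nat list \<Rightarrow> nat list \<Rightarrow> complex" where
  "tensor_entry \<rho> g w u = (\<Prod>s<length w. \<rho> g $$ (w ! s, u ! s))"

lemma tensor_rep_act:
  "ract (tensor_rep n \<rho> j) g t w = (if w \<in> words n j then \<Sum>u\<in>words n j. tensor_entry \<rho> g w u * t u else 0)"
  by (auto simp: tensor_rep_def tensor_entry_def words_length)

lemma tensor_rep_act_sum:
  "ract (tensor_rep n \<rho> j) g (\<Sum>s\<in>S. f s) = (\<Sum>s\<in>S. ract (tensor_rep n \<rho> j) g (f s))"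
proof
  fix w show "ract (tensor_rep n \<rho> j) g (\<Sum>s\<in>S. f s) w = (\<Sum>s\<in>S. ract (tensor_rep n \<rho> j) g (f s)) w"
    by (auto simp: tensor_rep_act sum_distrib_left intro: sum.swap)
qed

lemma tensor_rep_act_in: "ract (tensor_rep n \<rho> j) g t \<in> tensor_power n j"
  by (simp add: tensor_power_def tensor_rep_act)

context algebraic_group
begin

lemma tensor_entry_mult:
  assumes \<rho>: "rational_rep m G n \<rho>" and gh: "g \<in> G" "h \<in> G" and wu: "w \<in> words n j" "u \<in> words n j"
  shows "tensor_entry \<rho> (g * h) w u = (\<Sum>v\<in>words n j. tensor_entry \<rho> g w v * tensor_entry \<rho> h v u)"
proof -
  have c: "\<rho> g \<in> carrier_mat n n" "\<rho> h \<in> carrier_mat n n" using rational_repD(1)[OF \<rho>] gh by auto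
  have e: "\<rho> (g * h) $$ (a, b) = (\<Sum>i<n. \<rho> g $$ (a, i) * \<rho> h $$ (i, b))" if "a < n" "b < n" for a b
    using rational_repD(3)[OF \<rho> gh] c that by (simp add: scalar_prod_def atLeast0LessThan)
  have "tensor_entry \<rho> (g * h) w u = (\<Prod>s<j. \<Sum>i<n. \<rho> g $$ (w ! s, i) * \<rho> h $$ (i, u ! s))"
    using wu by (auto simp: tensor_entry_def words_length e words_nth intro!: prod.cong)
  also have "\<dots> = (\<Sum>v\<in>words n j. \<Prod>s<j. \<rho> g $$ (w ! s, v ! s) * \<rho> h $$ (v ! s, u ! s))"
    by (rule sum_words_prod[symmetric])
  also have "\<dots> = (\<Sum>v\<in>words n j. tensor_entry \<rho> g w v * tensor_entry \<rho> h v u)"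
    using wu by (auto simp: tensor_entry_def words_length prod.distrib intro!: sum.cong)
  finally show ?thesis .
qed

lemma tensor_entry_one:
  assumes \<rho>: "rational_rep m G n \<rho>" and wu: "w \<in> words n j" "u \<in> words n j"
  shows "tensor_entry \<rho> (1\<^sub>m m) w u = (if w = u then 1 else 0)"
proof -
  have "tensor_entry \<rho> (1\<^sub>m m) w u = (\<Prod>s<j. if w ! s = u ! s then 1 else 0)"
    using wu by (auto simp: tensor_entry_def rational_repD(2)[OF \<rho>] words_length words_nth intro!: prod.cong)
  also have "\<dots> = (if w = u then 1 else 0)"
  proof (cases "w = u")
    case False
    then obtain s where "s < j" "w ! s \<noteq> u ! s"
      using wu nth_equalityI[of w u] by (auto simp: words_length)
    thus ?thesis using False by auto
  qed simp
  finally show ?thesis .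
qed

lemma tensor_entry_regular:
  assumes "rational_rep m G n \<rho>" "w \<in> words n j" "u \<in> words n j"
  shows "regular_on m G (\<lambda>g. tensor_entry \<rho> g w u)"
  unfolding tensor_entry_def
  using assms by (intro regular_prod rational_repD(4)[OF assms(1)]) (auto simp: words_nth words_length)

lemma tensor_rep_mult:
  assumes \<rho>: "rational_rep m G n \<rho>" and gh: "g \<in> G" "h \<in> G"
  shows "ract (tensor_rep n \<rho> j) (g * h) t = ract (tensor_rep n \<rho> j) g (ract (tensor_rep n \<rho> j) h t)"
proof
  fix w
  show "ract (tensor_rep n \<rho> j) (g * h) t w = ract (tensor_rep n \<rho> j) g (ract (tensor_rep n \<rho> j) h t) w"
  proof (cases "w \<in> words n j")
    case True
    have "ract (tensor_rep n \<rho> j) (g * h) t w =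
        (\<Sum>u\<in>words n j. \<Sum>v\<in>words n j. tensor_entry \<rho> g w v * tensor_entry \<rho> h v u * t u)"
      using True by (simp add: tensor_rep_act tensor_entry_mult[OF \<rho> gh True] sum_distrib_right)
    also have "\<dots> = (\<Sum>v\<in>words n j. \<Sum>u\<in>words n j. tensor_entry \<rho> g w v * tensor_entry \<rho> h v u * t u)"
      by (rule sum.swap)
    also have "\<dots> = ract (tensor_rep n \<rho> j) g (ract (tensor_rep n \<rho> j) h t) w"
      using True by (simp add: tensor_rep_act sum_distrib_left mult.assoc)
    finally show ?thesis .
  qed (simp add: tensor_rep_act)
qed

lemma tensor_rep_one:
  assumes \<rho>: "rational_rep m G n \<rho>" and t: "t \<in> tensor_power n j"
  shows "ract (tensor_rep n \<rho> j) (1\<^sub>m m) t = t"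
proof
  fix w
  show "ract (tensor_rep n \<rho> j) (1\<^sub>m m) t w = t w"
  proof (cases "w \<in> words n j")
    case True
    have "ract (tensor_rep n \<rho> j) (1\<^sub>m m) t w = (\<Sum>u\<in>words n j. if w = u then t u else 0)"
      using True by (auto simp: tensor_rep_act tensor_entry_one[OF \<rho> True] intro!: sum.cong)
    thus ?thesis using True finite_words by simp
  qed (use t in \<open>simp add: tensor_rep_act tensor_power_def\<close>)
qed

text \<open>In the basis of words the tensor power is a matrix representation by Kronecker powers, whose
  entries are products of entries of the given representation.\<close>

lemma tensor_rep_completely_reducible:
  assumes red: "reductive_group m G" and \<rho>: "rational_rep m G n \<rho>"
  shows "completely_reducible G (tensor_rep n \<rho> j)"
proof -
  let ?T = "tensor_rep n \<rho> j"
  define N where "N = card (words n j)"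
  obtain e where e: "bij_betw e {..<N} (words n j)"
    using ex_bij_betw_nat_finite[OF finite_words[of n j]] by (auto simp: N_def atLeast0LessThan)
  define \<kappa> where "\<kappa> g = mat N N (\<lambda>(a, b). tensor_entry \<rho> g (e a) (e b))" for g
  have ew: "e a \<in> words n j" if "a < N" for a using e that by (auto simp: bij_betw_def)
  have sum_e: "(\<Sum>a<N. f (e a)) = (\<Sum>u\<in>words n j. f u)" for f :: "nat list \<Rightarrow> complex"
    by (rule sum.reindex_bij_betw[OF e])
  have "rational_rep m G N \<kappa>"
  proof (rule rational_repI)
    show "\<kappa> g \<in> carrier_mat N N" for g by (simp add: \<kappa>_def)
    show "\<kappa> (1\<^sub>m m) = 1\<^sub>m N"
    proof (rule eq_matI)
      fix a b assume ab: "a < dim_row (1\<^sub>m N :: complex mat)" "b < dim_col (1\<^sub>m N :: complex mat)"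
      hence "e a = e b \<longleftrightarrow> a = b" using e by (auto simp: bij_betw_def inj_on_def)
      thus "\<kappa> (1\<^sub>m m) $$ (a, b) = 1\<^sub>m N $$ (a, b)"
        using ab by (simp add: \<kappa>_def tensor_entry_one[OF \<rho> ew ew])
    qed (simp_all add: \<kappa>_def)
    show "\<kappa> (g * h) = \<kappa> g * \<kappa> h" if gh: "g \<in> G" "h \<in> G" for g h
    proof (rule eq_matI)
      fix a b assume "a < dim_row (\<kappa> g * \<kappa> h)" "b < dim_col (\<kappa> g * \<kappa> h)"
      hence ab: "a < N" "b < N" by (simp_all add: \<kappa>_def)
      have "\<kappa> (g * h) $$ (a, b) = (\<Sum>c<N. tensor_entry \<rho> g (e a) (e c) * tensor_entry \<rho> h (e c) (e b))"
        using ab tensor_entry_mult[OF \<rho> gh ew ew, of a b] sum_e[of "\<lambda>v. tensor_entry \<rho> g (e a) v * tensor_entry \<rho> h v (e b)"]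
        by (simp add: \<kappa>_def)
      also have "\<dots> = (\<kappa> g * \<kappa> h) $$ (a, b)"
        using ab by (simp add: \<kappa>_def scalar_prod_def atLeast0LessThan)
      finally show "\<kappa> (g * h) $$ (a, b) = (\<kappa> g * \<kappa> h) $$ (a, b)" .
    qed (simp_all add: \<kappa>_def)
    show "regular_on m G (\<lambda>g. \<kappa> g $$ (a, b))" if "a < N" "b < N" for a b
      using tensor_entry_regular[OF \<rho> ew ew, of a b] that by (simp add: \<kappa>_def)
  qed
  hence cr: "completely_reducible G (mat_rep N \<kappa>)" using red by (simp add: reductive_group_def)
  define e' where "e' = the_inv_into {..<N} e"
  have e'e: "e' (e a) = a" if "a < N" for a
    unfolding e'_def using e that by (intro the_inv_into_f_f) (auto simp: bij_betw_def)
  have ee': "e (e' w) = w" and e'N: "e' w < N" if "w \<in> words n j" for w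
  proof -
    show "e (e' w) = w" unfolding e'_def using e that by (intro f_the_inv_into_f) (auto simp: bij_betw_def)
    show "e' w < N" using the_inv_into_into[of e "{..<N}" w "{..<N}"] e that by (auto simp: e'_def bij_betw_def)
  qed
  define h where "h x = (\<lambda>w. if w \<in> words n j then x (e' w) else 0 :: complex)" for x
  have he: "h x (e a) = x a" if "a < N" for x a using that ew e'e by (simp add: h_def)
  have "rep_iso G (mat_rep N \<kappa>) ?T h"
  proof (rule rep_hom_kernel_iso[OF linear_rep_mat_rep linear_rep_tensor_rep])
    show "rep_hom G (mat_rep N \<kappa>) ?T h"
    proof (rule rep_homI)
      fix g x
      show "h (ract (mat_rep N \<kappa>) g x) = ract ?T g (h x)"
      proof
        fix w
        show "h (ract (mat_rep N \<kappa>) g x) w = ract ?T g (h x) w"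
        proof (cases "w \<in> words n j")
          case True
          have "h (ract (mat_rep N \<kappa>) g x) w = (\<Sum>b<N. tensor_entry \<rho> g w (e b) * h x (e b))"
            proof -
            have "h (ract (mat_rep N \<kappa>) g x) w = ract (mat_rep N \<kappa>) g x (e' w)"
              using True by (simp add: h_def)
            thus ?thesis using e'N[OF True] ee'[OF True] by (simp add: mat_rep_def \<kappa>_def he)
          qed
          also have "\<dots> = ract ?T g (h x) w"
            using True sum_e[of "\<lambda>u. tensor_entry \<rho> g w u * h x u"] by (simp add: tensor_rep_act)
          finally show ?thesis .
        qed (simp add: h_def tensor_rep_act)
      qed
    qed (auto simp: h_def tensor_power_def fun_eq_iff)
    show "x = 0" if x: "x \<in> rspace (mat_rep N \<kappa>)" and z: "h x = 0" for x
    proof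
      fix a show "x a = 0 a"
        using he[of a x] z x by (cases "a < N") (simp_all add: cspace_def)
    qed
    show "rspace ?T \<subseteq> h ` rspace (mat_rep N \<kappa>)"
    proof
      fix t assume t: "t \<in> rspace ?T"
      have "h (\<lambda>a. if a < N then t (e a) else 0) = t"
        using t e'N ee' by (auto simp: h_def tensor_power_def fun_eq_iff)
      moreover have "(\<lambda>a. if a < N then t (e a) else 0) \<in> rspace (mat_rep N \<kappa>)" by (simp add: cspace_def)
      ultimately show "t \<in> h ` rspace (mat_rep N \<kappa>)" by (rule image_eqI[OF sym])
    qed
  qed
  thus ?thesis using completely_reducible_iso[OF linear_rep_mat_rep linear_rep_tensor_rep _ cr] by blast
qed

text \<open>In a basis of a subrepresentation the group acts by matrices. Their entries are linear
  combinations of the entries of the whole representation, because the coordinates with respect to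
  the basis extend to linear functionals on the whole space.\<close>

lemma tensor_subrep_rational:
  assumes \<rho>: "rational_rep m G n \<rho>" and S: "subrep G (tensor_rep n \<rho> j) S"
  shows "\<exists>d \<sigma>. rational_rep m G d \<sigma> \<and> rep_isomorphic G (mat_rep d \<sigma>) (restrict_rep (tensor_rep n \<rho> j) S)"
proof -
  let ?T = "tensor_rep n \<rho> j"
  interpret T: linear_rep G ?T by (rule linear_rep_tensor_rep)
  define d where "d = fn.dim S"
  have Ss: "fn.subspace S" "S \<subseteq> tensor_power n j" and act: "\<And>g x. g \<in> G \<Longrightarrow> x \<in> S \<Longrightarrow> ract ?T g x \<in> S"
    using S by (auto simp: subrep_def)
  have "S \<subseteq> coord_space (words n j)" using Ss by (simp add: tensor_power_eq_coord_space)
  from frame_exists[OF finite_words this Ss(1)] obtain b where b: "frame d S b"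
    unfolding d_def by (rule exE)
  have ind: "fn.independent (b ` {..<d})" and inj: "inj_on b {..<d}" using b by (auto simp: frame_def)
  \<comment> \<open>with a basis of the whole function space, coordinates are defined on all tensors, so they can be
     evaluated on single words\<close>
  define E where "E = fn.extend_basis (b ` {..<d})"
  have E: "fn.independent E" "fn.span E = UNIV" "b ` {..<d} \<subseteq> E"
    unfolding E_def using fn.independent_extend_basis[OF ind] fn.span_extend_basis[OF ind]
      fn.extend_basis_superset[OF ind] by auto
  define L where "L i v = fn.representation E v (b i)" for i v
  have Ladd: "L i (u + v) = L i u + L i v" for i u v
    unfolding L_def using fn.representation_add[OF E(1), of v u] E(2) by simp
  have Lscale: "L i (fscale c v) = c * L i v" for i c v
    unfolding L_def using fn.representation_scale[OF E(1), of v c] E(2) by simp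
  have L0: "L i 0 = 0" for i using Lscale[of i 0 0] by simp
  have Lsum: "L i (\<Sum>a\<in>A. f a) = (\<Sum>a\<in>A. L i (f a))" for i A and f :: "_ \<Rightarrow> _"
    by (induction A rule: infinite_finite_induct) (simp_all only: sum.infinite sum.empty sum.insert L0 Ladd not_False_eq_True)
  have Lb: "L i (b r) = (if i = r then 1 else 0)" if "i < d" "r < d" for i r
  proof -
    have "b r \<in> E" using E(3) that by blast
    moreover have "b i = b r \<longleftrightarrow> i = r" using inj that by (auto simp: inj_on_def)
    ultimately show ?thesis unfolding L_def using fn.representation_basis[OF E(1)] by simp
  qed
  have expand: "v = (\<Sum>r<d. fscale (L r v) (b r))" if vS: "v \<in> S" for v
  proof -
    obtain \<mu> where \<mu>: "v = (\<Sum>r<d. fscale (\<mu> r) (b r))"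
      using frame_spanning[OF b vS] by (rule bexE)
    have "L r v = \<mu> r" if r: "r < d" for r
    proof -
      have "L r v = (\<Sum>s<d. \<mu> s * L r (b s))" by (simp add: \<mu> Lsum Lscale)
      also have "\<dots> = (\<Sum>s<d. if s = r then \<mu> s else 0)" using r by (intro sum.cong) (auto simp: Lb)
      finally show ?thesis using r by simp
    qed
    thus ?thesis using \<mu> by simp
  qed
  have bS: "b r \<in> S" if "r < d" for r using frame_in[OF b that] .
  have bT: "b r \<in> tensor_power n j" if "r < d" for r using bS[OF that] Ss by blast
  define \<sigma> where "\<sigma> g = mat d d (\<lambda>(i, r). L i (ract ?T g (b r)))" for g
  have acts: "ract ?T g (b r) = (\<Sum>i<d. fscale (\<sigma> g $$ (i, r)) (b i))" if "g \<in> G" "r < d" for g r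
    using expand[OF act[OF that(1) bS[OF that(2)]]] that by (simp add: \<sigma>_def)
  have act_sum: "ract ?T g (\<Sum>r<d. fscale (\<mu> r) (b r)) = (\<Sum>r<d. fscale (\<mu> r) (ract ?T g (b r)))"
    if "g \<in> G" for g \<mu>
    unfolding tensor_rep_act_sum using T.act_scale[OF that] bT by (intro sum.cong) simp_all
  have rat: "rational_rep m G d \<sigma>"
  proof (rule rational_repI)
    show "\<sigma> g \<in> carrier_mat d d" for g by (simp add: \<sigma>_def)
    show "\<sigma> (1\<^sub>m m) = 1\<^sub>m d"
      by (rule eq_matI) (auto simp: \<sigma>_def tensor_rep_one[OF \<rho> bT] Lb)
    show "\<sigma> (g * h) = \<sigma> g * \<sigma> h" if gh: "g \<in> G" "h \<in> G" for g h
    proof (rule eq_matI)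
      fix i r assume "i < dim_row (\<sigma> g * \<sigma> h)" "r < dim_col (\<sigma> g * \<sigma> h)"
      hence ir: "i < d" "r < d" by (simp_all add: \<sigma>_def)
      have "\<sigma> (g * h) $$ (i, r) = L i (ract ?T g (ract ?T h (b r)))"
        using ir by (simp add: \<sigma>_def tensor_rep_mult[OF \<rho> gh])
      also have "\<dots> = (\<Sum>s<d. \<sigma> h $$ (s, r) * L i (ract ?T g (b s)))"
        by (simp add: acts[OF gh(2) ir(2)] act_sum[OF gh(1)] Lsum Lscale)
      also have "\<dots> = (\<Sum>s<d. \<sigma> g $$ (i, s) * \<sigma> h $$ (s, r))"
        using ir by (intro sum.cong) (auto simp: \<sigma>_def)
      also have "\<dots> = (\<sigma> g * \<sigma> h) $$ (i, r)"
        using ir by (simp add: \<sigma>_def scalar_prod_def atLeast0LessThan)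
      finally show "\<sigma> (g * h) $$ (i, r) = (\<sigma> g * \<sigma> h) $$ (i, r)" .
    qed (simp_all add: \<sigma>_def)
    show "regular_on m G (\<lambda>g. \<sigma> g $$ (i, r))" if ir: "i < d" "r < d" for i r
    proof -
      have "\<sigma> g $$ (i, r) = (\<Sum>w\<in>words n j. (\<Sum>u\<in>words n j. tensor_entry \<rho> g w u * b r u) * L i (delta w))" for g
      proof -
        let ?v = "ract ?T g (b r)"
        have "?v \<in> coord_space (words n j)" by (simp add: coord_space_def tensor_rep_act)
        from coord_space_expand[OF finite_words this]
        have "L i ?v = L i (\<Sum>w\<in>words n j. fscale (?v w) (delta w))" by simp
        also have "\<dots> = (\<Sum>w\<in>words n j. ?v w * L i (delta w))" by (simp add: Lsum Lscale)
        finally show ?thesis using ir by (simp add: \<sigma>_def tensor_rep_act)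
      qed
      moreover have "regular_on m G (\<lambda>g. \<Sum>w\<in>words n j. (\<Sum>u\<in>words n j. tensor_entry \<rho> g w u * b r u) * L i (delta w))"
        by (intro regular_sum regular_mult regular_const tensor_entry_regular[OF \<rho>])
      ultimately show ?thesis by simp
    qed
  qed
  define h where "h \<mu> = (\<Sum>r<d. fscale (\<mu> r) (b r))" for \<mu>
  have "rep_iso G (mat_rep d \<sigma>) (restrict_rep ?T S) h"
  proof (rule rep_hom_kernel_iso[OF linear_rep_mat_rep T.linear_rep_restrict[OF S]])
    show "rep_hom G (mat_rep d \<sigma>) (restrict_rep ?T S) h"
    proof (rule rep_homI)
      fix \<mu> show "h \<mu> \<in> rspace (restrict_rep ?T S)"
        using bS by (auto simp: h_def intro!: fn.subspace_sum[OF Ss(1)] fn.subspace_scale[OF Ss(1)])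
    next
      fix \<mu> \<nu> show "h (\<mu> + \<nu>) = h \<mu> + h \<nu>"
        by (simp add: h_def fn.scale_left_distrib sum.distrib)
    next
      fix c \<mu> show "h (rscale (mat_rep d \<sigma>) c \<mu>) = rscale (restrict_rep ?T S) c (h \<mu>)"
        by (simp add: h_def fn.scale_sum_right)
    next
      fix g \<mu> assume g: "g \<in> G"
      have "ract ?T g (h \<mu>) = (\<Sum>r<d. \<Sum>i<d. fscale (\<sigma> g $$ (i, r) * \<mu> r) (b i))"
        by (simp add: h_def act_sum[OF g] acts[OF g] fn.scale_sum_right mult.commute)
      also have "\<dots> = (\<Sum>i<d. \<Sum>r<d. fscale (\<sigma> g $$ (i, r) * \<mu> r) (b i))" by (rule sum.swap)
      also have "\<dots> = h (ract (mat_rep d \<sigma>) g \<mu>)"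
        by (simp add: h_def mat_rep_def fn.scale_sum_left)
      finally show "h (ract (mat_rep d \<sigma>) g \<mu>) = ract (restrict_rep ?T S) g (h \<mu>)" by simp
    qed
    show "\<mu> = 0" if \<mu>: "\<mu> \<in> rspace (mat_rep d \<sigma>)" and z: "h \<mu> = 0" for \<mu>
    proof
      fix r show "\<mu> r = 0 r"
        using frame_independent[OF b, of \<mu> r] z \<mu> by (cases "r < d") (simp_all add: h_def cspace_def)
    qed
    show "rspace (restrict_rep ?T S) \<subseteq> h ` rspace (mat_rep d \<sigma>)"
      using frame_spanning[OF b] by (auto simp: h_def)
  qed
  thus ?thesis using rat by (auto simp: rep_isomorphic_def)
qed

lemma semisimple_tensor_rep:
  assumes "reductive_group m G" "rational_rep m G n \<rho>"
  shows "semisimple_rep G (tensor_rep n \<rho> j) m (words n j)"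
proof -
  interpret T: linear_rep G "tensor_rep n \<rho> j" by (rule linear_rep_tensor_rep)
  show ?thesis
    by unfold_locales
      (use tensor_rep_completely_reducible[OF assms] tensor_subrep_rational[OF assms(2)] finite_words in
        \<open>simp_all add: tensor_power_eq_coord_space\<close>)
qed

end

section \<open>Incidence conditions on Grassmannians in Pluecker coordinates\<close>

text \<open>The maximal minor at a list of columns, possibly unsorted or with repetitions. Such lists arise
  when one column is replaced by another.\<close>

definition minor :: "nat \<Rightarrow> (nat \<Rightarrow> nat \<Rightarrow> complex) \<Rightarrow> nat list \<Rightarrow> complex" where
  "minor f b L = det (mat f f (\<lambda>(r, s). b r (L ! s)))"

lemma pluecker_eq_minor: "pluecker f b I = minor f b (sorted_list_of_set I)"
  by (simp add: pluecker_def minor_def)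

lemma minor_not_distinct:
  assumes "length L = f" "\<not> distinct L"
  shows "minor f b L = 0"
proof -
  obtain s s' where s: "s < f" "s' < f" "s \<noteq> s'" "L ! s = L ! s'"
    using assms by (auto simp: distinct_conv_nth)
  let ?M = "mat f f (\<lambda>(r, s). b r (L ! s))"
  have "col ?M s = col ?M s'" using s by (intro eq_vecI) auto
  thus ?thesis unfolding minor_def using s
    by (intro det_identical_columns[of ?M f s s']) auto
qed

lemma minor_pluecker:
  assumes "length L = f" "set L \<subseteq> {..<a}" "distinct L"
  shows "\<exists>\<epsilon>. \<forall>b. minor f b L = \<epsilon> * pluecker f b (set L)"
proof -
  let ?S = "sorted_list_of_set (set L)"
  have "mset L = mset ?S" using assms(3) by (simp add: set_eq_iff_mset_eq_distinct[symmetric])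
  then obtain p where p: "p permutes {..<length ?S}" "permute_list p ?S = L"
    using mset_eq_permutation by blast
  have len: "length ?S = f" using assms by (simp add: distinct_card)
  have pp: "p permutes {0..<f}" using p(1) len by (simp add: atLeast0LessThan)
  have nth: "L ! s = ?S ! p s" if "s < f" for s
    using permute_list_nth[OF p(1), of s] p(2) len that by simp
  show ?thesis
  proof (intro exI[of _ "signof p"] allI)
    fix b
    let ?A = "mat f f (\<lambda>(s, r). b r (?S ! s)) :: complex mat"
    have pf: "p s < f" if "s < f" for s using permutes_in_image[OF pp, of s] that by simp
    have "minor f b L = det (transpose_mat (mat f f (\<lambda>(r, s). b r (L ! s))))"
      unfolding minor_def by (intro det_transpose[symmetric]) auto
    also have "transpose_mat (mat f f (\<lambda>(r, s). b r (L ! s))) = mat f f (\<lambda>(s, r). ?A $$ (p s, r))"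
      by (rule eq_matI) (auto simp: nth pf)
    also have "det \<dots> = signof p * det ?A" by (intro det_permute_rows pp) auto
    also have "det ?A = det (transpose_mat ?A)" by (intro det_transpose[symmetric]) auto
    also have "transpose_mat ?A = mat f f (\<lambda>(r, s). b r (?S ! s))" by (rule eq_matI) auto
    finally show "minor f b L = signof p * pluecker f b (set L)" by (simp add: pluecker_def)
  qed
qed

text \<open>Pluecker coordinates are indexed by sets of columns, while Cramer's rule produces lists of
  columns in any order and with repetitions. A permutation of the columns costs a sign and a
  repetition gives zero. Neither depends on the frame, so minors are polynomials in the Pluecker
  coordinates.\<close>

lemma minor_pluecker_choice:
  assumes "I0 \<subseteq> {..<a}" "card I0 = f"
  shows "\<exists>\<epsilon> J. \<forall>L. length L = f \<longrightarrow> set L \<subseteq> {..<a} \<longrightarrow>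
           J L \<subseteq> {..<a} \<and> card (J L) = f \<and> (\<forall>b. minor f b L = \<epsilon> L * pluecker f b (J L))"
proof -
  have "\<exists>\<epsilon> J. length L = f \<longrightarrow> set L \<subseteq> {..<a} \<longrightarrow>
           J \<subseteq> {..<a} \<and> card J = f \<and> (\<forall>b. minor f b L = \<epsilon> * pluecker f b J)" for L
  proof (cases "length L = f \<and> set L \<subseteq> {..<a} \<and> distinct L")
    case True
    then obtain \<epsilon> where "\<forall>b. minor f b L = \<epsilon> * pluecker f b (set L)"
      using minor_pluecker by blast
    moreover have "card (set L) = f" using True by (simp add: distinct_card)
    ultimately show ?thesis using True by blast
  next
    case False
    hence "\<forall>b. length L = f \<longrightarrow> set L \<subseteq> {..<a} \<longrightarrow> minor f b L = 0 * pluecker f b I0"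
      using minor_not_distinct by auto
    thus ?thesis using assms by (intro exI[of _ 0] exI[of _ I0]) simp
  qed
  thus ?thesis by metis
qed

lemma minor_nonzero_iff:
  "minor f b L \<noteq> 0 \<longleftrightarrow> (\<forall>\<mu>. (\<forall>s<f. (\<Sum>r<f. \<mu> r * b r (L ! s)) = 0) \<longrightarrow> (\<forall>r<f. \<mu> r = 0))"
proof -
  let ?M = "mat f f (\<lambda>(s, r). b r (L ! s))"
  have M: "?M \<in> carrier_mat f f" by simp
  have "minor f b L = det (transpose_mat ?M)"
    unfolding minor_def by (rule arg_cong[of _ _ det], rule eq_matI) auto
  also have "\<dots> = det ?M" by (rule det_transpose[OF M])
  finally have *: "minor f b L = 0 \<longleftrightarrow> (\<exists>v. v \<in> carrier_vec f \<and> v \<noteq> 0\<^sub>v f \<and> ?M *\<^sub>v v = 0\<^sub>v f)"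
    using det_0_iff_vec_prod_zero[OF M] by simp
  have mv: "(?M *\<^sub>v v) $ s = (\<Sum>r<f. v $ r * b r (L ! s))" if "v \<in> carrier_vec f" "s < f" for v s
    using that by (auto simp: scalar_prod_def atLeast0LessThan mult.commute intro!: sum.cong)
  show ?thesis
  proof
    assume "minor f b L \<noteq> 0"
    hence no: "\<not> (\<exists>v. v \<in> carrier_vec f \<and> v \<noteq> 0\<^sub>v f \<and> ?M *\<^sub>v v = 0\<^sub>v f)" using * by simp
    show "\<forall>\<mu>. (\<forall>s<f. (\<Sum>r<f. \<mu> r * b r (L ! s)) = 0) \<longrightarrow> (\<forall>r<f. \<mu> r = 0)"
    proof (intro allI impI)
      fix \<mu> r assume z: "\<forall>s<f. (\<Sum>r<f. \<mu> r * b r (L ! s)) = 0" and r: "r < f"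
      have "?M *\<^sub>v vec f \<mu> = 0\<^sub>v f"
        using z mv[of "vec f \<mu>"] by (intro eq_vecI) auto
      hence "vec f \<mu> = 0\<^sub>v f" using no vec_carrier[of f \<mu>] by blast
      thus "\<mu> r = 0" using r by (metis index_vec index_zero_vec(1))
    qed
  next
    assume A: "\<forall>\<mu>. (\<forall>s<f. (\<Sum>r<f. \<mu> r * b r (L ! s)) = 0) \<longrightarrow> (\<forall>r<f. \<mu> r = 0)"
    show "minor f b L \<noteq> 0"
    proof
      assume "minor f b L = 0"
      then obtain v where v: "v \<in> carrier_vec f" "v \<noteq> 0\<^sub>v f" "?M *\<^sub>v v = 0\<^sub>v f" using * by blast
      have "\<forall>s<f. (\<Sum>r<f. v $ r * b r (L ! s)) = 0" using mv[OF v(1)] v(3) by simp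
      hence "\<forall>r<f. v $ r = 0" using A by blast
      hence "v = 0\<^sub>v f" using v(1) by (intro eq_vecI) auto
      thus False using v(2) by simp
    qed
  qed
qed

text \<open>Laplace expansion along the replaced column, whose cofactors do not see the new entries.\<close>

lemma minor_update:
  assumes "length L = f" "s < f"
  shows "minor f b (L[s := c]) = (\<Sum>r<f. adj_mat (mat f f (\<lambda>(r, s). b r (L ! s))) $$ (s, r) * b r c)"
proof -
  let ?M = "mat f f (\<lambda>(r, s). b r (L ! s))" and ?N = "mat f f (\<lambda>(r, t). b r (L[s := c] ! t))"
  have "minor f b (L[s := c]) = (\<Sum>r<f. ?N $$ (r, s) * cofactor ?N r s)"
    unfolding minor_def using assms by (intro laplace_expansion_column) auto
  also have "\<dots> = (\<Sum>r<f. b r c * cofactor ?M r s)"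
  proof (rule sum.cong[OF refl])
    fix r assume r: "r \<in> {..<f}"
    have "mat_delete ?N r s = mat_delete ?M r s"
      using assms r by (intro eq_matI) (auto simp: mat_delete_def nth_list_update)
    thus "?N $$ (r, s) * cofactor ?N r s = b r c * cofactor ?M r s"
      using assms r by (simp add: cofactor_def)
  qed
  also have "\<dots> = (\<Sum>r<f. adj_mat ?M $$ (s, r) * b r c)"
    using assms by (intro sum.cong) (auto simp: adj_mat_def)
  finally show ?thesis .
qed

text \<open>This is $M \cdot \mathrm{adj}(M) = \det(M)$, applied to an arbitrary column of the frame. It holds at
  vanishing minors too, so it is an identity between polynomials.\<close>

lemma minor_cramer:
  assumes "length L = f" "r < f"
  shows "minor f b L * b r c = (\<Sum>s<f. b r (L ! s) * minor f b (L[s := c]))"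
proof -
  let ?M = "mat f f (\<lambda>(r, s). b r (L ! s))"
  have M: "?M \<in> carrier_mat f f" by simp
  note adj = adj_mat[OF M]
  have "(\<Sum>s<f. b r (L ! s) * minor f b (L[s := c])) =
      (\<Sum>s<f. \<Sum>r'<f. ?M $$ (r, s) * adj_mat ?M $$ (s, r') * b r' c)"
    using assms by (intro sum.cong) (auto simp: minor_update sum_distrib_left mult.assoc)
  also have "\<dots> = (\<Sum>r'<f. \<Sum>s<f. ?M $$ (r, s) * adj_mat ?M $$ (s, r') * b r' c)"
    by (rule sum.swap)
  also have "\<dots> = (\<Sum>r'<f. (?M * adj_mat ?M) $$ (r, r') * b r' c)"
  proof (rule sum.cong[OF refl])
    fix r' assume r': "r' \<in> {..<f}"
    have "(?M * adj_mat ?M) $$ (r, r') = (\<Sum>s<f. ?M $$ (r, s) * adj_mat ?M $$ (s, r'))"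
      using assms r' adj(1) by (auto simp: scalar_prod_def atLeast0LessThan)
    thus "(\<Sum>s<f. ?M $$ (r, s) * adj_mat ?M $$ (s, r') * b r' c) = (?M * adj_mat ?M) $$ (r, r') * b r' c"
      by (simp add: sum_distrib_right)
  qed
  also have "\<dots> = (\<Sum>r'<f. if r' = r then minor f b L * b r c else 0)"
    using assms by (intro sum.cong) (auto simp: adj(2) minor_def)
  finally show ?thesis using assms by simp
qed

text \<open>A family of linearly independent rows has a nonzero maximal minor. To extend a nonzero minor
  by one row, the new row is reduced to zero in the chosen columns with the old rows; what remains
  is nonzero in some column.\<close>

lemma independent_minor_exists:
  assumes "\<And>\<mu>. (\<And>c. c < a \<Longrightarrow> (\<Sum>r<f. \<mu> r * b r c) = 0) \<Longrightarrow> \<forall>r<f. \<mu> r = 0"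
  shows "\<exists>L. length L = f \<and> set L \<subseteq> {..<a} \<and> minor f b L \<noteq> 0"
  using assms
proof (induction f)
  case 0
  have "minor 0 b [] \<noteq> 0" by (simp add: minor_nonzero_iff)
  thus ?case by (intro exI[of _ "[]"]) simp
next
  case (Suc f)
  have "\<exists>L. length L = f \<and> set L \<subseteq> {..<a} \<and> minor f b L \<noteq> 0"
  proof (rule Suc.IH)
    fix \<mu> assume z: "\<And>c. c < a \<Longrightarrow> (\<Sum>r<f. \<mu> r * b r c) = 0"
    have "\<forall>r<Suc f. (\<lambda>r. if r < f then \<mu> r else 0) r = 0"
      by (rule Suc.prems) (use z in simp)
    thus "\<forall>r<f. \<mu> r = 0" by (metis less_Suc_eq)
  qed
  then obtain L where L: "length L = f" "set L \<subseteq> {..<a}" "minor f b L \<noteq> 0" by blast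
  let ?M = "mat f f (\<lambda>(r, s). b r (L ! s))"
  have M: "?M \<in> carrier_mat f f" by simp
  note adj = adj_mat[OF M]
  define q where "q = minor f b L"
  define coef where "coef r = (\<Sum>t<f. b f (L ! t) * adj_mat ?M $$ (t, r)) / q" for r
  have sol: "(\<Sum>r<f. coef r * b r (L ! s)) = b f (L ! s)" if s: "s < f" for s
  proof -
    have "(\<Sum>r<f. coef r * b r (L ! s)) = (\<Sum>r<f. \<Sum>t<f. b f (L ! t) * (adj_mat ?M $$ (t, r) * ?M $$ (r, s))) / q"
      using s by (simp add: coef_def sum_distrib_right sum_divide_distrib mult.assoc)
    also have "(\<Sum>r<f. \<Sum>t<f. b f (L ! t) * (adj_mat ?M $$ (t, r) * ?M $$ (r, s))) =
        (\<Sum>t<f. \<Sum>r<f. b f (L ! t) * (adj_mat ?M $$ (t, r) * ?M $$ (r, s)))" by (rule sum.swap)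
    also have "\<dots> = (\<Sum>t<f. b f (L ! t) * (adj_mat ?M * ?M) $$ (t, s))"
    proof (rule sum.cong[OF refl])
      fix t assume "t \<in> {..<f}"
      hence "(adj_mat ?M * ?M) $$ (t, s) = (\<Sum>r<f. adj_mat ?M $$ (t, r) * ?M $$ (r, s))"
        using s adj(1) by (auto simp: scalar_prod_def atLeast0LessThan)
      thus "(\<Sum>r<f. b f (L ! t) * (adj_mat ?M $$ (t, r) * ?M $$ (r, s))) = b f (L ! t) * (adj_mat ?M * ?M) $$ (t, s)"
        by (simp add: sum_distrib_left)
    qed
    also have "\<dots> = (\<Sum>t<f. if t = s then b f (L ! s) * q else 0)"
      using s by (intro sum.cong) (auto simp: adj(3) q_def minor_def)
    finally show ?thesis using s L(3) by (simp add: q_def)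
  qed
  define rest where "rest c = b f c - (\<Sum>r<f. coef r * b r c)" for c
  have "\<exists>c<a. rest c \<noteq> 0"
  proof (rule ccontr)
    assume "\<not> ?thesis"
    hence "(\<Sum>r<Suc f. (if r = f then -1 else coef r) * b r c) = 0" if "c < a" for c
      using that by (simp add: rest_def)
    from Suc.prems[OF this] show False by auto
  qed
  then obtain c where c: "c < a" "rest c \<noteq> 0" by blast
  have "minor (Suc f) b (L @ [c]) \<noteq> 0"
    unfolding minor_nonzero_iff
  proof (intro allI impI)
    fix \<mu> r assume z: "\<forall>s<Suc f. (\<Sum>r<Suc f. \<mu> r * b r ((L @ [c]) ! s)) = 0" and r: "r < Suc f"
    have zs: "(\<Sum>r<f. \<mu> r * b r (L ! s)) + \<mu> f * b f (L ! s) = 0" if "s < f" for s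
      using z[rule_format, of s] that L(1) by (simp add: nth_append)
    have zc: "(\<Sum>r<f. \<mu> r * b r c) + \<mu> f * b f c = 0"
      using z[rule_format, of f] L(1) by (simp add: nth_append)
    have "\<forall>s<f. (\<Sum>r<f. (\<mu> r + \<mu> f * coef r) * b r (L ! s)) = 0"
    proof (intro allI impI)
      fix s assume s: "s < f"
      have "(\<Sum>r<f. (\<mu> r + \<mu> f * coef r) * b r (L ! s)) =
          (\<Sum>r<f. \<mu> r * b r (L ! s)) + \<mu> f * (\<Sum>r<f. coef r * b r (L ! s))"
        by (simp add: algebra_simps sum.distrib sum_distrib_left)
      thus "(\<Sum>r<f. (\<mu> r + \<mu> f * coef r) * b r (L ! s)) = 0" using sol[OF s] zs[OF s] by simp
    qed
    hence eq: "\<forall>r<f. \<mu> r + \<mu> f * coef r = 0"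
      using L(3)[unfolded minor_nonzero_iff, THEN spec[of _ "\<lambda>r. \<mu> r + \<mu> f * coef r"]] by blast
    hence \<mu>: "\<mu> r = - \<mu> f * coef r" if "r < f" for r using that by (simp add: eq_neg_iff_add_eq_0)
    have "(\<Sum>r<f. \<mu> r * b r c) = - \<mu> f * (\<Sum>r<f. coef r * b r c)"
      using \<mu> by (simp add: sum_distrib_left mult.assoc sum_negf)
    hence "\<mu> f * rest c = 0" using zc by (simp add: rest_def algebra_simps)
    hence "\<mu> f = 0" using c by simp
    thus "\<mu> r = 0" using \<mu> r by (cases "r = f") auto
  qed
  thus ?case using L c by (intro exI[of _ "L @ [c]"]) auto
qed

lemma frame_pluecker_nonzero:
  assumes "frame f W b" "W \<subseteq> cspace a"
  shows "\<exists>I. I \<subseteq> {..<a} \<and> card I = f \<and> pluecker f b I \<noteq> 0"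
proof -
  have "\<exists>L. length L = f \<and> set L \<subseteq> {..<a} \<and> minor f b L \<noteq> 0"
  proof (rule independent_minor_exists)
    fix \<mu> assume z: "\<And>c. c < a \<Longrightarrow> (\<Sum>r<f. \<mu> r * b r c) = 0"
    have "(\<Sum>r<f. fscale (\<mu> r) (b r)) = 0"
    proof
      fix c
      have "b r c = 0" if "r < f" "\<not> c < a" for r
        using frame_in[OF assms(1) that(1)] assms(2) that(2) by (auto simp: cspace_def)
      thus "(\<Sum>r<f. fscale (\<mu> r) (b r)) c = 0 c" using z[of c] by (cases "c < a") auto
    qed
    thus "\<forall>r<f. \<mu> r = 0" using frame_independent[OF assms(1)] by blast
  qed
  then obtain L where L: "length L = f" "set L \<subseteq> {..<a}" "minor f b L \<noteq> 0" by blast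
  have dist: "distinct L" using L minor_not_distinct by blast
  then obtain \<epsilon> where "minor f b L = \<epsilon> * pluecker f b (set L)" using minor_pluecker L by blast
  hence "pluecker f b (set L) \<noteq> 0" using L(3) by auto
  thus ?thesis using L dist by (intro exI[of _ "set L"]) (simp add: distinct_card)
qed

text \<open>At a nonzero minor these vectors span the subspace, by \<open>cramer_expansion\<close> below. Their entries
  are minors, whereas those of the frame itself are not functions of the Pluecker coordinates.\<close>

definition cramer_vector :: "nat \<Rightarrow> (nat \<Rightarrow> nat \<Rightarrow> complex) \<Rightarrow> nat \<Rightarrow> nat list \<Rightarrow> nat \<Rightarrow> nat \<Rightarrow> complex" where
  "cramer_vector f b a L s = (\<lambda>c. if c < a then minor f b (L[s := c]) else 0)"

lemma cramer_vector_in: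
  assumes b: "frame f W b" and W: "W \<subseteq> cspace a" and L: "length L = f" "s < f"
  shows "cramer_vector f b a L s \<in> W"
proof -
  let ?A = "adj_mat (mat f f (\<lambda>(r, s). b r (L ! s)))"
  have z: "b r c = 0" if "r < f" "\<not> c < a" for r c
    using frame_in[OF b that(1)] W that(2) by (auto simp: cspace_def)
  have "cramer_vector f b a L s = (\<Sum>r<f. fscale (?A $$ (s, r)) (b r))"
    by (auto simp: fun_eq_iff cramer_vector_def minor_update[OF L] z)
  also have "\<dots> \<in> W"
    using frame_in[OF b] by (intro fn.subspace_sum[OF frame_subspace[OF b]] fn.subspace_scale[OF frame_subspace[OF b]]) auto
  finally show ?thesis .
qed

lemma cramer_expansion:
  assumes b: "frame f W b" and L: "length L = f" and w: "w \<in> W"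
  shows "minor f b L * w c = (\<Sum>s<f. w (L ! s) * minor f b (L[s := c]))"
proof -
  obtain \<mu> where \<mu>: "w = (\<Sum>r<f. fscale (\<mu> r) (b r))" using frame_spanning[OF b w] by (rule bexE)
  have "minor f b L * w c = (\<Sum>r<f. \<mu> r * (minor f b L * b r c))"
    by (simp add: \<mu> sum_distrib_left ac_simps)
  also have "\<dots> = (\<Sum>r<f. \<Sum>s<f. \<mu> r * b r (L ! s) * minor f b (L[s := c]))"
    by (intro sum.cong) (simp_all add: minor_cramer[OF L] sum_distrib_left mult.assoc)
  also have "\<dots> = (\<Sum>s<f. \<Sum>r<f. \<mu> r * b r (L ! s) * minor f b (L[s := c]))" by (rule sum.swap)
  also have "\<dots> = (\<Sum>s<f. w (L ! s) * minor f b (L[s := c]))"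
    by (simp add: \<mu> sum_distrib_right)
  finally show ?thesis .
qed

text \<open>Conversely, at a nonzero minor this expansion exhibits \<open>w\<close> as an element of the subspace.\<close>

lemma cramer_membership:
  assumes b: "frame f W b" and W: "W \<subseteq> cspace a" and L: "length L = f" "minor f b L \<noteq> 0"
    and w: "w \<in> cspace a"
    and eq: "\<And>c. c < a \<Longrightarrow> minor f b L * w c = (\<Sum>s<f. w (L ! s) * minor f b (L[s := c]))"
  shows "w \<in> W"
proof -
  note sub = frame_subspace[OF b]
  have "w = fscale (1 / minor f b L) (\<Sum>s<f. fscale (w (L ! s)) (cramer_vector f b a L s))"
  proof
    fix c
    show "w c = fscale (1 / minor f b L) (\<Sum>s<f. fscale (w (L ! s)) (cramer_vector f b a L s)) c"
      using eq[of c, symmetric] w L(2) by (cases "c < a") (auto simp: cramer_vector_def cspace_def field_simps)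
  qed
  also have "\<dots> \<in> W"
    using cramer_vector_in[OF b W L(1)] by (intro fn.subspace_scale[OF sub] fn.subspace_sum[OF sub]) auto
  finally show ?thesis .
qed

definition matrix_apply :: "nat \<Rightarrow> nat \<Rightarrow> (nat \<Rightarrow> nat \<Rightarrow> complex) \<Rightarrow> (nat \<Rightarrow> complex) \<Rightarrow> nat \<Rightarrow> complex" where
  "matrix_apply a a' \<tau> w = (\<lambda>c'. if c' < a' then \<Sum>c<a. \<tau> c' c * w c else 0)"

lemma matrix_apply_in: "matrix_apply a a' \<tau> w \<in> cspace a'"
  by (simp add: matrix_apply_def cspace_def)

text \<open>For a matrix \<open>\<tau>\<close> the condition that \<open>\<tau>\<close> maps one subspace into another is tested on the Cramer
  vectors of the first subspace, with the Cramer expansion of the second one. Both consist of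
  Pluecker coordinates, so the test is bilinear in the two groups of variables.\<close>

lemma zariski_closed_incidence:
  assumes Q: "finite Q" "q1 \<in> Q" "q2 \<in> Q"
  shows "zariski_closed Q f a {X \<in> (\<Pi>\<^sub>E q\<in>Q. Grass (f q) (a q)).
           \<forall>w\<in>X q1. matrix_apply (a q1) (a q2) \<tau> w \<in> X q2}"
proof -
  let ?Gr = "\<Pi>\<^sub>E q\<in>Q. Grass (f q) (a q)"
  let ?T = "matrix_apply (a q1) (a q2) \<tau>"
  let ?sets = "\<lambda>q. {I. I \<subseteq> {..<a q} \<and> card I = f q}"
  have frames: "\<exists>b. \<forall>q\<in>Q. is_frame (f q) (X q) (b q)" if X: "X \<in> ?Gr" for X
  proof -
    have "\<exists>b. is_frame (f q) (X q) b" if "q \<in> Q" for q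
    proof -
      have W: "fn.subspace (X q)" "X q \<subseteq> coord_space {..<a q}" "fn.dim (X q) = f q"
        using PiE_mem[OF X that] by (auto simp: Grass_def cspace_eq_coord_space)
      thus ?thesis using frame_exists[OF _ W(2,1)] by (simp add: is_frame_eq_frame)
    qed
    thus ?thesis by metis
  qed
  show ?thesis
  proof (cases "\<exists>X. X \<in> ?Gr")
    case False
    thus ?thesis unfolding zariski_closed_def by (intro conjI exI[of _ "{}"]) auto
  next
    case True
    \<comment> \<open>an element of the product shows that every factor has a Pluecker coordinate, which is then
       available to represent the minors that vanish identically\<close>
    then obtain X0 where X0: "X0 \<in> ?Gr" ..
    then obtain b0 where b0: "\<And>q. q \<in> Q \<Longrightarrow> is_frame (f q) (X0 q) (b0 q)" using frames by blast
    have "\<exists>\<epsilon> J. q \<in> Q \<longrightarrow> (\<forall>L. length L = f q \<longrightarrow> set L \<subseteq> {..<a q} \<longrightarrow>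
        J L \<subseteq> {..<a q} \<and> card (J L) = f q \<and> (\<forall>b. minor (f q) b L = \<epsilon> L * pluecker (f q) b (J L)))" for q
    proof (cases "q \<in> Q")
      case True
      have "X0 q \<subseteq> cspace (a q)" using PiE_mem[OF X0 True] by (auto simp: Grass_def)
      then obtain I0 where "I0 \<subseteq> {..<a q}" "card I0 = f q"
        using frame_pluecker_nonzero b0[OF True] by (metis is_frame_eq_frame)
      from minor_pluecker_choice[OF this] show ?thesis by (simp add: True)
    qed simp
    hence "\<exists>\<epsilon> J. \<forall>q\<in>Q. \<forall>L. length L = f q \<longrightarrow> set L \<subseteq> {..<a q} \<longrightarrow>
        J q L \<subseteq> {..<a q} \<and> card (J q L) = f q \<and> (\<forall>b. minor (f q) b L = \<epsilon> q L * pluecker (f q) b (J q L))"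
      by metis
    then obtain \<epsilon> J where H: "\<forall>q\<in>Q. \<forall>L. length L = f q \<longrightarrow> set L \<subseteq> {..<a q} \<longrightarrow>
        J q L \<subseteq> {..<a q} \<and> card (J q L) = f q \<and> (\<forall>b. minor (f q) b L = \<epsilon> q L * pluecker (f q) b (J q L))"
      by (elim exE)
    have J: "J q L \<in> ?sets q" and \<epsilon>: "minor (f q) b L = \<epsilon> q L * pluecker (f q) b (J q L)"
      if "q \<in> Q" "length L = f q" "set L \<subseteq> {..<a q}" for q L b
      using H that by simp_all
    \<comment> \<open>the minor at \<open>L\<close> as a polynomial in the Pluecker coordinates\<close>
    define m where "m q L x = \<epsilon> q L * x (q, J q L)" for q L and x :: "'a \<times> nat set \<Rightarrow> complex"
    \<comment> \<open>the defect in coordinate \<open>c'\<close> of the expansion at \<open>L2\<close> of the image of the Cramer vector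
       of \<open>L1\<close> and \<open>s1\<close>\<close>
    define p where "p L1 s1 L2 c' x =
       m q2 L2 x * (\<Sum>c<a q1. \<tau> c' c * m q1 (L1[s1 := c]) x)
       - (\<Sum>s<f q2. (\<Sum>c<a q1. \<tau> (L2 ! s) c * m q1 (L1[s1 := c]) x) * m q2 (L2[s := c']) x)"
      for L1 s1 L2 c' and x :: "'a \<times> nat set \<Rightarrow> complex"
    define ok where "ok L1 s1 L2 c' \<longleftrightarrow> length L1 = f q1 \<and> set L1 \<subseteq> {..<a q1} \<and> s1 < f q1 \<and>
       length L2 = f q2 \<and> set L2 \<subseteq> {..<a q2} \<and> c' < a q2" for L1 s1 L2 c'
    define F where "F = {p L1 s1 L2 c' | L1 s1 L2 c'. ok L1 s1 L2 c'}"
    have upd: "set (L[s := c]) \<subseteq> {..<N}" if "set L \<subseteq> {..<N}" "c < N" for L s and c N :: nat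
      using that set_update_subset_insert[of L s c] by auto
    have nthL: "L ! s < N" if "set L \<subseteq> {..<N}" "s < length L" for L s and N :: nat
      using that nth_mem by blast
    have mh: "multihomogeneous Q f a (p L1 s1 L2 c')" if o: "ok L1 s1 L2 c'" for L1 s1 L2 c'
    proof -
      let ?V = "SIGMA q:Q. ?sets q"
      note o' = o[unfolded ok_def]
      have mpoly: "(\<lambda>x. m q L x) \<in> polyfun ?V" if "q \<in> Q" "length L = f q" "set L \<subseteq> {..<a q}" for q L
      proof -
        have "(q, J q L) \<in> ?V" using J[OF that] that(1) by blast
        thus ?thesis unfolding m_def by (intro polyfun_cmult polyfun.var)
      qed
      have m1: "(\<lambda>x. m q1 (L1[s1 := c]) x) \<in> polyfun ?V" if "c < a q1" for c
        using o' that upd by (intro mpoly Q) auto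
      have m2: "(\<lambda>x. m q2 (L2[s := c']) x) \<in> polyfun ?V" for s
        using o' upd by (intro mpoly Q) auto
      have m2': "(\<lambda>x. m q2 L2 x) \<in> polyfun ?V" using o' by (intro mpoly Q) auto
      have "(\<lambda>x. m q2 L2 x * (\<Sum>c<a q1. \<tau> c' c * m q1 (L1[s1 := c]) x)
          + (- 1) * (\<Sum>s<f q2. (\<Sum>c<a q1. \<tau> (L2 ! s) c * m q1 (L1[s1 := c]) x) * m q2 (L2[s := c']) x)) \<in> polyfun ?V"
        by (intro polyfun.add polyfun_cmult polyfun.mult polyfun_sum m1 m2 m2') auto
      hence poly: "p L1 s1 L2 c' \<in> polyfun ?V" by (simp add: p_def[abs_def])
      \<comment> \<open>for \<open>q1 = q2\<close> the two groups of variables coincide and the degree is two\<close>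
      define deg where "deg q = (if q = q1 then 1 else 0) + (if q = q2 then 1 else (0::nat))" for q
      have scale: "p L1 s1 L2 c' (\<lambda>(q, I). e q * x (q, I)) = (\<Prod>q\<in>Q. e q ^ deg q) * p L1 s1 L2 c' x" for e x
      proof -
        have ms: "m q L (\<lambda>(q, I). e q * x (q, I)) = e q * m q L x" for q L by (simp add: m_def)
        have "e q ^ deg q = (if q = q1 then e q else 1) * (if q = q2 then e q else 1)" for q
          by (simp add: deg_def)
        hence "(\<Prod>q\<in>Q. e q ^ deg q) = e q1 * e q2" using Q by (simp add: prod.distrib)
        thus ?thesis unfolding p_def ms by (simp add: algebra_simps sum_distrib_left)
      qed
      show ?thesis unfolding multihomogeneous_def
        by (intro conjI poly exI[of _ deg] allI scale)
    qed
    have val: "p L1 s1 L2 c' (\<lambda>(q, I). pluecker (f q) (b q) I) =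
        minor (f q2) (b q2) L2 * ?T (cramer_vector (f q1) (b q1) (a q1) L1 s1) c' -
        (\<Sum>s<f q2. ?T (cramer_vector (f q1) (b q1) (a q1) L1 s1) (L2 ! s) * minor (f q2) (b q2) (L2[s := c']))"
      if o: "ok L1 s1 L2 c'" for L1 s1 L2 c' b
    proof -
      note o' = o[unfolded ok_def]
      let ?x = "\<lambda>(q, I). pluecker (f q) (b q) I"
      have mv: "m q L ?x = minor (f q) (b q) L" if "q \<in> Q" "length L = f q" "set L \<subseteq> {..<a q}" for q L
        using \<epsilon>[OF that] by (simp add: m_def)
      have m1: "m q1 (L1[s1 := c]) ?x = cramer_vector (f q1) (b q1) (a q1) L1 s1 c" if "c < a q1" for c
        using that o' mv[OF Q(2), of "L1[s1 := c]"] upd by (simp add: cramer_vector_def)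
      have T: "(\<Sum>c<a q1. \<tau> d c * m q1 (L1[s1 := c]) ?x) = ?T (cramer_vector (f q1) (b q1) (a q1) L1 s1) d"
        if "d < a q2" for d using that by (simp add: matrix_apply_def m1)
      have m2: "m q2 (L2[s := c']) ?x = minor (f q2) (b q2) (L2[s := c'])" for s
        using o' upd by (intro mv Q) auto
      have m2': "m q2 L2 ?x = minor (f q2) (b q2) L2" using o' by (intro mv Q) auto
      show ?thesis unfolding p_def m2 m2' using o' nthL by (simp add: T)
    qed
    have main: "(\<forall>w\<in>X q1. ?T w \<in> X q2) \<longleftrightarrow>
         (\<forall>p\<in>F. \<forall>b. (\<forall>q\<in>Q. is_frame (f q) (X q) (b q)) \<longrightarrow> p (\<lambda>(q, I). pluecker (f q) (b q) I) = 0)"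
      if X: "X \<in> ?Gr" for X
    proof
      have Xs: "X q \<subseteq> cspace (a q)" if "q \<in> Q" for q using PiE_mem[OF X that] by (simp add: Grass_def)
      {
        assume inc: "\<forall>w\<in>X q1. ?T w \<in> X q2"
        show "\<forall>p\<in>F. \<forall>b. (\<forall>q\<in>Q. is_frame (f q) (X q) (b q)) \<longrightarrow> p (\<lambda>(q, I). pluecker (f q) (b q) I) = 0"
        proof (intro ballI allI impI)
          fix r b assume "r \<in> F" and b: "\<forall>q\<in>Q. is_frame (f q) (X q) (b q)"
          then obtain L1 s1 L2 c' where r: "r = p L1 s1 L2 c'" and o: "ok L1 s1 L2 c'"
            unfolding F_def by blast
          have fr: "frame (f q) (X q) (b q)" if "q \<in> Q" for q using b that by (simp add: is_frame_eq_frame)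
          have "cramer_vector (f q1) (b q1) (a q1) L1 s1 \<in> X q1"
            using o by (intro cramer_vector_in[OF fr[OF Q(2)] Xs[OF Q(2)]]) (auto simp: ok_def)
          hence "?T (cramer_vector (f q1) (b q1) (a q1) L1 s1) \<in> X q2" using inc by blast
          from cramer_expansion[OF fr[OF Q(3)] _ this, of L2 c'] o
          show "r (\<lambda>(q, I). pluecker (f q) (b q) I) = 0" by (simp add: r val[OF o] ok_def)
        qed
      next
        assume van: "\<forall>p\<in>F. \<forall>b. (\<forall>q\<in>Q. is_frame (f q) (X q) (b q)) \<longrightarrow> p (\<lambda>(q, I). pluecker (f q) (b q) I) = 0"
        obtain b where b: "\<forall>q\<in>Q. is_frame (f q) (X q) (b q)" using frames[OF X] by blast
        have fr: "frame (f q) (X q) (b q)" if "q \<in> Q" for q using b that by (simp add: is_frame_eq_frame)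
        have "\<exists>L. length L = f q \<and> set L \<subseteq> {..<a q} \<and> minor (f q) (b q) L \<noteq> 0" if q: "q \<in> Q" for q
        proof -
          obtain I where I: "I \<subseteq> {..<a q}" "card I = f q" "pluecker (f q) (b q) I \<noteq> 0"
            using frame_pluecker_nonzero[OF fr[OF q] Xs[OF q]] by blast
          have "finite I" using I(1) finite_subset by blast
          thus ?thesis using I by (intro exI[of _ "sorted_list_of_set I"]) (simp add: pluecker_eq_minor)
        qed
        then obtain L1 L2 where L1: "length L1 = f q1" "set L1 \<subseteq> {..<a q1}" "minor (f q1) (b q1) L1 \<noteq> 0"
          and L2: "length L2 = f q2" "set L2 \<subseteq> {..<a q2}" "minor (f q2) (b q2) L2 \<noteq> 0"
          using Q(2,3) by metis
        let ?u = "\<lambda>s. cramer_vector (f q1) (b q1) (a q1) L1 s"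
        have Tu: "?T (?u s) \<in> X q2" if s: "s < f q1" for s
        proof (rule cramer_membership[OF fr[OF Q(3)] Xs[OF Q(3)] L2(1,3) matrix_apply_in])
          fix c assume c: "c < a q2"
          have o: "ok L1 s L2 c" using L1 L2 s c by (simp add: ok_def)
          hence "p L1 s L2 c \<in> F" by (auto simp: F_def)
          hence "p L1 s L2 c (\<lambda>(q, I). pluecker (f q) (b q) I) = 0" using van b by blast
          thus "minor (f q2) (b q2) L2 * ?T (?u s) c =
            (\<Sum>t<f q2. ?T (?u s) (L2 ! t) * minor (f q2) (b q2) (L2[t := c]))"
            using val[OF o, of b] by simp
        qed
        show "\<forall>w\<in>X q1. ?T w \<in> X q2"
        proof
          fix w assume w: "w \<in> X q1"
          let ?e = "1 / minor (f q1) (b q1) L1"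
          have wc: "w c = ?e * (\<Sum>s<f q1. w (L1 ! s) * ?u s c)" if "c < a q1" for c
            using cramer_expansion[OF fr[OF Q(2)] L1(1) w, of c] L1(3) that
            by (simp add: cramer_vector_def field_simps)
          have "?T w = fscale ?e (\<Sum>s<f q1. fscale (w (L1 ! s)) (?T (?u s)))"
          proof
            fix c'
            have "(\<Sum>c<a q1. \<tau> c' c * w c) = ?e * (\<Sum>c<a q1. \<Sum>s<f q1. w (L1 ! s) * (\<tau> c' c * ?u s c))"
              unfolding sum_distrib_left
              by (rule sum.cong) (simp_all add: wc sum_distrib_left ac_simps)
            also have "(\<Sum>c<a q1. \<Sum>s<f q1. w (L1 ! s) * (\<tau> c' c * ?u s c)) =
                (\<Sum>s<f q1. \<Sum>c<a q1. w (L1 ! s) * (\<tau> c' c * ?u s c))" by (rule sum.swap)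
            finally show "?T w c' = fscale ?e (\<Sum>s<f q1. fscale (w (L1 ! s)) (?T (?u s))) c'"
              by (simp add: matrix_apply_def sum_distrib_left sum_divide_distrib)
          qed
          also have "\<dots> \<in> X q2"
            using Tu frame_subspace[OF fr[OF Q(3)]] by (intro fn.subspace_scale fn.subspace_sum) auto
          finally show "?T w \<in> X q2" .
        qed
      }
    qed
    show ?thesis unfolding zariski_closed_def
    proof (intro conjI exI[of _ F] ballI)
      show "multihomogeneous Q f a r" if "r \<in> F" for r using that mh by (auto simp: F_def)
    qed (use main in auto)
  qed
qed

lemma zariski_closed_Inter:
  assumes "\<And>i. i \<in> A \<Longrightarrow> zariski_closed Q f a (Z i)"
  shows "zariski_closed Q f a {X \<in> (\<Pi>\<^sub>E q\<in>Q. Grass (f q) (a q)). \<forall>i\<in>A. X \<in> Z i}"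
proof -
  let ?van = "\<lambda>X p. \<forall>b. (\<forall>q\<in>Q. is_frame (f q) (X q) (b q)) \<longrightarrow> p (\<lambda>(q, I). pluecker (f q) (b q) I) = 0"
  have "\<exists>F. i \<in> A \<longrightarrow> (\<forall>p\<in>F. multihomogeneous Q f a p) \<and>
      (\<forall>X \<in> (\<Pi>\<^sub>E q\<in>Q. Grass (f q) (a q)). X \<in> Z i \<longleftrightarrow> (\<forall>p\<in>F. ?van X p))" for i
    using assms[of i] unfolding zariski_closed_def by (cases "i \<in> A") simp_all
  hence "\<forall>i. \<exists>F. i \<in> A \<longrightarrow> (\<forall>p\<in>F. multihomogeneous Q f a p) \<and>
      (\<forall>X \<in> (\<Pi>\<^sub>E q\<in>Q. Grass (f q) (a q)). X \<in> Z i \<longleftrightarrow> (\<forall>p\<in>F. ?van X p))" by (rule allI)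
  from choice[OF this] obtain F where H: "\<forall>i. i \<in> A \<longrightarrow> (\<forall>p\<in>F i. multihomogeneous Q f a p) \<and>
      (\<forall>X \<in> (\<Pi>\<^sub>E q\<in>Q. Grass (f q) (a q)). X \<in> Z i \<longleftrightarrow> (\<forall>p\<in>F i. ?van X p))" by (rule exE)
  have F: "p \<in> F i \<Longrightarrow> multihomogeneous Q f a p"
    "X \<in> (\<Pi>\<^sub>E q\<in>Q. Grass (f q) (a q)) \<Longrightarrow> X \<in> Z i \<longleftrightarrow> (\<forall>p\<in>F i. ?van X p)"
    if i: "i \<in> A" for i p X
    using H[rule_format, OF i] by simp_all
  show ?thesis unfolding zariski_closed_def
  proof (intro conjI exI[of _ "\<Union>i\<in>A. F i"] ballI)
    fix X assume X: "X \<in> (\<Pi>\<^sub>E q\<in>Q. Grass (f q) (a q))"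
    have "(\<forall>i\<in>A. X \<in> Z i) \<longleftrightarrow> (\<forall>p\<in>\<Union>i\<in>A. F i. ?van X p)" using F(2)[OF _ X] by blast
    thus "X \<in> {X \<in> (\<Pi>\<^sub>E q\<in>Q. Grass (f q) (a q)). \<forall>i\<in>A. X \<in> Z i} \<longleftrightarrow> (\<forall>p\<in>\<Union>i\<in>A. F i. ?van X p)"
      using X by blast
  qed (use F(1) in auto)
qed

section \<open>The product of the tensor algebra\<close>

lemma tmul_add_left: "tmul (t + t') u = tmul t u + tmul t' u"
  by (auto simp: tmul_def fun_eq_iff algebra_simps sum.distrib)

lemma tmul_add_right: "tmul t (u + u') = tmul t u + tmul t u'"
  by (auto simp: tmul_def fun_eq_iff algebra_simps sum.distrib)

lemma tmul_scale_left: "tmul (fscale c t) u = fscale c (tmul t u)"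
  by (auto simp: tmul_def fun_eq_iff algebra_simps sum_distrib_left)

lemma tmul_scale_right: "tmul t (fscale c u) = fscale c (tmul t u)"
  by (auto simp: tmul_def fun_eq_iff algebra_simps sum_distrib_left)

lemma tmul_zero_left: "tmul 0 u = 0"
  by (auto simp: tmul_def fun_eq_iff)

lemma tmul_zero_right: "tmul t 0 = 0"
  by (auto simp: tmul_def fun_eq_iff)

lemma tmul_sum_left: "tmul (\<Sum>a\<in>A. f a) u = (\<Sum>a\<in>A. tmul (f a) u)"
  by (induction A rule: infinite_finite_induct)
    (simp_all only: sum.infinite sum.empty sum.insert not_False_eq_True tmul_zero_left tmul_add_left)

lemma tmul_sum_right: "tmul t (\<Sum>a\<in>A. f a) = (\<Sum>a\<in>A. tmul t (f a))"
  by (induction A rule: infinite_finite_induct)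
    (simp_all only: sum.infinite sum.empty sum.insert not_False_eq_True tmul_zero_right tmul_add_right)

text \<open>Only one factorisation of a word has factors of the two given lengths.\<close>

lemma tmul_homogeneous:
  assumes "t \<in> tensor_power n a" "u \<in> tensor_power n b"
  shows "tmul t u w = (if length w = a + b then t (take a w) * u (drop a w) else 0)"
proof -
  have "t (take l w) * u (drop l w) = (if l = a \<and> length w = a + b then t (take a w) * u (drop a w) else 0)"
    if l: "l \<le> length w" for l
  proof (cases "l = a \<and> length w = a + b")
    case False
    have "take l w \<notin> words n a \<or> drop l w \<notin> words n b"
      using False l by (auto simp: words_def)
    hence "t (take l w) = 0 \<or> u (drop l w) = 0" using assms by (auto simp: tensor_power_def)
    thus ?thesis using False by auto
  qed auto
  hence "tmul t u w = (\<Sum>l\<le>length w. if l = a then (if length w = a + b then t (take a w) * u (drop a w) else 0) else 0)"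
    unfolding tmul_def by (intro sum.cong) auto
  thus ?thesis by auto
qed

lemma words_append_iff:
  "length w = a + b \<Longrightarrow> w \<in> words n (a + b) \<longleftrightarrow> take a w \<in> words n a \<and> drop a w \<in> words n b"
proof -
  assume "length w = a + b"
  moreover have "set w = set (take a w) \<union> set (drop a w)" by (metis append_take_drop_id set_append)
  ultimately show ?thesis by (auto simp: words_def)
qed

lemma bij_betw_append_words:
  "bij_betw (\<lambda>(x, y). x @ y) (words n a \<times> words n b) (words n (a + b))"
proof (rule bij_betwI[where g = "\<lambda>w. (take a w, drop a w)"])
  show "(\<lambda>w. (take a w, drop a w)) \<in> words n (a + b) \<rightarrow> words n a \<times> words n b"
  proof
    fix w assume w: "w \<in> words n (a + b)"
    show "(take a w, drop a w) \<in> words n a \<times> words n b"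
      using words_append_iff[OF words_length[OF w]] w by simp
  qed
qed (auto simp: words_def)

lemma tmul_in_tensor_power:
  assumes "t \<in> tensor_power n a" "u \<in> tensor_power n b"
  shows "tmul t u \<in> tensor_power n (a + b)"
proof -
  have "tmul t u w = 0" if "w \<notin> words n (a + b)" for w
  proof (cases "length w = a + b")
    case True
    hence "t (take a w) = 0 \<or> u (drop a w) = 0"
      using words_append_iff[OF True] that assms by (auto simp: tensor_power_def)
    thus ?thesis using True by (auto simp: tmul_homogeneous[OF assms])
  qed (simp add: tmul_homogeneous[OF assms])
  thus ?thesis by (simp add: tensor_power_def)
qed

lemma delta_in_tensor_power: "w \<in> words n j \<Longrightarrow> delta w \<in> tensor_power n j"
  by (simp add: tensor_power_eq_coord_space delta_in_coord_space)

lemma tensor_power_expand: "t \<in> tensor_power n j \<Longrightarrow> (\<Sum>w\<in>words n j. fscale (t w) (delta w)) = t"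
  by (simp add: tensor_power_eq_coord_space coord_space_expand finite_words)

section \<open>The ideal condition as a family of incidence conditions\<close>

definition sandwich :: "nat list \<Rightarrow> nat list \<Rightarrow> (nat list \<Rightarrow> complex) \<Rightarrow> nat list \<Rightarrow> complex" where
  "sandwich x y p = tmul (tmul (delta x) p) (delta y)"

lemma sandwich_linear:
  "sandwich x y (p + p') = sandwich x y p + sandwich x y p'"
  "sandwich x y (fscale c p) = fscale c (sandwich x y p)"
  by (simp_all add: sandwich_def tmul_add_left tmul_add_right tmul_scale_left tmul_scale_right)

lemma sandwich_sum: "sandwich x y (\<Sum>a\<in>A. f a) = (\<Sum>a\<in>A. sandwich x y (f a))"
  by (simp add: sandwich_def tmul_sum_left tmul_sum_right del: sum_function_apply)

lemma sandwich_in: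
  assumes "x \<in> words n l" "y \<in> words n r" "p \<in> tensor_power n i"
  shows "sandwich x y p \<in> tensor_power n (l + i + r)"
  unfolding sandwich_def
  by (intro tmul_in_tensor_power delta_in_tensor_power assms)

lemma tensor_sandwich_subset_iff:
  assumes "fn.subspace P'"
  shows "tensor_sandwich n l P r \<subseteq> P' \<longleftrightarrow> (\<forall>x\<in>words n l. \<forall>y\<in>words n r. \<forall>p\<in>P. sandwich x y p \<in> P')"
proof
  assume *: "tensor_sandwich n l P r \<subseteq> P'"
  show "\<forall>x\<in>words n l. \<forall>y\<in>words n r. \<forall>p\<in>P. sandwich x y p \<in> P'"
  proof (intro ballI)
    fix x y p assume xyp: "x \<in> words n l" "y \<in> words n r" "p \<in> P"
    have "sandwich x y p \<in> tensor_sandwich n l P r"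
      unfolding tensor_sandwich_def sandwich_def
      using delta_in_tensor_power[OF xyp(1)] delta_in_tensor_power[OF xyp(2)] xyp(3)
      by (intro fn.span_base) blast
    thus "sandwich x y p \<in> P'" using * by blast
  qed
next
  assume *: "\<forall>x\<in>words n l. \<forall>y\<in>words n r. \<forall>p\<in>P. sandwich x y p \<in> P'"
  show "tensor_sandwich n l P r \<subseteq> P'"
    unfolding tensor_sandwich_def
  proof (rule fn.span_minimal[OF _ assms], rule subsetI)
    fix v assume "v \<in> {tmul (tmul x p) y |x p y. x \<in> tensor_power n l \<and> p \<in> P \<and> y \<in> tensor_power n r}"
    then obtain x p y where v: "v = tmul (tmul x p) y" "x \<in> tensor_power n l" "p \<in> P" "y \<in> tensor_power n r"
      by blast
    have "v = tmul (tmul (\<Sum>a\<in>words n l. fscale (x a) (delta a)) p) (\<Sum>b\<in>words n r. fscale (y b) (delta b))"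
      using v by (simp only: tensor_power_expand)
    also have "\<dots> = (\<Sum>b\<in>words n r. \<Sum>a\<in>words n l. fscale (y b) (fscale (x a) (sandwich a b p)))"
      by (simp only: tmul_sum_left tmul_sum_right tmul_scale_left tmul_scale_right sandwich_def fn.scale_sum_right)
    also have "\<dots> \<in> P'"
      using * v(3) by (intro fn.subspace_sum[OF assms] fn.subspace_scale[OF assms]) blast
    finally show "v \<in> P'" .
  qed
qed

lemma mult_sub_expand:
  assumes "z \<in> coord_space (simples_index D a)"
  shows "z = (\<Sum>s<nsimple D. \<Sum>t<sdim D s. mult_incl s t (\<lambda>c. z (s, c, t)))"
proof
  fix p :: "nat \<times> nat \<times> nat"
  obtain s c t where p: "p = (s, c, t)" by (cases p)
  have "(\<Sum>t'<sdim D s'. mult_incl s' t' (\<lambda>c. z (s', c, t')) p) =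
      (if s' = s then (if t < sdim D s then z p else 0) else 0)" for s'
  proof -
    have "(\<Sum>t'<sdim D s'. mult_incl s' t' (\<lambda>c. z (s', c, t')) p) =
        (\<Sum>t'<sdim D s'. if t' = t then (if s' = s then z p else 0) else 0)"
      by (rule sum.cong) (auto simp: mult_incl_def p)
    thus ?thesis by auto
  qed
  hence "(\<Sum>s<nsimple D. \<Sum>t<sdim D s. mult_incl s t (\<lambda>c. z (s, c, t))) p =
      (\<Sum>s'<nsimple D. if s' = s then (if t < sdim D s then z p else 0) else 0)" by simp
  also have "\<dots> = z p" using assms by (auto simp: coord_space_def simples_index_def p)
  finally show "z p = (\<Sum>s<nsimple D. \<Sum>t<sdim D s. mult_incl s t (\<lambda>c. z (s, c, t))) p" by simp
qed

lemma mult_incl_in_mult_sub: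
  assumes "s < nsimple D" "t < sdim D s" "w \<in> W s" "\<And>s. s < nsimple D \<Longrightarrow> fn.subspace (W s) \<and> W s \<subseteq> cspace (a s)"
  shows "mult_incl s t w \<in> mult_sub D a W"
proof -
  have "w \<in> cspace (a s)" using assms by blast
  hence "mult_incl s t w \<in> coord_space (simples_index D a)" using assms by (intro mult_incl_in)
  moreover have "(\<lambda>c. mult_incl s t w (s', c, t')) = (if s' = s \<and> t' = t then w else 0)" for s' t'
    by (auto simp: mult_incl_def)
  moreover have "0 \<in> W s'" if "s' < nsimple D" for s' using assms(4)[OF that] fn.subspace_0 by blast
  ultimately show ?thesis using assms by (simp add: mult_sub_def)
qed

text \<open>The effect of multiplication by the words \<open>x\<close> and \<open>y\<close> on multiplicity spaces: the matrix from
  the multiplicity space of the simple representation \<open>s\<close> in degree \<open>i\<close>, placed at the basis vector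
  \<open>t\<close>, to the multiplicity space of \<open>s'\<close> in degree \<open>j\<close>, read off at the basis vector \<open>t'\<close>.\<close>

definition sandwich_matrix ::
  "isotypic \<Rightarrow> isotypic \<Rightarrow> nat list \<Rightarrow> nat list \<Rightarrow> nat \<times> nat \<Rightarrow> nat \<times> nat \<Rightarrow> nat \<Rightarrow> nat \<Rightarrow> complex" where
  "sandwich_matrix D D' x y = (\<lambda>(s, t) (s', t') c' c.
     inv_into (coord_space (simples_index D' (tot_mult D'))) (tiso D')
       (sandwich x y (tiso D (mult_incl s t (delta c)))) (s', c', t'))"

text \<open>The subrepresentation in degree \<open>i\<close> is spanned by elementary tensors, and membership in the one
  in degree \<open>j\<close> is tested slice by slice. Hence the inclusion is a conjunction of inclusions between
  multiplicity spaces.\<close>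

lemma sandwich_incidence:
  fixes n :: nat and \<rho> :: "complex mat \<Rightarrow> complex mat"
  defines "T \<equiv> tensor_rep n \<rho>"
  assumes h: "rep_iso G (sum_of_simples D (tot_mult D)) (T i) (tiso D)"
    and h': "rep_iso G (sum_of_simples D' (tot_mult D')) (T j) (tiso D')"
    and W: "\<And>s. s < nsimple D \<Longrightarrow> fn.subspace (W s) \<and> W s \<subseteq> cspace (tot_mult D s)"
    and W': "\<And>s. s < nsimple D' \<Longrightarrow> fn.subspace (W' s) \<and> W' s \<subseteq> cspace (tot_mult D' s)"
    and j: "j = l + i + r"
  shows "tensor_sandwich n l (isotypic_sub D W) r \<subseteq> isotypic_sub D' W' \<longleftrightarrow>
     (\<forall>x\<in>words n l. \<forall>y\<in>words n r. \<forall>s<nsimple D. \<forall>t<sdim D s. \<forall>s'<nsimple D'. \<forall>t'<sdim D' s'.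
        \<forall>w\<in>W s. matrix_apply (tot_mult D s) (tot_mult D' s') (sandwich_matrix D D' x y (s, t) (s', t')) w \<in> W' s')"
proof -
  let ?a = "tot_mult D" and ?a' = "tot_mult D'"
  let ?X = "coord_space (simples_index D ?a)" and ?X' = "coord_space (simples_index D' ?a')"
  let ?k = "inv_into ?X' (tiso D')"
  have linT: "linear_rep G (T j)" for j unfolding T_def by (rule linear_rep_tensor_rep)
  note linS = linear_rep_sum_of_simples
  have Tsp: "rspace (T j) = tensor_power n j" "rscale (T j) = fscale" for j unfolding T_def by simp_all
  have hom: "rep_hom G (sum_of_simples D ?a) (T i) (tiso D)" using h by (simp add: rep_iso_iff_hom)
  have k: "rep_hom G (T j) (sum_of_simples D' ?a') ?k"
    using linear_rep.rep_iso_inv[OF linS h'] by (simp add: rep_iso_iff_hom)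
  have bij': "bij_betw (tiso D') ?X' (tensor_power n j)"
    using h' by (simp add: rep_iso_iff_hom Tsp)
  have subP': "fn.subspace (isotypic_sub D' W')"
  proof -
    have "subrep G (sum_of_simples D' ?a') (mult_sub D' ?a' W')" using W' by (intro subrep_mult_sub) simp
    hence "subrep G (T j) (isotypic_sub D' W')"
      unfolding isotypic_sub_eq_image using h'
      by (intro subrep_image[OF linear_rep_sum_of_simples[of G D' ?a'] linT]) (simp_all add: rep_iso_iff_hom)
    thus ?thesis by (simp add: subrep_def Tsp)
  qed
  have memP': "v \<in> isotypic_sub D' W' \<longleftrightarrow> (\<forall>s'<nsimple D'. \<forall>t'<sdim D' s'. (\<lambda>c. ?k v (s', c, t')) \<in> W' s')"
    if v: "v \<in> tensor_power n j" for v
  proof -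
    have kv: "?k v \<in> ?X'" "tiso D' (?k v) = v"
      using bij' v by (auto simp: bij_betw_def inv_into_into f_inv_into_f)
    have "v \<in> tiso D' ` mult_sub D' ?a' W' \<longleftrightarrow> ?k v \<in> mult_sub D' ?a' W'"
    proof
      assume "v \<in> tiso D' ` mult_sub D' ?a' W'"
      then obtain z where z: "z \<in> mult_sub D' ?a' W'" "v = tiso D' z" by blast
      hence "?k v = z" using bij' by (auto simp: bij_betw_def mult_sub_def)
      thus "?k v \<in> mult_sub D' ?a' W'" using z by simp
    qed (use kv in \<open>metis imageI\<close>)
    thus ?thesis using kv(1) by (simp add: isotypic_sub_eq_image mult_sub_def)
  qed
  have tiso_in: "tiso D z \<in> tensor_power n i" if "z \<in> ?X" for z
    using rep_homD(1)[OF hom, of z] that by (simp add: Tsp)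
  have swin: "sandwich x y p \<in> tensor_power n j" if "x \<in> words n l" "y \<in> words n r" "p \<in> tensor_power n i" for x y p
    using sandwich_in[OF that] j by simp
  have matrix: "(\<lambda>c'. ?k (sandwich x y (tiso D (mult_incl s t w))) (s', c', t')) =
      matrix_apply (?a s) (?a' s') (sandwich_matrix D D' x y (s, t) (s', t')) w"
    if xy: "x \<in> words n l" "y \<in> words n r" and st: "s < nsimple D" "t < sdim D s"
      and st': "s' < nsimple D'" "t' < sdim D' s'" and w: "w \<in> cspace (?a s)" for x y s t s' t' w
  proof
    fix c'
    have inX: "mult_incl s t (delta c) \<in> ?X" if "c < ?a s" for c
      using that st by (intro mult_incl_in) (auto simp: cspace_def delta_def)
    have scX: "fscale (w c) (mult_incl s t (delta c)) \<in> ?X" if "c < ?a s" for c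
      by (rule fn.subspace_scale[OF subspace_coord_space inX[OF that]])
    have "mult_incl s t w = (\<Sum>c<?a s. fscale (w c) (mult_incl s t (delta c)))"
    proof
      fix p :: "nat \<times> nat \<times> nat"
      obtain s1 c1 t1 where p: "p = (s1, c1, t1)" by (cases p)
      have "(\<Sum>c<?a s. w c * mult_incl s t (delta c) p) =
          (\<Sum>c<?a s. if c = c1 then mult_incl s t w p else 0)"
        by (rule sum.cong) (auto simp: mult_incl_def delta_def p)
      thus "mult_incl s t w p = (\<Sum>c<?a s. fscale (w c) (mult_incl s t (delta c))) p"
        using w by (auto simp: mult_incl_def p cspace_def)
    qed
    hence "tiso D (mult_incl s t w) = tiso D (\<Sum>c<?a s. fscale (w c) (mult_incl s t (delta c)))" by simp
    also have "\<dots> = (\<Sum>c<?a s. tiso D (fscale (w c) (mult_incl s t (delta c))))"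
      using scX by (intro rep_hom_sum[OF linS linT hom]) simp
    also have "\<dots> = (\<Sum>c<?a s. fscale (w c) (tiso D (mult_incl s t (delta c))))"
    proof (rule sum.cong[OF refl])
      fix c assume "c \<in> {..<?a s}"
      thus "tiso D (fscale (w c) (mult_incl s t (delta c))) = fscale (w c) (tiso D (mult_incl s t (delta c)))"
        using rep_homD(3)[OF hom, of "mult_incl s t (delta c)" "w c"] inX by (simp add: Tsp)
    qed
    finally have 1: "sandwich x y (tiso D (mult_incl s t w)) =
        (\<Sum>c<?a s. fscale (w c) (sandwich x y (tiso D (mult_incl s t (delta c)))))"
      by (simp only: sandwich_sum sandwich_linear)
    have inT: "sandwich x y (tiso D (mult_incl s t (delta c))) \<in> tensor_power n j" if "c < ?a s" for c
      using inX[OF that] by (intro swin xy tiso_in)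
    have "?k (sandwich x y (tiso D (mult_incl s t w))) =
        (\<Sum>c<?a s. ?k (fscale (w c) (sandwich x y (tiso D (mult_incl s t (delta c))))))"
      unfolding 1 using inT fn.subspace_scale[OF subspace_tensor_power]
      by (intro rep_hom_sum[OF linT linS k]) (simp add: Tsp)
    also have "\<dots> = (\<Sum>c<?a s. fscale (w c) (?k (sandwich x y (tiso D (mult_incl s t (delta c))))))"
    proof (rule sum.cong[OF refl])
      fix c assume "c \<in> {..<?a s}"
      thus "?k (fscale (w c) (sandwich x y (tiso D (mult_incl s t (delta c))))) =
          fscale (w c) (?k (sandwich x y (tiso D (mult_incl s t (delta c)))))"
        using rep_homD(3)[OF k, of _ "w c"] inT by (simp add: Tsp)
    qed
    finally have 2: "?k (sandwich x y (tiso D (mult_incl s t w))) (s', c', t') =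
        (\<Sum>c<?a s. sandwich_matrix D D' x y (s, t) (s', t') c' c * w c)"
      by (simp add: sandwich_matrix_def mult.commute)
    have "mult_incl s t w \<in> ?X" using w st by (intro mult_incl_in)
    hence "?k (sandwich x y (tiso D (mult_incl s t w))) \<in> ?X'"
      using rep_homD(1)[OF k] swin[OF xy tiso_in] by (simp add: Tsp)
    thus "?k (sandwich x y (tiso D (mult_incl s t w))) (s', c', t') =
        matrix_apply (?a s) (?a' s') (sandwich_matrix D D' x y (s, t) (s', t')) w c'"
      using 2 by (auto simp: matrix_apply_def coord_space_def simples_index_def)
  qed
  have gen: "(\<forall>p\<in>isotypic_sub D W. sandwich x y p \<in> isotypic_sub D' W') \<longleftrightarrow>
     (\<forall>s<nsimple D. \<forall>t<sdim D s. \<forall>w\<in>W s. sandwich x y (tiso D (mult_incl s t w)) \<in> isotypic_sub D' W')"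
    if xy: "x \<in> words n l" "y \<in> words n r" for x y
  proof
    assume *: "\<forall>p\<in>isotypic_sub D W. sandwich x y p \<in> isotypic_sub D' W'"
    show "\<forall>s<nsimple D. \<forall>t<sdim D s. \<forall>w\<in>W s. sandwich x y (tiso D (mult_incl s t w)) \<in> isotypic_sub D' W'"
    proof (intro allI impI ballI)
      fix s t w assume "s < nsimple D" "t < sdim D s" "w \<in> W s"
      from mult_incl_in_mult_sub[where W = W and a = ?a, OF this W]
      show "sandwich x y (tiso D (mult_incl s t w)) \<in> isotypic_sub D' W'"
        using * by (simp add: isotypic_sub_eq_image)
    qed
  next
    assume *: "\<forall>s<nsimple D. \<forall>t<sdim D s. \<forall>w\<in>W s. sandwich x y (tiso D (mult_incl s t w)) \<in> isotypic_sub D' W'"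
    show "\<forall>p\<in>isotypic_sub D W. sandwich x y p \<in> isotypic_sub D' W'"
    proof
      fix p assume "p \<in> isotypic_sub D W"
      then obtain z where z: "z \<in> mult_sub D ?a W" "p = tiso D z" by (auto simp: isotypic_sub_eq_image)
      have zX: "z \<in> ?X" and zW: "\<And>s t. s < nsimple D \<Longrightarrow> t < sdim D s \<Longrightarrow> (\<lambda>c. z (s, c, t)) \<in> W s"
        using z(1) by (simp_all add: mult_sub_def)
      let ?z = "\<lambda>s t. mult_incl s t (\<lambda>c. z (s, c, t))"
      have inX: "?z s t \<in> rspace (sum_of_simples D ?a)" if "s < nsimple D" "t < sdim D s" for s t
        using mult_incl_in_mult_sub[where W = W and a = ?a, OF that zW[OF that] W] by (simp add: mult_sub_def)
      have "p = tiso D (\<Sum>s<nsimple D. \<Sum>t<sdim D s. ?z s t)" using mult_sub_expand[OF zX] z(2) by simp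
      also have "\<dots> = (\<Sum>s<nsimple D. tiso D (\<Sum>t<sdim D s. ?z s t))"
      proof (rule rep_hom_sum[OF linS linT hom])
        fix s assume "s \<in> {..<nsimple D}"
        thus "(\<Sum>t<sdim D s. ?z s t) \<in> rspace (sum_of_simples D ?a)"
          using inX unfolding sum_of_simples_simps by (intro fn.subspace_sum[OF subspace_coord_space]) auto
      qed
      also have "\<dots> = (\<Sum>s<nsimple D. \<Sum>t<sdim D s. tiso D (?z s t))"
        using inX by (intro sum.cong refl rep_hom_sum[OF linS linT hom]) simp
      finally have "sandwich x y p = (\<Sum>s<nsimple D. \<Sum>t<sdim D s. sandwich x y (tiso D (?z s t)))"
        by (simp only: sandwich_sum)
      also have "\<dots> \<in> isotypic_sub D' W'"
        using * zW by (intro fn.subspace_sum[OF subP']) auto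
      finally show "sandwich x y p \<in> isotypic_sub D' W'" .
    qed
  qed
  have step: "sandwich x y (tiso D (mult_incl s t w)) \<in> isotypic_sub D' W' \<longleftrightarrow>
      (\<forall>s'<nsimple D'. \<forall>t'<sdim D' s'.
        matrix_apply (?a s) (?a' s') (sandwich_matrix D D' x y (s, t) (s', t')) w \<in> W' s')"
    if xy: "x \<in> words n l" "y \<in> words n r" and st: "s < nsimple D" "t < sdim D s" and w: "w \<in> W s" for x y s t w
  proof -
    have wc: "w \<in> cspace (?a s)" using w W[OF st(1)] by blast
    have "mult_incl s t w \<in> ?X" using wc st by (intro mult_incl_in)
    from memP'[OF swin[OF xy tiso_in[OF this]]] matrix[OF xy st _ _ wc] show ?thesis by simp
  qed
  show ?thesis
    unfolding tensor_sandwich_subset_iff[OF subP']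
  proof (intro iffI ballI allI impI)
    fix x y s t s' t' w
    assume *: "\<forall>x\<in>words n l. \<forall>y\<in>words n r. \<forall>p\<in>isotypic_sub D W. sandwich x y p \<in> isotypic_sub D' W'"
      and xy: "x \<in> words n l" "y \<in> words n r" and st: "s < nsimple D" "t < sdim D s"
      and st': "s' < nsimple D'" "t' < sdim D' s'" and w: "w \<in> W s"
    have "sandwich x y (tiso D (mult_incl s t w)) \<in> isotypic_sub D' W'"
      using gen[OF xy] * xy st w by simp
    thus "matrix_apply (?a s) (?a' s') (sandwich_matrix D D' x y (s, t) (s', t')) w \<in> W' s'"
      using step[OF xy st w] st' by simp
  next
    fix x y p
    assume *: "\<forall>x\<in>words n l. \<forall>y\<in>words n r. \<forall>s<nsimple D. \<forall>t<sdim D s. \<forall>s'<nsimple D'. \<forall>t'<sdim D' s'.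
        \<forall>w\<in>W s. matrix_apply (?a s) (?a' s') (sandwich_matrix D D' x y (s, t) (s', t')) w \<in> W' s'"
      and xy: "x \<in> words n l" "y \<in> words n r" and p: "p \<in> isotypic_sub D W"
    have "sandwich x y (tiso D (mult_incl s t w)) \<in> isotypic_sub D' W'"
      if "s < nsimple D" "t < sdim D s" "w \<in> W s" for s t w
      using step[OF xy that] * xy that by simp
    thus "sandwich x y p \<in> isotypic_sub D' W'" using gen[OF xy] p by simp
  qed
qed

section \<open>The parameter set as a closed subset of the product of Grassmannians\<close>

text \<open>Degree by degree this is the classification of subrepresentations by their multiplicity spaces;
  the dimensions of these spaces express the isomorphism type.\<close>

lemma schur_map_bij:
  assumes ss: "\<And>j. semisimple_rep G (tensor_rep n \<rho> j) m (words n j)"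
    and K: "\<And>j. j \<in> {2..k} \<Longrightarrow> subrep G (tensor_rep n \<rho> j) (K j)"
    and D: "\<And>j. j \<in> {2..k} \<Longrightarrow> isotypic_decomposition m G (tensor_rep n \<rho> j) (K j) (D j)"
  shows "bij_betw (schur_map k D) (grass_product k D) (\<Pi>\<^sub>E j\<in>{2..k}. subreps_like G n \<rho> j (K j))"
proof -
  have mem: "X (j, i) \<in> Grass (ker_mult (D j) i) (tot_mult (D j) i)"
    if "X \<in> grass_product k D" "j \<in> {2..k}" "i < nsimple (D j)" for X j i
    using that by (auto simp: grass_product_def grass_index_def grass_f_def grass_a_def dest: PiE_mem)
  show ?thesis unfolding bij_betw_def
  proof (intro conjI equalityI subsetI)
    show "inj_on (schur_map k D) (grass_product k D)"
    proof (rule inj_onI)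
      fix X Y assume XY: "X \<in> grass_product k D" "Y \<in> grass_product k D" "schur_map k D X = schur_map k D Y"
      have "X q = Y q" if q: "q \<in> grass_index k D" for q
      proof -
        obtain j i where qi: "q = (j, i)" "j \<in> {2..k}" "i < nsimple (D j)"
          using q by (auto simp: grass_index_def)
        have "schur_map k D X j = schur_map k D Y j" using XY(3) by simp
        hence "isotypic_sub (D j) (\<lambda>i. X (j, i)) = isotypic_sub (D j) (\<lambda>i. Y (j, i))"
          using qi(2) by (simp add: schur_map_def)
        from semisimple_rep.isotypic_sub_inj[OF ss D[OF qi(2)] mem[OF XY(1) qi(2)] mem[OF XY(2) qi(2)] this qi(3)]
        show ?thesis by (simp add: qi(1))
      qed
      thus "X = Y" using XY(1,2) unfolding grass_product_def by (intro PiE_ext)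
    qed
  next
    fix P assume "P \<in> schur_map k D ` grass_product k D"
    then obtain X where X: "X \<in> grass_product k D" "P = schur_map k D X" by blast
    show "P \<in> (\<Pi>\<^sub>E j\<in>{2..k}. subreps_like G n \<rho> j (K j))"
      unfolding X(2) schur_map_def
    proof (rule restrict_PiE_iff[THEN iffD2], rule ballI)
      fix j assume j: "j \<in> {2..k}"
      note sub = semisimple_rep.isotypic_sub_subrep[OF ss D[OF j], of "\<lambda>i. X (j, i)", OF mem[OF X(1) j]]
      show "isotypic_sub (D j) (\<lambda>i. X (j, i)) \<in> subreps_like G n \<rho> j (K j)"
        unfolding subreps_like_def using sub by blast
    qed
  next
    fix P assume P: "P \<in> (\<Pi>\<^sub>E j\<in>{2..k}. subreps_like G n \<rho> j (K j))"
    have "\<exists>W. j \<in> {2..k} \<longrightarrow> (\<forall>i<nsimple (D j). W i \<in> Grass (ker_mult (D j) i) (tot_mult (D j) i)) \<and>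
        P j = isotypic_sub (D j) W" for j
    proof (cases "j \<in> {2..k}")
      case True
      have "P j \<in> subreps_like G n \<rho> j (K j)" by (rule PiE_mem[OF P True])
      hence "subrep G (tensor_rep n \<rho> j) (P j)"
        "rep_isomorphic G (restrict_rep (tensor_rep n \<rho> j) (P j)) (restrict_rep (tensor_rep n \<rho> j) (K j))"
        by (simp_all add: subreps_like_def)
      from semisimple_rep.isotypic_sub_surj[OF ss D[OF True] K[OF True] this] show ?thesis by blast
    next
      case False
      thus ?thesis by blast
    qed
    hence "\<forall>j. \<exists>W. j \<in> {2..k} \<longrightarrow> (\<forall>i<nsimple (D j). W i \<in> Grass (ker_mult (D j) i) (tot_mult (D j) i)) \<and>
        P j = isotypic_sub (D j) W" by (rule allI)
    from choice[OF this] obtain W where W: "\<And>j. j \<in> {2..k} \<Longrightarrow>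
        (\<forall>i<nsimple (D j). W j i \<in> Grass (ker_mult (D j) i) (tot_mult (D j) i)) \<and> P j = isotypic_sub (D j) (W j)"
      by blast
    define X where "X = (\<lambda>q\<in>grass_index k D. W (fst q) (snd q))"
    have X: "X \<in> grass_product k D"
      using W by (auto simp: X_def grass_product_def grass_index_def grass_f_def grass_a_def)
    have "schur_map k D X = P"
    proof
      fix j
      show "schur_map k D X j = P j"
      proof (cases "j \<in> {2..k}")
        case True
        have "mult_sub (D j) (tot_mult (D j)) (\<lambda>i. X (j, i)) = mult_sub (D j) (tot_mult (D j)) (W j)"
          using True by (simp add: mult_sub_def X_def grass_index_def)
        thus ?thesis using W[OF True] True by (simp add: schur_map_def isotypic_sub_eq_image)
      next
        case False
        thus ?thesis using PiE_arb[OF P False] by (simp only: schur_map_def restrict_apply if_False)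
      qed
    qed
    thus "P \<in> schur_map k D ` grass_product k D" using X by blast
  qed
qed

text \<open>Since the image of the product of Grassmannians consists of subrepresentations of the right
  isomorphism types, only the ideal condition is left. It is an intersection of incidence conditions.\<close>

lemma param_set_closed:
  assumes ss: "\<And>j. semisimple_rep G (tensor_rep n \<rho> j) m (words n j)"
    and K: "\<And>j. j \<in> {2..k} \<Longrightarrow> subrep G (tensor_rep n \<rho> j) (K j)"
    and D: "\<And>j. j \<in> {2..k} \<Longrightarrow> isotypic_decomposition m G (tensor_rep n \<rho> j) (K j) (D j)"
  shows "zariski_closed (grass_index k D) (grass_f D) (grass_a D)
          {X \<in> grass_product k D. schur_map k D X \<in> param_set G n \<rho> K k}"
proof -
  let ?Q = "grass_index k D"
  have finQ: "finite ?Q" by (simp add: grass_index_def)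
  define A where "A = {(i, j, l, x, y, s, t, s', t'). 2 \<le> i \<and> i \<le> j \<and> j \<le> k \<and> l \<le> j - i \<and>
      x \<in> words n l \<and> y \<in> words n (j - i - l) \<and>
      s < nsimple (D i) \<and> t < sdim (D i) s \<and> s' < nsimple (D j) \<and> t' < sdim (D j) s'}"
  define Z where "Z = (\<lambda>(i, j, l :: nat, x, y, s, t, s', t'). {X \<in> (\<Pi>\<^sub>E q\<in>?Q. Grass (grass_f D q) (grass_a D q)).
      \<forall>w\<in>X (i, s). matrix_apply (grass_a D (i, s)) (grass_a D (j, s'))
         (sandwich_matrix (D i) (D j) x y (s, t) (s', t')) w \<in> X (j, s')})"
  have closed: "zariski_closed ?Q (grass_f D) (grass_a D) (Z z)" if z: "z \<in> A" for z
  proof -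
    obtain i j l x y s t s' t' where zz: "z = (i, j, l, x, y, s, t, s', t')" by (metis surj_pair)
    have "(i, s) \<in> ?Q" "(j, s') \<in> ?Q" using z unfolding zz A_def by (auto simp: grass_index_def)
    thus ?thesis unfolding zz Z_def prod.case by (intro zariski_closed_incidence[OF finQ])
  qed
  have "{X \<in> grass_product k D. schur_map k D X \<in> param_set G n \<rho> K k} =
      {X \<in> (\<Pi>\<^sub>E q\<in>?Q. Grass (grass_f D q) (grass_a D q)). \<forall>z\<in>A. X \<in> Z z}"
  proof -
    have "schur_map k D X \<in> param_set G n \<rho> K k \<longleftrightarrow> (\<forall>z\<in>A. X \<in> Z z)" if X: "X \<in> grass_product k D" for X
    proof -
      have W: "fn.subspace (X (j, s)) \<and> X (j, s) \<subseteq> cspace (tot_mult (D j) s)"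
        if "j \<in> {2..k}" "s < nsimple (D j)" for j s
        using X that by (auto simp: grass_product_def grass_index_def grass_f_def grass_a_def Grass_def dest!: PiE_mem[of _ _ _ "(j, s)"])
      have "schur_map k D X \<in> (\<Pi>\<^sub>E j\<in>{2..k}. subreps_like G n \<rho> j (K j))"
        using bij_betw_apply[OF schur_map_bij[OF ss K D] X] .
      hence "schur_map k D X \<in> param_set G n \<rho> K k \<longleftrightarrow> (\<forall>i j l. 2 \<le> i \<and> i \<le> j \<and> j \<le> k \<and> l \<le> j - i \<longrightarrow>
          tensor_sandwich n l (isotypic_sub (D i) (\<lambda>s. X (i, s))) (j - i - l) \<subseteq> isotypic_sub (D j) (\<lambda>s. X (j, s)))"
        by (auto simp: param_set_def schur_map_def)
      also have "\<dots> \<longleftrightarrow> (\<forall>z\<in>A. X \<in> Z z)"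
      proof -
        have eq: "tensor_sandwich n l (isotypic_sub (D i) (\<lambda>s. X (i, s))) (j - i - l) \<subseteq> isotypic_sub (D j) (\<lambda>s. X (j, s)) \<longleftrightarrow>
           (\<forall>x\<in>words n l. \<forall>y\<in>words n (j - i - l). \<forall>s<nsimple (D i). \<forall>t<sdim (D i) s. \<forall>s'<nsimple (D j). \<forall>t'<sdim (D j) s'.
              \<forall>w\<in>X (i, s). matrix_apply (grass_a D (i, s)) (grass_a D (j, s'))
                 (sandwich_matrix (D i) (D j) x y (s, t) (s', t')) w \<in> X (j, s'))"
          if ij: "2 \<le> i" "i \<le> j" "j \<le> k" "l \<le> j - i" for i j l
        proof -
          have r: "i \<in> {2..k}" "j \<in> {2..k}" "j = l + i + (j - i - l)" using ij by auto
          have h: "rep_iso G (sum_of_simples (D i) (tot_mult (D i))) (tensor_rep n \<rho> i) (tiso (D i))"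
            "rep_iso G (sum_of_simples (D j) (tot_mult (D j))) (tensor_rep n \<rho> j) (tiso (D j))"
            using D[OF r(1)] D[OF r(2)] by (simp_all add: isotypic_decomposition_iff)
          show ?thesis
            using sandwich_incidence[OF h, of "\<lambda>s. X (i, s)" "\<lambda>s. X (j, s)" l "j - i - l", OF W[OF r(1)] W[OF r(2)] r(3)]
            by (simp add: grass_a_def)
        qed
        have XP: "X \<in> (\<Pi>\<^sub>E q\<in>?Q. Grass (grass_f D q) (grass_a D q))" using X by (simp add: grass_product_def)
        show ?thesis
        proof (intro iffI ballI allI impI)
          fix z assume *: "\<forall>i j l. 2 \<le> i \<and> i \<le> j \<and> j \<le> k \<and> l \<le> j - i \<longrightarrow>
            tensor_sandwich n l (isotypic_sub (D i) (\<lambda>s. X (i, s))) (j - i - l) \<subseteq> isotypic_sub (D j) (\<lambda>s. X (j, s))"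
            and z: "z \<in> A"
          obtain i j l x y s t s' t' where zz: "z = (i, j, l, x, y, s, t, s', t')" by (metis surj_pair)
          have c: "2 \<le> i" "i \<le> j" "j \<le> k" "l \<le> j - i" "x \<in> words n l" "y \<in> words n (j - i - l)"
            "s < nsimple (D i)" "t < sdim (D i) s" "s' < nsimple (D j)" "t' < sdim (D j) s'"
            using z unfolding zz A_def by simp_all
          have "\<forall>w\<in>X (i, s). matrix_apply (grass_a D (i, s)) (grass_a D (j, s'))
                 (sandwich_matrix (D i) (D j) x y (s, t) (s', t')) w \<in> X (j, s')"
            using eq[OF c(1-4)] * c by simp
          thus "X \<in> Z z" using XP unfolding zz Z_def by simp
        next
          fix i j l assume *: "\<forall>z\<in>A. X \<in> Z z" and c: "2 \<le> i \<and> i \<le> j \<and> j \<le> k \<and> l \<le> j - i"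
          have "\<forall>w\<in>X (i, s). matrix_apply (grass_a D (i, s)) (grass_a D (j, s'))
                 (sandwich_matrix (D i) (D j) x y (s, t) (s', t')) w \<in> X (j, s')"
            if "x \<in> words n l" "y \<in> words n (j - i - l)" "s < nsimple (D i)" "t < sdim (D i) s"
              "s' < nsimple (D j)" "t' < sdim (D j) s'" for x y s t s' t'
          proof -
            have "(i, j, l, x, y, s, t, s', t') \<in> A" using that c by (simp add: A_def)
            hence "X \<in> Z (i, j, l, x, y, s, t, s', t')" using * by blast
            thus ?thesis by (simp add: Z_def)
          qed
          thus "tensor_sandwich n l (isotypic_sub (D i) (\<lambda>s. X (i, s))) (j - i - l) \<subseteq> isotypic_sub (D j) (\<lambda>s. X (j, s))"
            using eq[of i j l] c by simp
        qed
      qed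
      finally show ?thesis .
    qed
    thus ?thesis unfolding grass_product_def by blast
  qed
  thus ?thesis using zariski_closed_Inter[of A ?Q "grass_f D" "grass_a D" Z] closed by simp
qed

section \<open>The relations of an algebra generated in degree one\<close>

text \<open>The identification of $V$ with the component of degree one makes the algebra a quotient of the
  tensor algebra.\<close>

locale presented_algebra = G_algebra m G A
  for m :: nat and G :: "complex mat set" and A :: "('a::ab_group_add) galg" +
  fixes n :: nat and \<rho> :: "complex mat \<Rightarrow> complex mat" and \<psi> :: "(nat \<Rightarrow> complex) \<Rightarrow> 'a"
  assumes \<psi>: "rep_iso G (mat_rep n \<rho>) (comp_rep A 1) \<psi>"
begin

lemma subspace_alg_space: "subspace (alg_space A)"
  unfolding alg_space_def by (rule subspace_span)

lemma gcomp_alg_space: "a \<in> gcomp A i \<Longrightarrow> a \<in> alg_space A"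
  unfolding alg_space_def by (rule span_base) blast

lemma gone_gcomp: "gone A \<in> gcomp A 0"
  unfolding connected(2) by (rule span_base) simp

lemma linear_rep_comp: "linear_rep G (comp_rep A i)"
proof (intro linear_rep.intro linear_rep_axioms.intro)
  show "vector_space (rscale (comp_rep A i))" unfolding comp_rep_simps by (rule vector_space_axioms)
qed (use comp_subspace act_graded act_add act_scale gcomp_alg_space in simp_all)

lemma mult_sum_left:
  assumes "\<And>s. s \<in> S \<Longrightarrow> f s \<in> alg_space A" "b \<in> alg_space A"
  shows "gmult A (\<Sum>s\<in>S. f s) b = (\<Sum>s\<in>S. gmult A (f s) b)"
proof -
  have z: "gmult A 0 b = 0"
    using mult_scale_left[OF subspace_0[OF subspace_alg_space] assms(2), of 0] by simp
  show ?thesis using assms(1)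
  proof (induction S rule: infinite_finite_induct)
    case (insert s S)
    have "(\<Sum>s\<in>S. f s) \<in> alg_space A" using insert.prems by (intro subspace_sum[OF subspace_alg_space]) simp
    thus ?case using insert mult_add_left[OF _ _ assms(2)] by simp
  qed (simp_all add: z)
qed

lemma mult_sum_right:
  assumes "\<And>s. s \<in> S \<Longrightarrow> f s \<in> alg_space A" "b \<in> alg_space A"
  shows "gmult A b (\<Sum>s\<in>S. f s) = (\<Sum>s\<in>S. gmult A b (f s))"
proof -
  have z: "gmult A b 0 = 0"
    using mult_scale_right[OF assms(2) subspace_0[OF subspace_alg_space], of 0] by simp
  show ?thesis using assms(1)
  proof (induction S rule: infinite_finite_induct)
    case (insert s S)
    have "(\<Sum>s\<in>S. f s) \<in> alg_space A" using insert.prems by (intro subspace_sum[OF subspace_alg_space]) simp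
    thus ?case using insert mult_add_right[OF assms(2)] by simp
  qed (simp_all add: z)
qed

lemma mult_zero: "a \<in> alg_space A \<Longrightarrow> gmult A 0 a = 0" "a \<in> alg_space A \<Longrightarrow> gmult A a 0 = 0"
  using mult_sum_left[of "{}" "\<lambda>_. 0" a] mult_sum_right[of "{}" "\<lambda>_. 0" a] by simp_all

lemma act_sum:
  assumes "g \<in> G" "\<And>s. s \<in> S \<Longrightarrow> f s \<in> alg_space A"
  shows "gact A g (\<Sum>s\<in>S. f s) = (\<Sum>s\<in>S. gact A g (f s))"
proof -
  have z: "gact A g 0 = 0"
    using act_scale[OF assms(1) subspace_0[OF subspace_alg_space], of 0] by simp
  show ?thesis using assms(2)
  proof (induction S rule: infinite_finite_induct)
    case (insert s S)
    have "(\<Sum>s\<in>S. f s) \<in> alg_space A" using insert.prems by (intro subspace_sum[OF subspace_alg_space]) simp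
    thus ?case using insert act_add[OF assms(1)] by simp
  qed (simp_all add: z)
qed

definition gen :: "nat \<Rightarrow> 'a" where
  "gen i = \<psi> (unit_vector i)"

definition monomial :: "nat list \<Rightarrow> 'a" where
  "monomial w = foldr (\<lambda>i b. gmult A (\<psi> (unit_vector i)) b) w (gone A)"

lemma monomial_simps [simp]: "monomial [] = gone A" "monomial (i # w) = gmult A (gen i) (monomial w)"
  by (simp_all add: monomial_def gen_def)

lemma proj_map_eq: "proj_map A \<psi> n j t = (\<Sum>w\<in>words n j. gscale A (t w) (monomial w))"
  by (simp add: proj_map_def monomial_def)

lemma unit_vector_cspace: "i < n \<Longrightarrow> unit_vector i \<in> cspace n"
  by (auto simp: unit_vector_def cspace_def)

lemma gen_in: "i < n \<Longrightarrow> gen i \<in> gcomp A 1"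
  using \<psi> unit_vector_cspace[of i] unfolding gen_def rep_iso_iff_hom
  by (auto dest: rep_homD(1))

lemma monomial_in: "w \<in> words n j \<Longrightarrow> monomial w \<in> gcomp A j"
proof (induction w arbitrary: j)
  case Nil
  thus ?case using gone_gcomp by (simp add: words_def)
next
  case (Cons i w)
  then obtain j' where j: "j = Suc j'" "i < n" "w \<in> words n j'" by (cases j) (auto simp: words_def)
  show ?case using mult_graded[OF gen_in[OF j(2)] Cons.IH[OF j(3)]] by (simp add: j(1))
qed

lemma monomial_alg_space: "w \<in> words n j \<Longrightarrow> monomial w \<in> alg_space A"
  using monomial_in gcomp_alg_space by blast

lemma gen_alg_space: "i < n \<Longrightarrow> gen i \<in> alg_space A"
  using gen_in gcomp_alg_space by blast

lemma scale_alg_space: "a \<in> alg_space A \<Longrightarrow> gscale A c a \<in> alg_space A"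
  by (rule subspace_scale[OF subspace_alg_space])

lemma monomial_append:
  assumes "u \<in> words n a" "v \<in> words n b"
  shows "monomial (u @ v) = gmult A (monomial u) (monomial v)"
  using assms(1)
proof (induction u arbitrary: a)
  case Nil
  thus ?case using one_left[OF monomial_alg_space[OF assms(2)]] by simp
next
  case (Cons i u)
  then obtain a' where a: "a = Suc a'" "i < n" "u \<in> words n a'" by (cases a) (auto simp: words_def)
  show ?case
    using Cons.IH[OF a(3)] mult_assoc[OF gen_alg_space[OF a(2)] monomial_alg_space[OF a(3)] monomial_alg_space[OF assms(2)]]
    by simp
qed

lemma proj_in: "proj_map A \<psi> n j t \<in> gcomp A j"
  unfolding proj_map_eq
  by (intro subspace_sum[OF comp_subspace] subspace_scale[OF comp_subspace] monomial_in)

lemma proj_alg_space: "proj_map A \<psi> n j t \<in> alg_space A"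
  by (rule gcomp_alg_space[OF proj_in])

lemma proj_add: "proj_map A \<psi> n j (t + u) = proj_map A \<psi> n j t + proj_map A \<psi> n j u"
  unfolding proj_map_eq by (simp add: scale_left_distrib sum.distrib)

lemma proj_scale: "proj_map A \<psi> n j (fscale c t) = gscale A c (proj_map A \<psi> n j t)"
  unfolding proj_map_eq by (simp add: scale_sum_right)

lemma proj_mult:
  assumes "t \<in> tensor_power n a" "u \<in> tensor_power n b"
  shows "proj_map A \<psi> n (a + b) (tmul t u) = gmult A (proj_map A \<psi> n a t) (proj_map A \<psi> n b u)"
proof -
  note bij = bij_betw_append_words[of n a b]
  have mo: "gmult A (gscale A p (monomial x)) (gscale A q (monomial y)) = gscale A (p * q) (monomial (x @ y))"
    if "x \<in> words n a" "y \<in> words n b" for x y p q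
    using monomial_append[OF that] monomial_alg_space[OF that(1)] monomial_alg_space[OF that(2)]
    by (simp add: mult_scale_left mult_scale_right scale_alg_space)
  have "proj_map A \<psi> n (a + b) (tmul t u) =
      (\<Sum>z\<in>words n a \<times> words n b. gscale A (tmul t u (case z of (x, y) \<Rightarrow> x @ y)) (monomial (case z of (x, y) \<Rightarrow> x @ y)))"
    unfolding proj_map_eq by (rule sum.reindex_bij_betw[OF bij, symmetric])
  also have "\<dots> = (\<Sum>(x, y)\<in>words n a \<times> words n b. gscale A (t x * u y) (monomial (x @ y)))"
  proof (rule sum.cong[OF refl])
    fix z assume "z \<in> words n a \<times> words n b"
    then obtain x y where z: "z = (x, y)" "x \<in> words n a" "y \<in> words n b" by blast
    have "length x = a" "length y = b" using z words_length by blast+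
    hence "tmul t u (x @ y) = t x * u y" by (simp add: tmul_homogeneous[OF assms])
    thus "gscale A (tmul t u (case z of (x, y) \<Rightarrow> x @ y)) (monomial (case z of (x, y) \<Rightarrow> x @ y)) =
        (case z of (x, y) \<Rightarrow> gscale A (t x * u y) (monomial (x @ y)))" by (simp add: z(1))
  qed
  also have "\<dots> = (\<Sum>x\<in>words n a. \<Sum>y\<in>words n b. gscale A (t x * u y) (monomial (x @ y)))"
    by (rule sum.cartesian_product[symmetric])
  also have "\<dots> = (\<Sum>x\<in>words n a. \<Sum>y\<in>words n b. gmult A (gscale A (t x) (monomial x)) (gscale A (u y) (monomial y)))"
    by (intro sum.cong refl) (simp add: mo)
  also have "\<dots> = (\<Sum>x\<in>words n a. gmult A (gscale A (t x) (monomial x)) (proj_map A \<psi> n b u))"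
    unfolding proj_map_eq
    by (intro sum.cong refl mult_sum_right[symmetric] scale_alg_space monomial_alg_space)
  also have "\<dots> = gmult A (proj_map A \<psi> n a t) (proj_map A \<psi> n b u)"
    unfolding proj_map_eq[of a]
    by (intro mult_sum_left[symmetric] scale_alg_space monomial_alg_space proj_alg_space)
  finally show ?thesis .
qed

lemma act_gen:
  assumes g: "g \<in> G" and i: "i < n"
  shows "gact A g (gen i) = (\<Sum>j<n. gscale A (\<rho> g $$ (j, i)) (gen j))"
proof -
  have hom: "rep_hom G (mat_rep n \<rho>) (comp_rep A 1) \<psi>" using \<psi> by (simp add: rep_iso_iff_hom)
  have e: "ract (mat_rep n \<rho>) g (unit_vector i) = (\<Sum>j<n. fscale (\<rho> g $$ (j, i)) (unit_vector j))"
  proof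
    fix t
    have "(\<Sum>j<n. \<rho> g $$ (t, j) * unit_vector i j) = (\<Sum>j<n. if j = i then \<rho> g $$ (t, i) else 0)"
      by (rule sum.cong) (auto simp: unit_vector_def)
    moreover have "(\<Sum>j<n. \<rho> g $$ (j, i) * unit_vector j t) = (\<Sum>j<n. if j = t then \<rho> g $$ (t, i) else 0)"
      by (rule sum.cong) (auto simp: unit_vector_def)
    ultimately show "ract (mat_rep n \<rho>) g (unit_vector i) t = (\<Sum>j<n. fscale (\<rho> g $$ (j, i)) (unit_vector j)) t"
      using i by (simp add: mat_rep_def)
  qed
  have "gact A g (gen i) = \<psi> (ract (mat_rep n \<rho>) g (unit_vector i))"
    using rep_homD(4)[OF hom g, of "unit_vector i"] unit_vector_cspace[OF i] by (simp add: gen_def)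
  also have "\<dots> = (\<Sum>j<n. \<psi> (fscale (\<rho> g $$ (j, i)) (unit_vector j)))"
    unfolding e using fn.subspace_scale[OF subspace_cspace unit_vector_cspace]
    by (intro rep_hom_sum[OF linear_rep_mat_rep linear_rep_comp hom]) simp
  also have "\<dots> = (\<Sum>j<n. gscale A (\<rho> g $$ (j, i)) (gen j))"
  proof (rule sum.cong[OF refl])
    fix j assume "j \<in> {..<n}"
    thus "\<psi> (fscale (\<rho> g $$ (j, i)) (unit_vector j)) = gscale A (\<rho> g $$ (j, i)) (gen j)"
      using rep_homD(3)[OF hom, of "unit_vector j"] unit_vector_cspace[of j] by (simp add: gen_def)
  qed
  finally show ?thesis .
qed

text \<open>The algebra automorphism given by \<open>g\<close> is determined by its action on the generators; expanding
  the product of the images of the letters yields the Kronecker power.\<close>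

lemma act_monomial:
  assumes g: "g \<in> G"
  shows "w \<in> words n j \<Longrightarrow> gact A g (monomial w) = (\<Sum>v\<in>words n j. gscale A (tensor_entry \<rho> g v w) (monomial v))"
proof (induction w arbitrary: j)
  case Nil
  hence "j = 0" by (simp add: words_def)
  thus ?case by (simp add: words_0 act_algebra_one[OF g] tensor_entry_def)
next
  case (Cons i w)
  then obtain j' where j: "j = Suc j'" "i < n" "w \<in> words n j'" by (cases j) (auto simp: words_def)
  have te: "tensor_entry \<rho> g (k # v) (i # w) = \<rho> g $$ (k, i) * tensor_entry \<rho> g v w" for k v
    by (simp add: tensor_entry_def prod.lessThan_Suc_shift del: prod.lessThan_Suc)
  have in1: "gscale A (\<rho> g $$ (k, i)) (gen k) \<in> alg_space A" if "k < n" for k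
    using that by (intro scale_alg_space gen_alg_space)
  have in2: "gscale A (tensor_entry \<rho> g v w) (monomial v) \<in> alg_space A" if "v \<in> words n j'" for v
    using that by (intro scale_alg_space monomial_alg_space)
  have "gact A g (monomial (i # w)) = gmult A (gact A g (gen i)) (gact A g (monomial w))"
    using act_algebra_mult[OF g gen_alg_space[OF j(2)] monomial_alg_space[OF j(3)]] by simp
  also have "\<dots> = gmult A (\<Sum>k<n. gscale A (\<rho> g $$ (k, i)) (gen k))
      (\<Sum>v\<in>words n j'. gscale A (tensor_entry \<rho> g v w) (monomial v))"
    by (simp only: act_gen[OF g j(2)] Cons.IH[OF j(3)])
  also have "\<dots> = (\<Sum>k<n. gmult A (gscale A (\<rho> g $$ (k, i)) (gen k))
      (\<Sum>v\<in>words n j'. gscale A (tensor_entry \<rho> g v w) (monomial v)))"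
    using in1 in2 by (intro mult_sum_left subspace_sum[OF subspace_alg_space]) auto
  also have "\<dots> = (\<Sum>k<n. \<Sum>v\<in>words n j'. gmult A (gscale A (\<rho> g $$ (k, i)) (gen k))
      (gscale A (tensor_entry \<rho> g v w) (monomial v)))"
    using in1 in2 by (intro sum.cong refl mult_sum_right) auto
  also have "\<dots> = (\<Sum>k<n. \<Sum>v\<in>words n j'. gscale A (tensor_entry \<rho> g (k # v) (i # w)) (monomial (k # v)))"
    using gen_alg_space monomial_alg_space
    by (intro sum.cong refl) (simp add: te mult_scale_left mult_scale_right scale_alg_space)
  also have "\<dots> = (\<Sum>v\<in>words n j. gscale A (tensor_entry \<rho> g v (i # w)) (monomial v))"
    by (simp only: j(1) sum_words_Suc)
  finally show ?case .
qed

lemma proj_equivariant: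
  assumes g: "g \<in> G"
  shows "proj_map A \<psi> n j (ract (tensor_rep n \<rho> j) g t) = gact A g (proj_map A \<psi> n j t)"
proof -
  have "proj_map A \<psi> n j (ract (tensor_rep n \<rho> j) g t) =
      (\<Sum>w\<in>words n j. \<Sum>u\<in>words n j. gscale A (tensor_entry \<rho> g w u * t u) (monomial w))"
    unfolding proj_map_eq by (intro sum.cong refl) (simp add: tensor_rep_act scale_sum_left)
  also have "\<dots> = (\<Sum>u\<in>words n j. \<Sum>w\<in>words n j. gscale A (tensor_entry \<rho> g w u * t u) (monomial w))"
    by (rule sum.swap)
  also have "\<dots> = (\<Sum>u\<in>words n j. gact A g (gscale A (t u) (monomial u)))"
    by (intro sum.cong refl)
      (simp add: act_scale[OF g monomial_alg_space] act_monomial[OF g] scale_sum_right mult.commute)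
  also have "\<dots> = gact A g (proj_map A \<psi> n j t)"
    unfolding proj_map_eq by (intro act_sum[OF g, symmetric] scale_alg_space monomial_alg_space)
  finally show ?thesis .
qed

lemma rep_hom_proj: "rep_hom G (tensor_rep n \<rho> j) (comp_rep A j) (proj_map A \<psi> n j)"
  by (rule rep_homI) (simp_all add: proj_in proj_add proj_scale proj_equivariant)

lemma proj_delta: "w \<in> words n j \<Longrightarrow> proj_map A \<psi> n j (delta w) = monomial w"
proof -
  assume w: "w \<in> words n j"
  have "proj_map A \<psi> n j (delta w) = (\<Sum>v\<in>words n j. if v = w then monomial w else 0)"
    unfolding proj_map_eq by (rule sum.cong) (auto simp: delta_def)
  thus ?thesis using w finite_words by simp
qed

text \<open>The span of the monomials contains the generators and is closed under multiplication, so it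
  is the whole algebra.\<close>

lemma alg_space_monomials: "alg_space A \<subseteq> span (monomial ` {w. set w \<subseteq> {..<n}})"
proof -
  let ?M = "monomial ` {w. set w \<subseteq> {..<n}}"
  have wl: "w \<in> words n (length w)" if "set w \<subseteq> {..<n}" for w using that by (simp add: words_def)
  have MA: "?M \<subseteq> alg_space A" using wl monomial_alg_space by blast
  have hom: "rep_hom G (mat_rep n \<rho>) (comp_rep A 1) \<psi>" using \<psi> by (simp add: rep_iso_iff_hom)
  show ?thesis
  proof (rule generated)
    show "subspace (span ?M)" by simp
    show "gone A \<in> span ?M" using span_base[of "monomial []" ?M] imageI[of "[]" "{w. set w \<subseteq> {..<n}}" monomial] by simp
    show "gcomp A 1 \<subseteq> span ?M"
    proof
      fix a assume "a \<in> gcomp A 1"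
      hence "a \<in> \<psi> ` cspace n" using \<psi> by (simp add: rep_iso_def bij_betw_def)
      then obtain x where x: "x \<in> cspace n" "a = \<psi> x" by blast
      have ud: "unit_vector = delta" by (simp add: unit_vector_def delta_def fun_eq_iff)
      have "a = (\<Sum>i<n. \<psi> (fscale (x i) (unit_vector i)))"
      proof -
        have "x = (\<Sum>i<n. fscale (x i) (unit_vector i))"
          using coord_space_expand[of "{..<n}" x] x(1) by (simp add: cspace_eq_coord_space ud)
        hence "a = \<psi> (\<Sum>i<n. fscale (x i) (unit_vector i))" using x(2) by simp
        also have "\<dots> = (\<Sum>i<n. \<psi> (fscale (x i) (unit_vector i)))"
          using fn.subspace_scale[OF subspace_cspace unit_vector_cspace]
          by (intro rep_hom_sum[OF linear_rep_mat_rep linear_rep_comp hom]) simp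
        finally show ?thesis .
      qed
      also have "\<dots> = (\<Sum>i<n. gscale A (x i) (monomial [i]))"
      proof (rule sum.cong[OF refl])
        fix i assume "i \<in> {..<n}"
        hence i: "i < n" by simp
        have "\<psi> (fscale (x i) (unit_vector i)) = gscale A (x i) (gen i)"
          using rep_homD(3)[OF hom, of "unit_vector i" "x i"] unit_vector_cspace[OF i] by (simp add: gen_def)
        thus "\<psi> (fscale (x i) (unit_vector i)) = gscale A (x i) (monomial [i])"
          using one_right[OF gen_alg_space[OF i]] by simp
      qed
      also have "\<dots> \<in> span ?M" by (intro span_sum span_scale span_base imageI) simp
      finally show "a \<in> span ?M" .
    qed
    have spA: "b \<in> alg_space A" if "b \<in> span ?M" for b
      using span_minimal[OF MA subspace_alg_space] that by blast
    have mm: "gmult A x y \<in> span ?M" if xy: "x \<in> ?M" "y \<in> ?M" for x y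
    proof -
      obtain u v where uv: "x = monomial u" "y = monomial v" "set u \<subseteq> {..<n}" "set v \<subseteq> {..<n}" using xy by blast
      hence "gmult A x y = monomial (u @ v)" using monomial_append[OF wl wl] by simp
      thus ?thesis using uv by (auto intro!: span_base)
    qed
    have subs1: "subspace {y \<in> alg_space A. gmult A x y \<in> span ?M}" if x: "x \<in> alg_space A" for x
      using x subspace_alg_space
      by (auto simp: subspace_def mult_zero mult_add_right mult_scale_right intro: span_add span_scale span_zero)
    have subs2: "subspace {x \<in> alg_space A. gmult A x y \<in> span ?M}" if y: "y \<in> alg_space A" for y
      using y subspace_alg_space
      by (auto simp: subspace_def mult_zero mult_add_left mult_scale_left intro: span_add span_scale span_zero)
    have mb: "gmult A x b \<in> span ?M" if x: "x \<in> ?M" and b: "b \<in> span ?M" for x b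
      using span_minimal[OF _ subs1, of ?M x] mm[OF x] MA x b by blast
    show "gmult A a b \<in> span ?M" if "a \<in> span ?M" "b \<in> span ?M" for a b
      using span_minimal[OF _ subs2, of ?M b] mb[OF _ that(2)] MA spA[OF that(2)] that(1) by blast
  qed
qed

text \<open>An element of the algebra is a sum of combinations of monomials of various degrees. Homogeneous
  components being independent, only the monomials of degree \<open>j\<close> contribute to an element of
  degree \<open>j\<close>.\<close>

lemma proj_surj: "proj_map A \<psi> n j ` tensor_power n j = gcomp A j"
proof (intro equalityI subsetI)
  fix a assume a: "a \<in> gcomp A j"
  let ?R = "\<lambda>i. proj_map A \<psi> n i ` tensor_power n i"
  have linT: "linear_rep G (tensor_rep n \<rho> i)" for i by (rule linear_rep_tensor_rep)
  have Rsub: "subspace (?R i)" for i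
    using subrep_image[OF linT linear_rep_comp rep_hom_proj linear_rep.subrep_self[OF linT], of i]
    by (simp add: subrep_def)
  define C where "C = {b. \<exists>x N. (\<forall>i. x i \<in> ?R i) \<and> (\<forall>i\<ge>N. x i = 0) \<and> b = (\<Sum>i<N. x i)}"
  have ext: "(\<Sum>i<N. x i) = (\<Sum>i<N'. x i)" if "\<forall>i\<ge>N. x i = 0" "N \<le> N'" for x :: "nat \<Rightarrow> 'a" and N N'
    using that by (intro sum.mono_neutral_left) auto
  have "subspace C" unfolding subspace_def
  proof (intro conjI ballI allI)
    show "0 \<in> C" unfolding C_def
      by (rule CollectI, rule exI[of _ "\<lambda>_. 0"], rule exI[of _ 0]) (use subspace_0[OF Rsub] in simp)
  next
    fix b b' assume "b \<in> C" "b' \<in> C"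
    then obtain x N x' N' where x: "\<forall>i. x i \<in> ?R i" "\<forall>i\<ge>N. x i = 0" "b = (\<Sum>i<N. x i)"
      and x': "\<forall>i. x' i \<in> ?R i" "\<forall>i\<ge>N'. x' i = 0" "b' = (\<Sum>i<N'. x' i)" unfolding C_def by blast
    have "b + b' = (\<Sum>i<max N N'. x i + x' i)"
      using ext[OF x(2), of "max N N'"] ext[OF x'(2), of "max N N'"] x(3) x'(3) by (simp add: sum.distrib)
    moreover have "\<forall>i. x i + x' i \<in> ?R i" using x(1) x'(1) subspace_add[OF Rsub] by blast
    moreover have "\<forall>i\<ge>max N N'. x i + x' i = 0" using x(2) x'(2) by simp
    ultimately show "b + b' \<in> C" unfolding C_def
      by (intro CollectI exI[of _ "\<lambda>i. x i + x' i"] exI[of _ "max N N'"] conjI)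
  next
    fix c b assume "b \<in> C"
    then obtain x N where x: "\<forall>i. x i \<in> ?R i" "\<forall>i\<ge>N. x i = 0" "b = (\<Sum>i<N. x i)" unfolding C_def by blast
    have "gscale A c b = (\<Sum>i<N. gscale A c (x i))" by (simp add: x(3) scale_sum_right)
    moreover have "\<forall>i. gscale A c (x i) \<in> ?R i" using x(1) subspace_scale[OF Rsub] by blast
    moreover have "\<forall>i\<ge>N. gscale A c (x i) = 0" using x(2) by simp
    ultimately show "gscale A c b \<in> C" unfolding C_def
      by (intro CollectI exI[of _ "\<lambda>i. gscale A c (x i)"] exI[of _ N] conjI)
  qed
  moreover have "monomial ` {w. set w \<subseteq> {..<n}} \<subseteq> C"
  proof
    fix b assume "b \<in> monomial ` {w. set w \<subseteq> {..<n}}"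
    then obtain w where w: "b = monomial w" "w \<in> words n (length w)" by (auto simp: words_def)
    have "b \<in> ?R (length w)"
      using proj_delta[OF w(2)] delta_in_tensor_power[OF w(2)] w(1) by (metis imageI)
    hence "\<forall>i. (if i = length w then b else 0) \<in> ?R i" using subspace_0[OF Rsub] by simp
    moreover have "b = (\<Sum>i<Suc (length w). if i = length w then b else 0)" by simp
    moreover have "\<forall>i\<ge>Suc (length w). (if i = length w then b else 0) = 0" by simp
    ultimately show "b \<in> C" unfolding C_def
      by (intro CollectI exI[of _ "\<lambda>i. if i = length w then b else 0"] exI[of _ "Suc (length w)"] conjI)
  qed
  ultimately have "alg_space A \<subseteq> C" using alg_space_monomials span_minimal by blast
  hence "a \<in> C" using gcomp_alg_space[OF a] by blast
  then obtain x N where x: "\<forall>i. x i \<in> ?R i" "\<forall>i\<ge>N. x i = 0" "a = (\<Sum>i<N. x i)" unfolding C_def by blast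
  have xg: "x i \<in> gcomp A i" for i using x(1)[rule_format, of i] proj_in[of i] by auto
  \<comment> \<open>a relation between homogeneous elements: the components of \<open>a\<close> minus \<open>a\<close> itself\<close>
  define y where "y i = x i - (if i = j then a else 0)" for i
  have "x j - a = 0"
  proof -
    have "(\<Sum>i<max N (Suc j). y i) = (\<Sum>i<max N (Suc j). x i) - a"
      by (simp add: y_def sum_subtractf less_max_iff_disj)
    also have "\<dots> = 0" using ext[OF x(2), of "max N (Suc j)"] x(3) by simp
    finally have "(\<Sum>i<max N (Suc j). y i) = 0" .
    moreover have "y i \<in> gcomp A i" for i
      unfolding y_def using xg a subspace_diff[OF comp_subspace] subspace_0[OF comp_subspace] by simp
    ultimately have "y j = 0" using comp_direct[of "{..<max N (Suc j)}" y j] by simp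
    thus ?thesis by (simp add: y_def)
  qed
  thus "a \<in> ?R j" using x(1) by (metis eq_iff_diff_eq_0)
qed (use proj_in in blast)

lemma relations_eq_kernel: "relations A \<psi> n j = {t \<in> rspace (tensor_rep n \<rho> j). proj_map A \<psi> n j t = 0}"
  by (simp add: relations_def)

lemma subrep_relations: "subrep G (tensor_rep n \<rho> j) (relations A \<psi> n j)"
  unfolding relations_eq_kernel
  by (rule subrep_kernel[OF linear_rep_tensor_rep linear_rep_comp rep_hom_proj])

lemma complement_relations_iso:
  assumes "complementary G (tensor_rep n \<rho> j) (relations A \<psi> n j) C"
  shows "rep_iso G (restrict_rep (tensor_rep n \<rho> j) C) (comp_rep A j) (proj_map A \<psi> n j)"
  using assms unfolding relations_eq_kernel
  by (intro complement_iso_image[OF linear_rep_tensor_rep linear_rep_comp rep_hom_proj])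
    (simp_all add: proj_surj)

lemma relations_sandwich: "tensor_sandwich n l (relations A \<psi> n i) r \<subseteq> relations A \<psi> n (l + i + r)"
proof -
  have "fn.subspace (relations A \<psi> n (l + i + r))"
    using subrep_relations[of "l + i + r"] by (simp add: subrep_def)
  moreover have "sandwich x y p \<in> relations A \<psi> n (l + i + r)"
    if "x \<in> words n l" "y \<in> words n r" "p \<in> relations A \<psi> n i" for x y p
  proof -
    have p: "p \<in> tensor_power n i" "proj_map A \<psi> n i p = 0" using that(3) by (simp_all add: relations_def)
    have xp: "tmul (delta x) p \<in> tensor_power n (l + i)"
      by (intro tmul_in_tensor_power delta_in_tensor_power that p)
    have "proj_map A \<psi> n (l + i) (tmul (delta x) p) = 0"
      using proj_mult[OF delta_in_tensor_power[OF that(1)] p(1)] p(2) by (simp add: mult_zero proj_alg_space)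
    hence "proj_map A \<psi> n (l + i + r) (sandwich x y p) = 0"
      unfolding sandwich_def using proj_mult[OF xp delta_in_tensor_power[OF that(2)]]
      by (simp add: mult_zero proj_alg_space)
    thus ?thesis using sandwich_in[OF that(1,2) p(1)] by (simp add: relations_def)
  qed
  ultimately show ?thesis by (simp add: tensor_sandwich_subset_iff)
qed

end

text \<open>The components of two algebras are quotients of the same tensor power. If they are isomorphic,
  so are complements of the relations, and cancellation applies.\<close>

lemma relations_isomorphic:
  assumes A: "presented_algebra m G A n \<rho> \<psi>" and B: "presented_algebra m G B n \<rho> \<eta>"
    and ss: "semisimple_rep G (tensor_rep n \<rho> j) m (words n j)"
    and iso: "rep_isomorphic G (comp_rep B j) (comp_rep A j)"
  shows "rep_isomorphic G (restrict_rep (tensor_rep n \<rho> j) (relations B \<eta> n j))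
           (restrict_rep (tensor_rep n \<rho> j) (relations A \<psi> n j))"
proof -
  interpret A: presented_algebra m G A n \<rho> \<psi> by fact
  interpret B: presented_algebra m G B n \<rho> \<eta> by fact
  interpret T: semisimple_rep G "tensor_rep n \<rho> j" m "words n j" by fact
  obtain CA where CA: "complementary G (tensor_rep n \<rho> j) (relations A \<psi> n j) CA"
    using completely_reducibleD[OF T.reducible A.subrep_relations] by blast
  obtain CB where CB: "complementary G (tensor_rep n \<rho> j) (relations B \<eta> n j) CB"
    using completely_reducibleD[OF T.reducible B.subrep_relations] by blast
  have sA: "subrep G (tensor_rep n \<rho> j) CA" using CA by (simp add: complementary_def)
  have 1: "rep_isomorphic G (restrict_rep (tensor_rep n \<rho> j) CB) (comp_rep B j)"
    using B.complement_relations_iso[OF CB] by (auto simp: rep_isomorphic_def)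
  have 2: "rep_isomorphic G (comp_rep A j) (restrict_rep (tensor_rep n \<rho> j) CA)"
  proof (rule linear_rep.rep_isomorphic_sym)
    show "linear_rep G (restrict_rep (tensor_rep n \<rho> j) CA)"
      by (rule linear_rep_of_subrep[OF linear_rep_tensor_rep sA])
    show "rep_isomorphic G (restrict_rep (tensor_rep n \<rho> j) CA) (comp_rep A j)"
      using A.complement_relations_iso[OF CA] by (auto simp: rep_isomorphic_def)
  qed
  from rep_isomorphic_trans[OF rep_isomorphic_trans[OF 1 iso] 2]
  have "rep_isomorphic G (restrict_rep (tensor_rep n \<rho> j) CB) (restrict_rep (tensor_rep n \<rho> j) CA)" .
  thus ?thesis by (rule T.complement_cancel[OF CB CA])
qed

lemma relations_in_param_set:
  assumes A: "presented_algebra m G A n \<rho> \<psi>" and B: "presented_algebra m G B n \<rho> \<eta>"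
    and ss: "\<And>j. semisimple_rep G (tensor_rep n \<rho> j) m (words n j)"
    and iso: "\<And>j. j \<le> k \<Longrightarrow> rep_isomorphic G (comp_rep B j) (comp_rep A j)"
  shows "(\<lambda>j\<in>{2..k}. relations B \<eta> n j) \<in> param_set G n \<rho> (relations A \<psi> n) k"
proof -
  have "relations B \<eta> n j \<in> subreps_like G n \<rho> j (relations A \<psi> n j)" if "j \<in> {2..k}" for j
    using relations_isomorphic[OF A B ss iso] presented_algebra.subrep_relations[OF B] that
    by (simp add: subreps_like_def)
  moreover have "tensor_sandwich n l (relations B \<eta> n i) (j - i - l) \<subseteq> relations B \<eta> n j"
    if "i \<le> j" "l \<le> j - i" for i j l
    using presented_algebra.relations_sandwich[OF B, of l i "j - i - l"] that by simp
  ultimately show ?thesis by (auto simp: param_set_def)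
qed

section \<open>The algebra defined by a graded ideal\<close>

text \<open>Functions of arbitrary support on words: the completed tensor algebra. The product is defined
  there as well, because a word has only finitely many factorisations, and this makes it unnecessary to
  keep track of finite sums of homogeneous tensors.\<close>

definition free_space :: "nat \<Rightarrow> (nat list \<Rightarrow> complex) set" where
  "free_space n = coord_space {w. set w \<subseteq> {..<n}}"

definition part :: "nat \<Rightarrow> nat \<Rightarrow> (nat list \<Rightarrow> complex) \<Rightarrow> nat list \<Rightarrow> complex" where
  "part n j t = (\<lambda>w. if w \<in> words n j then t w else 0)"

lemma part_in: "part n j t \<in> tensor_power n j"
  by (simp add: part_def tensor_power_def)

lemma part_add: "part n j (t + u) = part n j t + part n j u"
  by (auto simp: part_def fun_eq_iff)

lemma part_scale: "part n j (fscale c t) = fscale c (part n j t)"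
  by (auto simp: part_def fun_eq_iff)

lemma part_diff: "part n j (t - u) = part n j t - part n j u"
  by (auto simp: part_def fun_eq_iff)

lemma part_self: "t \<in> tensor_power n j \<Longrightarrow> part n j t = t"
  by (auto simp: part_def fun_eq_iff tensor_power_def)

lemma part_other: "t \<in> tensor_power n j \<Longrightarrow> i \<noteq> j \<Longrightarrow> part n i t = 0"
  by (auto simp: part_def fun_eq_iff tensor_power_def words_def)

lemma part_ext:
  assumes "t \<in> free_space n" "u \<in> free_space n" "\<And>j. part n j t = part n j u"
  shows "t = u"
proof
  fix w
  show "t w = u w"
  proof (cases "set w \<subseteq> {..<n}")
    case True
    thus ?thesis using fun_cong[OF assms(3)[of "length w"], of w] by (simp add: part_def words_def)
  qed (use assms(1,2) in \<open>simp add: free_space_def coord_space_def\<close>)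
qed

lemma tensor_power_free: "t \<in> tensor_power n j \<Longrightarrow> t \<in> free_space n"
  by (auto simp: tensor_power_def free_space_def coord_space_def words_def)

lemma subspace_free: "fn.subspace (free_space n)"
  unfolding free_space_def by (rule subspace_coord_space)

lemma tmul_free:
  assumes "t \<in> free_space n" "u \<in> free_space n"
  shows "tmul t u \<in> free_space n"
proof -
  have "tmul t u w = 0" if w: "\<not> set w \<subseteq> {..<n}" for w
    unfolding tmul_def
  proof (intro sum.neutral ballI)
    fix l assume "l \<in> {..length w}"
    have "set w = set (take l w) \<union> set (drop l w)" by (metis append_take_drop_id set_append)
    hence "t (take l w) = 0 \<or> u (drop l w) = 0"
      using w assms by (auto simp: free_space_def coord_space_def)
    thus "t (take l w) * u (drop l w) = 0" by auto
  qed
  thus ?thesis by (simp add: free_space_def coord_space_def)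
qed

lemma part_tmul: "part n j (tmul t u) = (\<Sum>l\<le>j. tmul (part n l t) (part n (j - l) u))"
proof
  fix w
  have e: "tmul (part n l t) (part n (j - l) u) w = (if w \<in> words n j then t (take l w) * u (drop l w) else 0)"
    if l: "l \<le> j" for l
  proof (cases "length w = j")
    case True
    have "w \<in> words n j \<longleftrightarrow> take l w \<in> words n l \<and> drop l w \<in> words n (j - l)"
      using words_append_iff[of w l "j - l" n] True l by simp
    thus ?thesis unfolding tmul_homogeneous[OF part_in part_in] using True l by (auto simp: part_def)
  next
    case False
    thus ?thesis unfolding tmul_homogeneous[OF part_in part_in] using l by (auto simp: words_def)
  qed
  have "(\<Sum>l\<le>j. tmul (part n l t) (part n (j - l) u)) w =
      (\<Sum>l\<le>j. if w \<in> words n j then t (take l w) * u (drop l w) else 0)"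
    by (simp add: e)
  thus "part n j (tmul t u) w = (\<Sum>l\<le>j. tmul (part n l t) (part n (j - l) u)) w"
    by (cases "w \<in> words n j") (simp_all add: part_def tmul_def words_length)
qed

text \<open>Both sides run over all ways of cutting a word into three factors.\<close>

lemma tmul_assoc: "tmul (tmul t u) v = tmul t (tmul u v)"
proof
  fix w :: "nat list"
  let ?N = "length w"
  define g where "g k m = t (take k w) * u (take m (drop k w)) * v (drop (k + m) w)" for k m
  have "tmul (tmul t u) v w = (\<Sum>l\<le>?N. \<Sum>k\<le>l. g k (l - k))"
    unfolding tmul_def
  proof (rule sum.cong[OF refl])
    fix l assume l: "l \<in> {..?N}"
    show "(\<Sum>k\<le>length (take l w). t (take k (take l w)) * u (drop k (take l w))) * v (drop l w) = (\<Sum>k\<le>l. g k (l - k))"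
      using l by (auto simp: g_def sum_distrib_right drop_take min_def intro!: sum.cong)
  qed
  also have "\<dots> = (\<Sum>(k, m)\<in>{(k, m). k + m \<le> ?N}. g k m)"
    by (rule sum.triangle_reindex_eq[symmetric])
  also have "{(k, m). k + m \<le> ?N} = (SIGMA k:{..?N}. {..?N - k})" by auto
  also have "(\<Sum>(k, m)\<in>(SIGMA k:{..?N}. {..?N - k}). g k m) = (\<Sum>k\<le>?N. \<Sum>m\<le>?N - k. g k m)"
    by (rule sum.Sigma[symmetric]) auto
  also have "\<dots> = tmul t (tmul u v) w"
    unfolding tmul_def
    by (auto simp: g_def sum_distrib_left mult.assoc add.commute intro!: sum.cong)
  finally show "tmul (tmul t u) v w = tmul t (tmul u v) w" .
qed

lemma tmul_one_left: "tmul (delta []) t = t"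
proof
  fix w
  have "tmul (delta []) t w = (\<Sum>l\<le>length w. if l = 0 then t w else 0)"
    unfolding tmul_def by (intro sum.cong) (auto simp: delta_def)
  thus "tmul (delta []) t w = t w" by simp
qed

lemma tmul_one_right: "tmul t (delta []) = t"
proof
  fix w
  have "tmul t (delta []) w = (\<Sum>l\<le>length w. if l = length w then t w else 0)"
    unfolding tmul_def by (intro sum.cong) (auto simp: delta_def)
  thus "tmul t (delta []) w = t w" by simp
qed

lemma tmul_delta: "tmul (delta u) (delta v) = delta (u @ v)"
proof
  fix w
  have "tmul (delta u) (delta v) w = (\<Sum>l\<le>length w. if l = length u then (if w = u @ v then 1 else 0) else 0)"
    unfolding tmul_def
  proof (rule sum.cong[OF refl])
    fix l assume "l \<in> {..length w}"
    hence l: "l \<le> length w" by simp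
    have iff: "take l w = u \<and> drop l w = v \<longleftrightarrow> l = length u \<and> w = u @ v"
    proof
      assume *: "take l w = u \<and> drop l w = v"
      hence "length u = l" using l by auto
      moreover have "w = u @ v" using * append_take_drop_id[of l w] by simp
      ultimately show "l = length u \<and> w = u @ v" by simp
    qed simp
    have "delta u (take l w) * delta v (drop l w) = (if take l w = u \<and> drop l w = v then 1 else 0)"
      by (simp add: delta_def)
    thus "delta u (take l w) * delta v (drop l w) = (if l = length u then (if w = u @ v then 1 else 0) else 0)"
      by (simp only: iff) simp
  qed
  thus "tmul (delta u) (delta v) w = delta (u @ v) w" by (auto simp: delta_def)
qed

definition free_act :: "nat \<Rightarrow> (complex mat \<Rightarrow> complex mat) \<Rightarrow> complex mat \<Rightarrow> (nat list \<Rightarrow> complex) \<Rightarrow> nat list \<Rightarrow> complex" where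
  "free_act n \<rho> g t = (\<lambda>w. ract (tensor_rep n \<rho> (length w)) g t w)"

lemma part_free_act: "part n j (free_act n \<rho> g t) = ract (tensor_rep n \<rho> j) g (part n j t)"
  by (auto simp: fun_eq_iff part_def free_act_def tensor_rep_act words_length)

lemma free_act_free: "free_act n \<rho> g t \<in> free_space n"
  by (auto simp: free_space_def coord_space_def free_act_def tensor_rep_act words_def)

lemma free_act_homogeneous:
  assumes "t \<in> tensor_power n j"
  shows "free_act n \<rho> g t = ract (tensor_rep n \<rho> j) g t"
proof (rule part_ext)
  note r = tensor_rep_act_in[of n \<rho> j g t]
  show "ract (tensor_rep n \<rho> j) g t \<in> free_space n" by (rule tensor_power_free[OF r])
  fix i
  have "ract (tensor_rep n \<rho> i) g 0 = 0" by (auto simp: fun_eq_iff tensor_rep_act)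
  thus "part n i (free_act n \<rho> g t) = part n i (ract (tensor_rep n \<rho> j) g t)"
    using assms r by (cases "i = j") (simp_all add: part_free_act part_self part_other)
qed (rule free_act_free)

lemma free_act_add: "free_act n \<rho> g (t + u) = free_act n \<rho> g t + free_act n \<rho> g u"
  by (auto simp: fun_eq_iff free_act_def tensor_rep_act algebra_simps sum.distrib)

lemma free_act_scale: "free_act n \<rho> g (fscale c t) = fscale c (free_act n \<rho> g t)"
  by (auto simp: fun_eq_iff free_act_def tensor_rep_act algebra_simps sum_distrib_left)

lemma tensor_entry_append:
  assumes "length u = length u'"
  shows "tensor_entry \<rho> g (u @ v) (u' @ v') = tensor_entry \<rho> g u u' * tensor_entry \<rho> g v v'"
  using assms
proof (induction u u' rule: list_induct2)
  case (Cons x xs y ys)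
  have c: "tensor_entry \<rho> g (a # as) (b # bs) = \<rho> g $$ (a, b) * tensor_entry \<rho> g as bs" for a as b bs
    by (simp add: tensor_entry_def prod.lessThan_Suc_shift del: prod.lessThan_Suc)
  show ?case using Cons by (simp add: c)
qed (simp add: tensor_entry_def)

lemma tensor_act_tmul:
  assumes "t \<in> tensor_power n a" "u \<in> tensor_power n b"
  shows "ract (tensor_rep n \<rho> (a + b)) g (tmul t u) = tmul (ract (tensor_rep n \<rho> a) g t) (ract (tensor_rep n \<rho> b) g u)"
proof
  fix w
  show "ract (tensor_rep n \<rho> (a + b)) g (tmul t u) w = tmul (ract (tensor_rep n \<rho> a) g t) (ract (tensor_rep n \<rho> b) g u) w"
  proof (cases "w \<in> words n (a + b)")
    case True
    have lw: "length w = a + b" by (rule words_length[OF True])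
    have tw: "take a w \<in> words n a" "drop a w \<in> words n b" using words_append_iff[OF lw] True by blast+
    note bij = bij_betw_append_words[of n a b]
    have "ract (tensor_rep n \<rho> (a + b)) g (tmul t u) w = (\<Sum>v\<in>words n (a + b). tensor_entry \<rho> g w v * tmul t u v)"
      using True by (simp add: tensor_rep_act)
    also have "\<dots> = (\<Sum>z\<in>words n a \<times> words n b. tensor_entry \<rho> g w (case z of (x, y) \<Rightarrow> x @ y) * tmul t u (case z of (x, y) \<Rightarrow> x @ y))"
      by (rule sum.reindex_bij_betw[OF bij, symmetric])
    also have "\<dots> = (\<Sum>(x, y)\<in>words n a \<times> words n b. (tensor_entry \<rho> g (take a w) x * t x) * (tensor_entry \<rho> g (drop a w) y * u y))"
    proof (rule sum.cong[OF refl])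
      fix z assume "z \<in> words n a \<times> words n b"
      then obtain x y where z: "z = (x, y)" "x \<in> words n a" "y \<in> words n b" by blast
      have l: "length x = a" "length y = b" using z words_length by blast+
      have "tensor_entry \<rho> g (take a w @ drop a w) (x @ y) = tensor_entry \<rho> g (take a w) x * tensor_entry \<rho> g (drop a w) y"
        using l lw by (intro tensor_entry_append) simp
      hence "tensor_entry \<rho> g w (x @ y) = tensor_entry \<rho> g (take a w) x * tensor_entry \<rho> g (drop a w) y" by simp
      moreover have "tmul t u (x @ y) = t x * u y" using l by (simp add: tmul_homogeneous[OF assms])
      ultimately show "tensor_entry \<rho> g w (case z of (x, y) \<Rightarrow> x @ y) * tmul t u (case z of (x, y) \<Rightarrow> x @ y) =
          (case z of (x, y) \<Rightarrow> (tensor_entry \<rho> g (take a w) x * t x) * (tensor_entry \<rho> g (drop a w) y * u y))"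
        by (simp add: z(1))
    qed
    also have "\<dots> = (\<Sum>x\<in>words n a. \<Sum>y\<in>words n b. (tensor_entry \<rho> g (take a w) x * t x) * (tensor_entry \<rho> g (drop a w) y * u y))"
      by (rule sum.cartesian_product[symmetric])
    also have "\<dots> = (\<Sum>x\<in>words n a. tensor_entry \<rho> g (take a w) x * t x) * (\<Sum>y\<in>words n b. tensor_entry \<rho> g (drop a w) y * u y)"
      by (rule sum_product[symmetric])
    also have "\<dots> = tmul (ract (tensor_rep n \<rho> a) g t) (ract (tensor_rep n \<rho> b) g u) w"
      using tw lw by (simp add: tmul_homogeneous[OF tensor_rep_act_in tensor_rep_act_in] tensor_rep_act)
    finally show ?thesis .
  next
    case False
    thus ?thesis using tmul_in_tensor_power[OF tensor_rep_act_in[of n \<rho> a g t] tensor_rep_act_in[of n \<rho> b g u]] by (simp add: tensor_rep_act tensor_power_def)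
  qed
qed

lemma free_act_tmul: "free_act n \<rho> g (tmul t u) = tmul (free_act n \<rho> g t) (free_act n \<rho> g u)"
proof (rule part_ext)
  fix j
  have "part n j (free_act n \<rho> g (tmul t u)) = (\<Sum>l\<le>j. ract (tensor_rep n \<rho> j) g (tmul (part n l t) (part n (j - l) u)))"
    by (simp only: part_free_act part_tmul tensor_rep_act_sum)
  also have "\<dots> = (\<Sum>l\<le>j. tmul (ract (tensor_rep n \<rho> l) g (part n l t)) (ract (tensor_rep n \<rho> (j - l)) g (part n (j - l) u)))"
  proof (rule sum.cong[OF refl])
    fix l assume "l \<in> {..j}"
    thus "ract (tensor_rep n \<rho> j) g (tmul (part n l t) (part n (j - l) u)) =
        tmul (ract (tensor_rep n \<rho> l) g (part n l t)) (ract (tensor_rep n \<rho> (j - l)) g (part n (j - l) u))"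
      using tensor_act_tmul[OF part_in[of n l t] part_in[of n "j - l" u], of \<rho> g] by simp
  qed
  also have "\<dots> = part n j (tmul (free_act n \<rho> g t) (free_act n \<rho> g u))"
    by (simp only: part_free_act part_tmul)
  finally show "part n j (free_act n \<rho> g (tmul t u)) = part n j (tmul (free_act n \<rho> g t) (free_act n \<rho> g u))" .
qed (intro tmul_free free_act_free)+

text \<open>A \<open>G\<close>-stable graded two-sided ideal with a \<open>G\<close>-stable complement in every degree. The quotient
  algebra lives on the complement: a product is computed in the tensor algebra and replaced by its
  normal form, the representative in the complement modulo the ideal.\<close>

locale graded_ideal = algebraic_group m G for m :: nat and G :: "complex mat set" +
  fixes n :: nat and \<rho> :: "complex mat \<Rightarrow> complex mat"
    and I :: "nat \<Rightarrow> (nat list \<Rightarrow> complex) set" and C :: "nat \<Rightarrow> (nat list \<Rightarrow> complex) set"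
  assumes rational: "rational_rep m G n \<rho>"
    and compl: "complementary G (tensor_rep n \<rho> j) (C j) (I j)"
    and low: "I 0 = {0}" "I 1 = {0}"
    and ideal: "x \<in> words n l \<Longrightarrow> y \<in> words n r \<Longrightarrow> p \<in> I i \<Longrightarrow> sandwich x y p \<in> I (l + i + r)"
begin

lemma C_sub: "subrep G (tensor_rep n \<rho> j) (C j)" and I_sub: "subrep G (tensor_rep n \<rho> j) (I j)"
  using compl[of j] by (simp_all add: complementary_def)

lemma C_subspace: "fn.subspace (C j)" and C_tensor: "t \<in> C j \<Longrightarrow> t \<in> tensor_power n j"
  and I_subspace: "fn.subspace (I j)" and I_tensor: "t \<in> I j \<Longrightarrow> t \<in> tensor_power n j"
  using C_sub[of j] I_sub[of j] by (auto simp: subrep_def)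

lemma C_low: "C 0 = tensor_power n 0" "C 1 = tensor_power n 1"
  using compl[of 0] compl[of 1] low unfolding complementary_def by simp_all

lemma ideal_left: "t \<in> tensor_power n a \<Longrightarrow> p \<in> I b \<Longrightarrow> tmul t p \<in> I (a + b)"
proof -
  assume t: "t \<in> tensor_power n a" and p: "p \<in> I b"
  have "tmul t p = tmul (\<Sum>w\<in>words n a. fscale (t w) (delta w)) p" by (simp only: tensor_power_expand[OF t])
  also have "\<dots> = (\<Sum>w\<in>words n a. fscale (t w) (sandwich w [] p))"
    by (simp only: tmul_sum_left tmul_scale_left sandwich_def tmul_one_right)
  also have "\<dots> \<in> I (a + b)"
    using ideal[of _ a "[]" 0, OF _ _ p]
    by (intro fn.subspace_sum[OF I_subspace] fn.subspace_scale[OF I_subspace]) (simp add: words_0)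
  finally show ?thesis .
qed

lemma ideal_right: "t \<in> tensor_power n a \<Longrightarrow> p \<in> I b \<Longrightarrow> tmul p t \<in> I (b + a)"
proof -
  assume t: "t \<in> tensor_power n a" and p: "p \<in> I b"
  have "tmul p t = tmul p (\<Sum>w\<in>words n a. fscale (t w) (delta w))" by (simp only: tensor_power_expand[OF t])
  also have "\<dots> = (\<Sum>w\<in>words n a. fscale (t w) (sandwich [] w p))"
    by (simp only: tmul_sum_right tmul_scale_right sandwich_def tmul_one_left)
  also have "\<dots> \<in> I (b + a)"
    using ideal[of "[]" 0 _ a, OF _ _ p]
    by (intro fn.subspace_sum[OF I_subspace] fn.subspace_scale[OF I_subspace]) (simp add: words_0)
  finally show ?thesis .
qed

definition nf :: "(nat list \<Rightarrow> complex) \<Rightarrow> nat list \<Rightarrow> complex" where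
  "nf t = (\<lambda>w. proj_along (C (length w)) (I (length w)) (part n (length w) t) w)"

lemma nf_component:
  "proj_along (C j) (I j) (part n j t) \<in> C j" "part n j t - proj_along (C j) (I j) (part n j t) \<in> I j"
  using proj_along[OF linear_rep_tensor_rep compl, of "part n j t" j] by (simp_all add: part_in)

lemma part_nf: "part n j (nf t) = proj_along (C j) (I j) (part n j t)"
proof
  fix w
  have "proj_along (C j) (I j) (part n j t) \<in> tensor_power n j" by (rule C_tensor[OF nf_component(1)])
  thus "part n j (nf t) w = proj_along (C j) (I j) (part n j t) w"
    by (auto simp: part_def nf_def words_length tensor_power_def)
qed

lemma nf_free: "nf t \<in> free_space n"
proof -
  have "nf t w = 0" if "\<not> set w \<subseteq> {..<n}" for w
  proof -
    have "proj_along (C (length w)) (I (length w)) (part n (length w) t) \<in> tensor_power n (length w)"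
      by (rule C_tensor[OF nf_component(1)])
    thus ?thesis using that by (simp add: nf_def tensor_power_def words_def)
  qed
  thus ?thesis by (simp add: free_space_def coord_space_def)
qed

lemma proj_hom: "rep_hom G (tensor_rep n \<rho> j) (tensor_rep n \<rho> j) (proj_along (C j) (I j))"
  by (rule rep_hom_proj_along[OF linear_rep_tensor_rep compl])

lemma nf_add: "nf (t + u) = nf t + nf u"
proof
  fix w show "nf (t + u) w = (nf t + nf u) w"
    using rep_homD(2)[OF proj_hom[of "length w"], of "part n (length w) t" "part n (length w) u"]
    by (simp add: nf_def part_add part_in)
qed

lemma nf_scale: "nf (fscale c t) = fscale c (nf t)"
proof
  fix w show "nf (fscale c t) w = fscale c (nf t) w"
    using rep_homD(3)[OF proj_hom[of "length w"], of "part n (length w) t" c]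
    by (simp add: nf_def part_scale part_in)
qed

lemma nf_zero: "nf 0 = 0"
  using nf_scale[of 0 0] by simp

lemma nf_sum: "nf (\<Sum>s\<in>S. f s) = (\<Sum>s\<in>S. nf (f s))"
  by (induction S rule: infinite_finite_induct)
    (simp_all only: sum.infinite sum.empty sum.insert not_False_eq_True nf_zero nf_add)

lemma nf_homogeneous:
  assumes "t \<in> tensor_power n j"
  shows "nf t = proj_along (C j) (I j) t"
proof (rule part_ext[OF nf_free])
  have c: "proj_along (C j) (I j) t \<in> tensor_power n j"
    using nf_component(1)[of j t] C_tensor assms by (simp add: part_self)
  show "proj_along (C j) (I j) t \<in> free_space n" by (rule tensor_power_free[OF c])
  fix i
  have "proj_along (C i) (I i) 0 = 0" by (rule rep_hom_zero[OF linear_rep_tensor_rep linear_rep_tensor_rep proj_hom])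
  thus "part n i (nf t) = part n i (proj_along (C j) (I j) t)"
    using assms c by (cases "i = j") (simp_all add: part_nf part_self part_other)
qed

lemma nf_in: "t \<in> tensor_power n j \<Longrightarrow> nf t \<in> C j"
  using nf_component(1)[of j t] by (simp add: nf_homogeneous part_self)

lemma nf_eq_zero_iff: "t \<in> tensor_power n j \<Longrightarrow> nf t = 0 \<longleftrightarrow> t \<in> I j"
  using proj_along_zero_iff[OF linear_rep_tensor_rep compl, of t j] by (simp add: nf_homogeneous)

text \<open>The kernel of the normal form: the completion of the ideal, together with the functions that vanish
  on all words over the given letters.\<close>

definition full_ideal :: "(nat list \<Rightarrow> complex) set" where
  "full_ideal = {t. \<forall>j. part n j t \<in> I j}"

lemma nf_full_ideal: "t \<in> full_ideal \<Longrightarrow> nf t = 0"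
proof (rule part_ext[OF nf_free])
  fix j assume t: "t \<in> full_ideal"
  hence "proj_along (C j) (I j) (part n j t) = 0"
    using proj_along_zero_iff[OF linear_rep_tensor_rep compl, of "part n j t" j]
    by (simp add: full_ideal_def part_in)
  thus "part n j (nf t) = part n j 0" by (simp add: part_nf) (simp add: part_def fun_eq_iff)
qed (rule fn.subspace_0[OF subspace_free])

lemma diff_nf: "t - nf t \<in> full_ideal"
  using nf_component(2) by (simp add: full_ideal_def part_diff part_nf)

lemma full_ideal_mult:
  assumes "p \<in> full_ideal"
  shows "tmul t p \<in> full_ideal" "tmul p t \<in> full_ideal"
proof -
  have p: "part n j p \<in> I j" for j using assms by (simp add: full_ideal_def)
  have "tmul (part n l t) (part n (j - l) p) \<in> I j" "tmul (part n l p) (part n (j - l) t) \<in> I j" if "l \<le> j" for l j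
    using ideal_left[OF part_in[of n l t] p[of "j - l"]] ideal_right[OF part_in[of n "j - l" t] p[of l]] that by simp_all
  hence "part n j (tmul t p) \<in> I j" "part n j (tmul p t) \<in> I j" for j
    unfolding part_tmul by (intro fn.subspace_sum[OF I_subspace]; simp)+
  thus "tmul t p \<in> full_ideal" "tmul p t \<in> full_ideal" by (simp_all add: full_ideal_def)
qed

text \<open>Normal forms may be taken before or after multiplying, because the ideal is two-sided. This is the
  associativity of the quotient.\<close>

lemma nf_mult_nf: "nf (tmul t (nf u)) = nf (tmul t u)" "nf (tmul (nf t) u) = nf (tmul t u)"
proof -
  have 1: "nf (tmul t (u - nf u)) = 0" by (intro nf_full_ideal full_ideal_mult diff_nf)
  have "tmul t u = tmul t (u - nf u) + tmul t (nf u)" by (simp add: tmul_add_right[symmetric])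
  thus "nf (tmul t (nf u)) = nf (tmul t u)" using 1 by (simp add: nf_add)
  have 2: "nf (tmul (t - nf t) u) = 0" by (intro nf_full_ideal full_ideal_mult diff_nf)
  have "tmul t u = tmul (t - nf t) u + tmul (nf t) u" by (simp add: tmul_add_left[symmetric])
  thus "nf (tmul (nf t) u) = nf (tmul t u)" using 2 by (simp add: nf_add)
qed

lemma nf_act: "g \<in> G \<Longrightarrow> nf (free_act n \<rho> g t) = free_act n \<rho> g (nf t)"
proof (rule part_ext[OF nf_free free_act_free])
  fix j assume g: "g \<in> G"
  show "part n j (nf (free_act n \<rho> g t)) = part n j (free_act n \<rho> g (nf t))"
    using rep_homD(4)[OF proj_hom[of j] g, of "part n j t"] by (simp add: part_nf part_free_act part_in)
qed

definition quotient_algebra :: "(nat list \<Rightarrow> complex) galg" where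
  "quotient_algebra = \<lparr>gcomp = C, gscale = fscale, gmult = (\<lambda>a b. nf (tmul a b)), gone = delta [],
     gact = free_act n \<rho>\<rparr>"

lemma quotient_simps [simp]:
  "gcomp quotient_algebra = C" "gscale quotient_algebra = fscale"
  "gmult quotient_algebra a b = nf (tmul a b)" "gone quotient_algebra = delta []"
  "gact quotient_algebra = free_act n \<rho>"
  by (simp_all add: quotient_algebra_def)

text \<open>Both properties are linear and hold on the complements, which span the algebra.\<close>

lemma nf_fixed: "a \<in> alg_space quotient_algebra \<Longrightarrow> nf a = a"
  and alg_space_free: "a \<in> alg_space quotient_algebra \<Longrightarrow> a \<in> free_space n"
proof -
  have sub: "fn.subspace {a \<in> free_space n. nf a = a}"
    using subspace_free[of n] by (auto simp: fn.subspace_def nf_zero nf_add nf_scale)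
  have "c \<in> free_space n \<and> nf c = c" if "c \<in> C i" for c i
    using proj_along_fixed_iff[OF linear_rep_tensor_rep compl, of c i] that C_tensor[OF that]
    by (simp add: nf_homogeneous tensor_power_free)
  hence "(\<Union>i. C i) \<subseteq> {a \<in> free_space n. nf a = a}" by blast
  from fn.span_minimal[OF this sub]
  have "alg_space quotient_algebra \<subseteq> {a \<in> free_space n. nf a = a}" by (simp add: alg_space_def)
  thus "a \<in> alg_space quotient_algebra \<Longrightarrow> nf a = a" "a \<in> alg_space quotient_algebra \<Longrightarrow> a \<in> free_space n"
    by blast+
qed

lemma C_alg_space: "c \<in> C i \<Longrightarrow> c \<in> alg_space quotient_algebra"
  unfolding alg_space_def quotient_simps by (rule fn.span_base) blast

lemma nf_delta_Cons: "nf (delta (i # w)) = nf (tmul (delta [i]) (nf (delta w)))"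
  by (simp add: nf_mult_nf tmul_delta)

lemma delta_letter: "i < n \<Longrightarrow> delta [i] \<in> C 1"
  unfolding C_low by (intro delta_in_tensor_power) (simp add: words_def)

lemma connected_quotient: "connected_graded_algebra quotient_algebra"
proof (intro connected_graded_algebra.intro connected_graded_algebra_axioms.intro; (unfold quotient_simps)?)
  show "vector_space (fscale :: complex \<Rightarrow> (nat list \<Rightarrow> complex) \<Rightarrow> _)" by (rule fn.vector_space_axioms)
  show "fn.subspace (C i)" for i by (rule C_subspace)
  show "x i = 0" if fin: "finite S" and x: "\<And>i. i \<in> S \<Longrightarrow> x i \<in> C i" and z: "(\<Sum>i\<in>S. x i) = 0" and i: "i \<in> S" for S x i
  proof
    fix w
    show "x i w = 0 w"
    proof (cases "w \<in> words n i")
      case True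
      have "(\<Sum>k\<in>S. x k w) = (\<Sum>k\<in>S. if k = i then x i w else 0)"
      proof (rule sum.cong[OF refl])
        fix k assume "k \<in> S"
        hence "k \<noteq> i \<Longrightarrow> x k w = 0" using C_tensor[OF x] True by (auto simp: tensor_power_def words_def)
        thus "x k w = (if k = i then x i w else 0)" by auto
      qed
      thus ?thesis using fun_cong[OF z, of w] fin i by simp
    next
      case False
      thus ?thesis using C_tensor[OF x[OF i]] by (simp add: tensor_power_def)
    qed
  qed
  show "nf (tmul a b) \<in> C (i + j)" if "a \<in> C i" "b \<in> C j" for a b i j
    using that by (intro nf_in tmul_in_tensor_power C_tensor)
  show "nf (tmul (a + b) c) = nf (tmul a c) + nf (tmul b c)" for a b c by (simp add: tmul_add_left nf_add)
  show "nf (tmul a (b + c)) = nf (tmul a b) + nf (tmul a c)" for a b c by (simp add: tmul_add_right nf_add)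
  show "nf (tmul (fscale z a) b) = fscale z (nf (tmul a b))" for z a b by (simp add: tmul_scale_left nf_scale)
  show "nf (tmul a (fscale z b)) = fscale z (nf (tmul a b))" for z a b by (simp add: tmul_scale_right nf_scale)
  show "nf (tmul (nf (tmul a b)) c) = nf (tmul a (nf (tmul b c)))" for a b c
    by (simp add: nf_mult_nf tmul_assoc)
  show "nf (tmul (delta []) a) = a" if "a \<in> alg_space quotient_algebra" for a
    using nf_fixed[OF that] by (simp add: tmul_one_left)
  show "nf (tmul a (delta [])) = a" if "a \<in> alg_space quotient_algebra" for a
    using nf_fixed[OF that] by (simp add: tmul_one_right)
  show "delta [] \<noteq> (0 :: nat list \<Rightarrow> complex)" by (auto simp: delta_def fun_eq_iff)
  have e: "delta [] \<in> tensor_power n 0" by (intro delta_in_tensor_power) (simp add: words_0)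
  have T: "tensor_power n 0 \<subseteq> fn.span {delta []}"
    using coord_space_subset_span[of "words n 0"] by (simp add: tensor_power_eq_coord_space words_0)
  show "C 0 = fn.span {delta []}"
  proof
    show "C 0 \<subseteq> fn.span {delta []}" using T by (simp add: C_low)
    show "fn.span {delta []} \<subseteq> C 0" using e by (intro fn.span_minimal C_subspace) (simp add: C_low)
  qed
  show "alg_space quotient_algebra \<subseteq> S"
    if S: "fn.subspace S" "delta [] \<in> S" "C 1 \<subseteq> S"
      and closed: "\<And>a b. a \<in> S \<Longrightarrow> b \<in> S \<Longrightarrow> a \<in> alg_space quotient_algebra \<Longrightarrow> b \<in> alg_space quotient_algebra \<Longrightarrow> nf (tmul a b) \<in> S" for S
  proof -
    have w: "nf (delta w) \<in> S" if "set w \<subseteq> {..<n}" for w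
      using that
    proof (induction w)
      case Nil
      have "nf (delta []) = delta []"
        using e by (intro nf_fixed C_alg_space[of _ 0]) (simp add: C_low)
      thus ?case using S(2) by simp
    next
      case (Cons i w)
      have "delta [i] \<in> C 1" using Cons.prems by (intro delta_letter) simp
      moreover have "nf (delta w) \<in> C (length w)"
        using Cons.prems by (intro nf_in delta_in_tensor_power) (simp add: words_def)
      ultimately show ?case
        unfolding nf_delta_Cons using Cons S(3) by (intro closed C_alg_space) auto
    qed
    have "C j \<subseteq> S" for j
    proof
      fix c assume c: "c \<in> C j"
      have "c = nf c" using nf_fixed[OF C_alg_space[OF c]] by simp
      also have "\<dots> = nf (\<Sum>w\<in>words n j. fscale (c w) (delta w))" by (simp only: tensor_power_expand[OF C_tensor[OF c]])
      also have "\<dots> = (\<Sum>w\<in>words n j. fscale (c w) (nf (delta w)))" by (simp only: nf_sum nf_scale)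
      also have "\<dots> \<in> S" using w by (intro fn.subspace_sum[OF S(1)] fn.subspace_scale[OF S(1)]) (auto simp: words_def)
      finally show "c \<in> S" .
    qed
    hence "(\<Union>i. C i) \<subseteq> S" by blast
    from fn.span_minimal[OF this S(1)] show ?thesis by (simp add: alg_space_def)
  qed
  show "\<exists>S. finite S \<and> C 1 = fn.span S"
  proof (intro exI conjI)
    show "finite (delta ` words n 1)" by (simp add: finite_words)
    show "C 1 = fn.span (delta ` words n 1)"
    proof
      show "C 1 \<subseteq> fn.span (delta ` words n 1)"
        using coord_space_subset_span[OF finite_words] by (simp add: C_low tensor_power_eq_coord_space del: One_nat_def)
      show "fn.span (delta ` words n 1) \<subseteq> C 1"
        using delta_in_tensor_power by (intro fn.span_minimal C_subspace) (auto simp: C_low simp del: One_nat_def)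
    qed
  qed
qed

lemma G_algebra_quotient: "G_algebra m G quotient_algebra"
proof (intro G_algebra.intro connected_quotient G_algebra_axioms.intro; (unfold quotient_simps)?)
  show "free_act n \<rho> g a \<in> C i" if "g \<in> G" "a \<in> C i" for g a i
    using C_sub[of i] that C_tensor[OF that(2)] by (simp add: free_act_homogeneous subrep_def)
  show "free_act n \<rho> g (a + b) = free_act n \<rho> g a + free_act n \<rho> g b" for g a b by (rule free_act_add)
  show "free_act n \<rho> g (fscale z a) = fscale z (free_act n \<rho> g a)" for g z a by (rule free_act_scale)
  show "free_act n \<rho> g (nf (tmul a b)) = nf (tmul (free_act n \<rho> g a) (free_act n \<rho> g b))" if "g \<in> G" for g a b
    using nf_act[OF that] by (simp add: free_act_tmul[symmetric])
  show "free_act n \<rho> g (delta []) = delta []" if "g \<in> G" for g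
  proof
    fix w
    show "free_act n \<rho> g (delta []) w = delta [] w"
    proof (cases "w = []")
      case True
      thus ?thesis by (simp add: free_act_def tensor_rep_act words_0 tensor_entry_def delta_def)
    next
      case False
      hence "(\<Sum>u\<in>words n (length w). tensor_entry \<rho> g w u * delta [] u) = 0"
        by (intro sum.neutral) (auto simp: words_def delta_def)
      thus ?thesis using False by (simp add: free_act_def tensor_rep_act delta_def)
    qed
  qed
  show "free_act n \<rho> (1\<^sub>m m) a = a" if "a \<in> alg_space quotient_algebra" for a
    by (rule part_ext[OF free_act_free alg_space_free[OF that]])
      (simp add: part_free_act tensor_rep_one[OF rational part_in])
  show "free_act n \<rho> (g * h) a = free_act n \<rho> g (free_act n \<rho> h a)" if "g \<in> G" "h \<in> G" for g h a
    by (rule part_ext[OF free_act_free free_act_free])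
      (simp add: part_free_act tensor_rep_mult[OF rational that])
qed

definition letters :: "(nat \<Rightarrow> complex) \<Rightarrow> nat list \<Rightarrow> complex" where
  "letters x = (\<lambda>w. if w \<in> words n 1 then x (hd w) else 0)"

lemma words_1: "w \<in> words n 1 \<longleftrightarrow> (\<exists>i<n. w = [i])"
  by (cases w) (auto simp: words_def)

lemma letters_iso: "rep_iso G (mat_rep n \<rho>) (comp_rep quotient_algebra 1) letters"
proof (rule rep_hom_kernel_iso[OF linear_rep_mat_rep])
  have C1: "x \<in> C 1 \<longleftrightarrow> x \<in> tensor_power n 1" for x by (simp only: C_low)
  have lin: "letters x \<in> C 1" for x unfolding C1 by (simp add: letters_def tensor_power_def)
  have "linear_rep G (restrict_rep (tensor_rep n \<rho> 1) (C 1))"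
    by (rule linear_rep_of_subrep[OF linear_rep_tensor_rep C_sub])
  then interpret L: linear_rep G "restrict_rep (tensor_rep n \<rho> 1) (C 1)" .
  show "linear_rep G (comp_rep quotient_algebra 1)"
  proof (intro linear_rep_fscaleI)
    show "fn.subspace (rspace (comp_rep quotient_algebra 1))" using C_subspace by simp
    fix g x assume "g \<in> G" "x \<in> rspace (comp_rep quotient_algebra 1)"
    thus "ract (comp_rep quotient_algebra 1) g x \<in> rspace (comp_rep quotient_algebra 1)"
      using L.act_closed[of g x] C_tensor[of x 1] by (simp add: free_act_homogeneous[of x n 1])
  qed (simp_all add: free_act_add free_act_scale)
  show "rep_hom G (mat_rep n \<rho>) (comp_rep quotient_algebra 1) letters"
  proof (rule rep_homI)
    show "letters x \<in> rspace (comp_rep quotient_algebra 1)" for x using lin by simp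
    show "letters (x + y) = letters x + letters y" for x y by (auto simp: letters_def fun_eq_iff)
    show "letters (rscale (mat_rep n \<rho>) c x) = rscale (comp_rep quotient_algebra 1) c (letters x)" for c x
      by (auto simp: letters_def fun_eq_iff)
    show "letters (ract (mat_rep n \<rho>) g x) = ract (comp_rep quotient_algebra 1) g (letters x)" for g x
    proof -
      have "letters (ract (mat_rep n \<rho>) g x) w = ract (tensor_rep n \<rho> 1) g (letters x) w" for w
      proof (cases "w \<in> words n 1")
        case True
        then obtain i where i: "i < n" "w = [i]" using words_1 by blast
        have "ract (tensor_rep n \<rho> 1) g (letters x) w = (\<Sum>u\<in>words n (Suc 0). tensor_entry \<rho> g [i] u * letters x u)"
          using True by (simp add: tensor_rep_act i(2))
        also have "\<dots> = (\<Sum>k<n. \<rho> g $$ (i, k) * x k)"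
          unfolding sum_words_Suc words_0
          by (intro sum.cong) (auto simp: tensor_entry_def letters_def words_def)
        also have "\<dots> = letters (ract (mat_rep n \<rho>) g x) w"
          using True i by (simp add: letters_def mat_rep_def)
        finally show ?thesis by simp
      next
        case False
        thus ?thesis by (simp add: letters_def tensor_rep_act)
      qed
      hence "letters (ract (mat_rep n \<rho>) g x) = ract (tensor_rep n \<rho> 1) g (letters x)" by blast
      thus ?thesis using free_act_homogeneous[of "letters x" n 1 \<rho> g] lin[of x] by (simp add: C1 del: One_nat_def)
    qed
  qed
  show "x = 0" if "x \<in> rspace (mat_rep n \<rho>)" "letters x = 0" for x
  proof
    fix i show "x i = 0 i"
      using fun_cong[OF that(2), of "[i]"] that(1) by (cases "i < n") (simp_all add: letters_def words_def cspace_def)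
  qed
  show "rspace (comp_rep quotient_algebra 1) \<subseteq> letters ` rspace (mat_rep n \<rho>)"
  proof
    fix t assume "t \<in> rspace (comp_rep quotient_algebra 1)"
    hence t: "t \<in> tensor_power n 1" by (simp add: C1 del: One_nat_def)
    define x where "x i = (if i < n then t [i] else 0)" for i
    have "t = letters x"
    proof
      fix w show "t w = letters x w"
        using t words_1[of w] by (auto simp: letters_def tensor_power_def x_def simp del: One_nat_def)
    qed
    moreover have "x \<in> rspace (mat_rep n \<rho>)" by (simp add: x_def cspace_def)
    ultimately show "t \<in> letters ` rspace (mat_rep n \<rho>)" by blast
  qed
qed

lemma letters_unit: "i < n \<Longrightarrow> letters (unit_vector i) = delta [i]"
  by (auto simp: letters_def unit_vector_def delta_def fun_eq_iff words_1 simp del: One_nat_def)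

lemma presented_quotient: "presented_algebra m G quotient_algebra n \<rho> letters"
  by (intro presented_algebra.intro G_algebra_quotient presented_algebra_axioms.intro letters_iso)

text \<open>The natural projection to the quotient is the normal form, since it is multiplicative and agrees
  with it on letters.\<close>

lemma relations_quotient: "relations quotient_algebra letters n j = I j"
proof -
  interpret B: presented_algebra m G quotient_algebra n \<rho> letters by (rule presented_quotient)
  have mono: "B.monomial w = nf (delta w)" if "set w \<subseteq> {..<n}" for w
    using that
  proof (induction w)
    case Nil
    have "delta [] \<in> C 0" unfolding C_low by (intro delta_in_tensor_power) (simp add: words_0)
    hence "nf (delta []) = delta []" by (intro nf_fixed C_alg_space)
    thus ?case by simp
  next
    case (Cons i w)
    thus ?case by (simp add: nf_delta_Cons B.gen_def letters_unit)
  qed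
  have "proj_map quotient_algebra letters n j t = nf t" if t: "t \<in> tensor_power n j" for t
  proof -
    have "proj_map quotient_algebra letters n j t = (\<Sum>w\<in>words n j. fscale (t w) (nf (delta w)))"
      unfolding B.proj_map_eq by (rule sum.cong) (auto simp: mono words_def)
    also have "\<dots> = nf (\<Sum>w\<in>words n j. fscale (t w) (delta w))" by (simp only: nf_sum nf_scale)
    finally show ?thesis by (simp only: tensor_power_expand[OF t])
  qed
  hence "t \<in> relations quotient_algebra letters n j \<longleftrightarrow> t \<in> I j" for t
    using nf_eq_zero_iff[of t j] I_tensor[of t j] unfolding relations_def by (cases "t \<in> tensor_power n j") auto
  thus ?thesis by blast
qed

lemma comp_quotient_iso: "rep_iso G (restrict_rep (tensor_rep n \<rho> j) (C j)) (comp_rep quotient_algebra j) (\<lambda>x. x)"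
  by (auto simp: rep_iso_def bij_betw_def free_act_homogeneous[OF C_tensor])

end

section \<open>Deformations from points of the parameter set\<close>

lemma (in presented_algebra) relations_0: "relations A \<psi> n 0 = {0}"
proof -
  have "t = 0" if "t \<in> relations A \<psi> n 0" for t
  proof
    fix w
    have t: "t \<in> tensor_power n 0" "gscale A (t []) (gone A) = 0"
      using that by (simp_all add: relations_def proj_map_eq words_0)
    hence "t [] = 0" using connected(1) by simp
    thus "t w = 0 w" using t(1) by (cases "w = []") (simp_all add: tensor_power_def words_0)
  qed
  moreover have "0 \<in> relations A \<psi> n 0"
    using subrep_relations[of 0] fn.subspace_0 by (auto simp: subrep_def)
  ultimately show ?thesis by blast
qed

text \<open>A tuple in the parameter set is completed to an ideal by zero in degrees below two and by
  everything in degrees above \<open>k\<close>, so the ideal condition in these degrees is trivial. The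
  quotient has the right components: in one and the same tensor power, isomorphic subrepresentations
  have isomorphic complements.\<close>

lemma param_set_realized:
  assumes red: "reductive_group m G" and rat: "rational_rep m G n \<rho>"
    and A: "presented_algebra m G A n \<rho> \<psi>"
    and P: "P \<in> param_set G n \<rho> (relations A \<psi> n) k"
  shows "\<exists>(B :: (nat list \<Rightarrow> complex) galg) \<eta>.
          G_deformation m G n \<rho> A k B \<and> rep_iso G (mat_rep n \<rho>) (comp_rep B 1) \<eta> \<and>
          P = (\<lambda>j\<in>{2..k}. relations B \<eta> n j)"
proof -
  interpret A: presented_algebra m G A n \<rho> \<psi> by fact
  interpret ag: algebraic_group m G using red by unfold_locales (simp add: reductive_group_def)
  let ?T = "tensor_rep n \<rho>"
  have ss: "semisimple_rep G (?T j) m (words n j)" for j by (rule ag.semisimple_tensor_rep[OF red rat])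
  have P': "P \<in> (\<Pi>\<^sub>E j\<in>{2..k}. subreps_like G n \<rho> j (relations A \<psi> n j))"
    and Pideal: "\<And>i j l. 2 \<le> i \<Longrightarrow> i \<le> j \<Longrightarrow> j \<le> k \<Longrightarrow> l \<le> j - i \<Longrightarrow> tensor_sandwich n l (P i) (j - i - l) \<subseteq> P j"
    using P by (simp_all add: param_set_def)
  have PS: "subrep G (?T j) (P j)"
    and Piso: "rep_isomorphic G (restrict_rep (?T j) (P j)) (restrict_rep (?T j) (relations A \<psi> n j))"
    if "2 \<le> j" "j \<le> k" for j
    using PiE_mem[OF P', of j] that by (simp_all add: subreps_like_def)
  define I where "I j = (if j < 2 then {0} else if j \<le> k then P j else tensor_power n j)" for j
  have z: "subrep G (?T j) {0}" for j
  proof -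
    interpret T: linear_rep G "?T j" by (rule linear_rep_tensor_rep)
    have "ract (?T j) g 0 = 0" for g by (auto simp: fun_eq_iff tensor_rep_act)
    thus ?thesis using fn.subspace_0[OF subspace_tensor_power] by (simp add: subrep_def fn.subspace_def)
  qed
  have Isub: "subrep G (?T j) (I j)" for j
    using z PS linear_rep.subrep_self[OF linear_rep_tensor_rep, of G n \<rho> j] by (simp add: I_def)
  have "\<exists>C. complementary G (?T j) C (I j)" for j
    using completely_reducibleD[OF semisimple_rep.reducible[OF ss] Isub] complementary_sym by blast
  hence "\<forall>j. \<exists>C. complementary G (?T j) C (I j)" by (rule allI)
  from choice[OF this] obtain C where C: "\<And>j. complementary G (?T j) (C j) (I j)" by blast
  have ideal: "sandwich x y p \<in> I (l + i + r)" if x: "x \<in> words n l" and y: "y \<in> words n r" and p: "p \<in> I i" for x y p l i r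
  proof (cases "i < 2")
    case True
    hence "p = 0" using p by (simp add: I_def)
    hence "sandwich x y p = 0" by (simp add: sandwich_def tmul_zero_left tmul_zero_right)
    thus ?thesis using Isub[of "l + i + r"] fn.subspace_0[of "I (l + i + r)"] by (simp add: subrep_def)
  next
    case i: False
    have pT: "p \<in> tensor_power n i" using p Isub[of i] by (auto simp: subrep_def)
    show ?thesis
    proof (cases "l + i + r \<le> k")
      case True
      have "fn.subspace (P (l + i + r))" using PS[of "l + i + r"] i True by (simp add: subrep_def)
      moreover have "tensor_sandwich n l (P i) r \<subseteq> P (l + i + r)"
        using Pideal[of i "l + i + r" l] i True by simp
      moreover have "p \<in> P i" using p i True by (simp add: I_def)
      ultimately have "sandwich x y p \<in> P (l + i + r)"
        using x y by (simp add: tensor_sandwich_subset_iff)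
      thus ?thesis using i True by (simp add: I_def)
    next
      case False
      thus ?thesis using sandwich_in[OF x y pT] i by (simp add: I_def)
    qed
  qed
  interpret Q: graded_ideal m G n \<rho> I C
    by unfold_locales (use rat C ideal in \<open>simp_all add: I_def\<close>)
  let ?B = Q.quotient_algebra
  have sC: "subrep G (?T j) (C j)" for j using C[of j] by (simp add: complementary_def)
  have linC: "linear_rep G (restrict_rep (?T j) (C j))" for j
    by (rule linear_rep_of_subrep[OF linear_rep_tensor_rep sC])
  have BC: "rep_isomorphic G (comp_rep ?B j) (restrict_rep (?T j) (C j))" for j
    using linear_rep.rep_iso_inv[OF linC Q.comp_quotient_iso] by (auto simp: rep_isomorphic_def)
  have BV: "rep_isomorphic G (comp_rep ?B 1) (mat_rep n \<rho>)"
    using linear_rep.rep_iso_inv[OF linear_rep_mat_rep Q.letters_iso] by (auto simp: rep_isomorphic_def)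
  have CA: "rep_isomorphic G (restrict_rep (?T j) (C j)) (comp_rep A j)" if "j \<le> k" "j \<noteq> 1" for j
  proof (cases "j = 0")
    case True
    have "complementary G (?T 0) (relations A \<psi> n 0) (C 0)"
      using complementary_sym[OF C[of 0]] by (simp add: A.relations_0 I_def)
    from A.complement_relations_iso[OF this] show ?thesis by (auto simp: True rep_isomorphic_def)
  next
    case False
    hence j: "2 \<le> j" using that by simp
    interpret S: semisimple_rep G "?T j" m "words n j" by (rule ss)
    obtain CA where CA: "complementary G (?T j) (relations A \<psi> n j) CA"
      using completely_reducibleD[OF S.reducible A.subrep_relations] by blast
    have "rep_isomorphic G (restrict_rep (?T j) (I j)) (restrict_rep (?T j) (relations A \<psi> n j))"
      using Piso[OF j that(1)] j that(1) by (simp add: I_def)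
    from S.complement_cancel[OF C complementary_sym[OF CA] this]
    have 1: "rep_isomorphic G (restrict_rep (?T j) (C j)) (restrict_rep (?T j) CA)" .
    have 2: "rep_isomorphic G (restrict_rep (?T j) CA) (comp_rep A j)"
      using A.complement_relations_iso[OF CA] by (auto simp: rep_isomorphic_def)
    show ?thesis by (rule rep_isomorphic_trans[OF 1 2])
  qed
  have "rep_isomorphic G (comp_rep ?B j) (comp_rep A j)" if "j \<le> k" for j
  proof (cases "j = 1")
    case True
    have "rep_isomorphic G (mat_rep n \<rho>) (comp_rep A 1)" using A.\<psi> by (auto simp: rep_isomorphic_def)
    from rep_isomorphic_trans[OF BV this] show ?thesis unfolding True .
  next
    case False
    show ?thesis by (rule rep_isomorphic_trans[OF BC CA[OF that False]])
  qed
  hence "G_deformation m G n \<rho> A k ?B"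
    using Q.G_algebra_quotient BV by (simp add: G_deformation_def)
  moreover have "P = (\<lambda>j\<in>{2..k}. relations ?B Q.letters n j)"
  proof
    fix j
    show "P j = (\<lambda>j\<in>{2..k}. relations ?B Q.letters n j) j"
    proof (cases "j \<in> {2..k}")
      case True
      thus ?thesis by (simp add: Q.relations_quotient I_def)
    next
      case False
      thus ?thesis using PiE_arb[OF P' False] by (simp only: restrict_apply if_False)
    qed
  qed
  ultimately show ?thesis using Q.letters_iso by blast
qed

theorem theorem2p1p3:
  fixes m n k :: nat
    and G :: "complex mat set"
    and \<rho> :: "complex mat \<Rightarrow> complex mat"
    and A :: "('a::ab_group_add) galg"
    and \<psi> :: "(nat \<Rightarrow> complex) \<Rightarrow> 'a"
  assumes "reductive_group m G"
    and "rational_rep m G n \<rho>"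
    and "inj_on \<rho> G"
    and "G_algebra m G A"
    and "rep_iso G (mat_rep n \<rho>) (comp_rep A 1) \<psi>"
    and "k \<ge> 2"
  shows
    "(\<exists>D. \<forall>j\<in>{2..k}.
        isotypic_decomposition m G (tensor_rep n \<rho> j) (relations A \<psi> n j) (D j)) \<and>
     (\<forall>D. (\<forall>j\<in>{2..k}.
        isotypic_decomposition m G (tensor_rep n \<rho> j) (relations A \<psi> n j) (D j)) \<longrightarrow>
        bij_betw (schur_map k D) (grass_product k D)
          (\<Pi>\<^sub>E j\<in>{2..k}. subreps_like G n \<rho> j (relations A \<psi> n j)) \<and>
        zariski_closed (grass_index k D) (grass_f D) (grass_a D)
          {X \<in> grass_product k D. schur_map k D X \<in> param_set G n \<rho> (relations A \<psi> n) k}) \<and>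
     (\<forall>(B :: ('b::ab_group_add) galg) \<eta>.
        G_deformation m G n \<rho> A k B \<longrightarrow> rep_iso G (mat_rep n \<rho>) (comp_rep B 1) \<eta> \<longrightarrow>
        (\<lambda>j\<in>{2..k}. relations B \<eta> n j) \<in> param_set G n \<rho> (relations A \<psi> n) k) \<and>
     (\<forall>P \<in> param_set G n \<rho> (relations A \<psi> n) k.
        \<exists>(B :: (nat list \<Rightarrow> complex) galg) \<eta>.
          G_deformation m G n \<rho> A k B \<and> rep_iso G (mat_rep n \<rho>) (comp_rep B 1) \<eta> \<and>
          P = (\<lambda>j\<in>{2..k}. relations B \<eta> n j))"
proof -
  have red: "reductive_group m G" and rat: "rational_rep m G n \<rho>" by fact+
  have A: "presented_algebra m G A n \<rho> \<psi>"
    using assms(4,5) by (intro presented_algebra.intro presented_algebra_axioms.intro)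
  interpret ag: algebraic_group m G using red by unfold_locales (simp add: reductive_group_def)
  have ss: "semisimple_rep G (tensor_rep n \<rho> j) m (words n j)" for j
    by (rule ag.semisimple_tensor_rep[OF red rat])
  have K: "subrep G (tensor_rep n \<rho> j) (relations A \<psi> n j)" for j
    by (rule presented_algebra.subrep_relations[OF A])
  have 1: "\<exists>D. \<forall>j\<in>{2..k}.
        isotypic_decomposition m G (tensor_rep n \<rho> j) (relations A \<psi> n j) (D j)"
  proof -
    have "\<forall>j. \<exists>D. isotypic_decomposition m G (tensor_rep n \<rho> j) (relations A \<psi> n j) D"
      using semisimple_rep.isotypic_decomposition_exists[OF ss K] by (rule allI)
    from choice[OF this] show ?thesis by blast
  qed
  have 2: "bij_betw (schur_map k D) (grass_product k D)
          (\<Pi>\<^sub>E j\<in>{2..k}. subreps_like G n \<rho> j (relations A \<psi> n j)) \<and>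
        zariski_closed (grass_index k D) (grass_f D) (grass_a D)
          {X \<in> grass_product k D. schur_map k D X \<in> param_set G n \<rho> (relations A \<psi> n) k}"
    if "\<forall>j\<in>{2..k}. isotypic_decomposition m G (tensor_rep n \<rho> j) (relations A \<psi> n j) (D j)" for D
    using schur_map_bij[OF ss K bspec[OF that]] param_set_closed[OF ss K bspec[OF that]] by (rule conjI)
  have 3: "(\<lambda>j\<in>{2..k}. relations B \<eta> n j) \<in> param_set G n \<rho> (relations A \<psi> n) k"
    if B: "G_deformation m G n \<rho> A k B" and \<eta>: "rep_iso G (mat_rep n \<rho>) (comp_rep B 1) \<eta>"
    for B :: "('b::ab_group_add) galg" and \<eta>
  proof -
    have "presented_algebra m G B n \<rho> \<eta>"
      using B \<eta> by (intro presented_algebra.intro presented_algebra_axioms.intro) (simp_all add: G_deformation_def)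
    thus ?thesis using B by (intro relations_in_param_set[OF A _ ss]) (simp_all add: G_deformation_def)
  qed
  show ?thesis
    using 1 2 3 param_set_realized[OF red rat A] by blast
qed

end
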